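(* Let $a\in\mathbb{Z}_{\geq -1}$, let $\rho$ be the largest root of $x^3-ax^2-(a+3)x-1$, let $K=\mathbb{Q}(\rho)$ be the corresponding simplest cubic field, and assume that its ring of integers is $\mathcal{O}_K=\mathbb{Z}[\rho]$. Then: (1) there is a diagonal universal quadratic form of rank $3(a^2+3a+6)$ over $K$; (2) every classical universal quadratic form over $K$ has rank at least $\frac{a^2+3a+8}{6}$; (3) if $a\geq 21$, every (not necessarily classical) universal quadratic form over $K$ has rank at least $\frac{\sqrt{a^2+3a+8}}{3\sqrt{2}}$.
   Context: The field $K$ is totally real. An element $\alpha\in K$ is totally positive ($\alpha\succ 0$) if $\sigma(\alpha)>0$ for all embeddings $\sigma:K\hookrightarrow\mathbb{R}$; $\mathcal{O}_K^+$ is the set of totally positive elements of $\mathcal{O}_K$. A quadratic form of rank $r$ over $\mathcal{O}_K$ is $Q(x)=\sum_{1\leq i\leq j\leq r}a_{ij}x_ix_j$ with $a_{ij}\in\mathcal{O}_K$. It is totally positive if $Q(v)\succ 0$ for all $0\neq v\in\mathcal{O}_K^r$; diagonal if $a_{ij}=0$ for all $i\neq j$; classical if $2\mid a_{ij}$ in $\mathcal{O}_K$ for all $i\neq j$. It is universal (over $K$) if it is totally positive and for every $\alpha\in\mathcal{O}_K^+$ there is $v\in\mathcal{O}_K^r$ with $Q(v)=\alpha$. *)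

theory Defs
  imports Complex_Main "HOL-Computational_Algebra.Computational_Algebra"
begin

section \<open>Number fields as subfields of an ambient field\<close>

definition is_subfield :: "'a::field set \<Rightarrow> bool" where
  "is_subfield F \<longleftrightarrow> 0 \<in> F \<and> 1 \<in> F
     \<and> (\<forall>x\<in>F. \<forall>y\<in>F. x + y \<in> F \<and> x - y \<in> F \<and> x * y \<in> F)
     \<and> (\<forall>x\<in>F. inverse x \<in> F)"

text \<open>In characteristic \<open>0\<close> every subfield contains the rationals, so the following is
  \<open>\<rat>(\<rho>)\<close>.\<close>

definition rat_adjoin :: "'a::field_char_0 \<Rightarrow> 'a set" where
  "rat_adjoin \<rho> = \<Inter>{F. is_subfield F \<and> \<rho> \<in> F}"

definition int_adjoin :: "'a::field_char_0 \<Rightarrow> 'a set" where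
  "int_adjoin \<rho> = {poly p \<rho> | p. \<forall>i. coeff p i \<in> \<int>}"

definition ring_of_integers :: "'a::field_char_0 set \<Rightarrow> 'a set" where
  "ring_of_integers K = {x \<in> K. algebraic_int x}"

text \<open>An embedding is represented by a total function of which only the values on \<open>K\<close>
  matter. Injectivity is automatic, as \<open>K\<close> is a field and \<open>\<sigma> 1 = 1\<close>.\<close>

definition real_embedding :: "'a::field_char_0 set \<Rightarrow> ('a \<Rightarrow> real) \<Rightarrow> bool" where
  "real_embedding K \<sigma> \<longleftrightarrow> \<sigma> 1 = 1
     \<and> (\<forall>x\<in>K. \<forall>y\<in>K. \<sigma> (x + y) = \<sigma> x + \<sigma> y \<and> \<sigma> (x * y) = \<sigma> x * \<sigma> y)"

definition totally_positive :: "'a::field_char_0 set \<Rightarrow> 'a \<Rightarrow> bool" where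
  "totally_positive K \<alpha> \<longleftrightarrow> \<alpha> \<in> K \<and> (\<forall>\<sigma>. real_embedding K \<sigma> \<longrightarrow> \<sigma> \<alpha> > 0)"


section \<open>Quadratic forms over the ring of integers\<close>

text \<open>A form of rank \<open>r\<close> is given by its coefficients \<open>A i j\<close> with \<open>i \<le> j < r\<close> (indices start
  at \<open>0\<close>), a vector of length \<open>r\<close> by its entries \<open>v i\<close> with \<open>i < r\<close>; all other values of
  \<open>A\<close> and \<open>v\<close> are irrelevant.\<close>

definition is_quadratic_form :: "'a::field_char_0 set \<Rightarrow> nat \<Rightarrow> (nat \<Rightarrow> nat \<Rightarrow> 'a) \<Rightarrow> bool" where
  "is_quadratic_form K r A \<longleftrightarrow> (\<forall>i j. i \<le> j \<and> j < r \<longrightarrow> A i j \<in> ring_of_integers K)"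

definition form_value :: "nat \<Rightarrow> (nat \<Rightarrow> nat \<Rightarrow> 'a::field_char_0) \<Rightarrow> (nat \<Rightarrow> 'a) \<Rightarrow> 'a" where
  "form_value r A v = (\<Sum>i<r. \<Sum>j\<in>{i..<r}. A i j * v i * v j)"

definition integral_vector :: "'a::field_char_0 set \<Rightarrow> nat \<Rightarrow> (nat \<Rightarrow> 'a) \<Rightarrow> bool" where
  "integral_vector K r v \<longleftrightarrow> (\<forall>i<r. v i \<in> ring_of_integers K)"

definition totally_positive_form ::
    "'a::field_char_0 set \<Rightarrow> nat \<Rightarrow> (nat \<Rightarrow> nat \<Rightarrow> 'a) \<Rightarrow> bool" where
  "totally_positive_form K r A \<longleftrightarrow>
     (\<forall>v. integral_vector K r v \<and> (\<exists>i<r. v i \<noteq> 0) \<longrightarrow> totally_positive K (form_value r A v))"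

definition diagonal_form :: "nat \<Rightarrow> (nat \<Rightarrow> nat \<Rightarrow> 'a::field_char_0) \<Rightarrow> bool" where
  "diagonal_form r A \<longleftrightarrow> (\<forall>i j. i < j \<and> j < r \<longrightarrow> A i j = 0)"

definition classical_form :: "'a::field_char_0 set \<Rightarrow> nat \<Rightarrow> (nat \<Rightarrow> nat \<Rightarrow> 'a) \<Rightarrow> bool" where
  "classical_form K r A \<longleftrightarrow>
     (\<forall>i j. i < j \<and> j < r \<longrightarrow> (\<exists>b \<in> ring_of_integers K. A i j = 2 * b))"

definition universal_form :: "'a::field_char_0 set \<Rightarrow> nat \<Rightarrow> (nat \<Rightarrow> nat \<Rightarrow> 'a) \<Rightarrow> bool" where
  "universal_form K r A \<longleftrightarrow> is_quadratic_form K r A \<and> totally_positive_form K r A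
     \<and> (\<forall>\<alpha> \<in> ring_of_integers K. totally_positive K \<alpha> \<longrightarrow>
          (\<exists>v. integral_vector K r v \<and> form_value r A v = \<alpha>))"

end

theory Submission
  imports Defs "HOL-Analysis.Analysis"
begin

text \<open>
  Let \<open>e\<^sub>1 = 1\<close>, \<open>e\<^sub>2 = \<rho>\<^sup>2\<close>, \<open>e\<^sub>3 = (1 + \<rho>)\<^sup>2\<close>, \<open>e\<^sub>4 = (\<rho> / (1 + \<rho>))\<^sup>2\<close>. Every totally positive integer lies,
  up to the square of a unit, in one of the cones \<open>\<langle>e\<^sub>1, e\<^sub>2, e\<^sub>3\<rangle>\<close> and \<open>\<langle>e\<^sub>1, e\<^sub>2, e\<^sub>4\<rangle>\<close>: each cone comes with a
  functional \<open>\<beta> \<mapsto> Tr (\<delta> \<beta>)\<close> that is positive on totally positive elements and constant on the generators,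
  and comparing the values at a minimum over the orbit \<open>\<alpha> u\<^sup>2\<close> gives exactly the inequalities of the
  cone. The generators are squares and a natural number is a sum of four squares, so twelve variables
  with coefficient \<open>1\<close> together with one variable for each nonzero point of the two half-open
  parallelepipeds suffice if \<open>a \<ge> 0\<close>. If \<open>a = -1\<close>, the second cone can be cut so that every piece
  contains an associate of \<open>1 + \<rho> + \<rho>\<^sup>2\<close>, and four variables with that coefficient and eight with
  coefficient \<open>1\<close> suffice.

  For the lower bounds let \<open>\<delta>\<close> be the codifferent element of the second cone. The \<open>(a\<^sup>2 + 3 a + 8) / 2\<close> lattice
  points of its triangle have \<open>Tr (\<delta> \<alpha>) = 1\<close>, so they are represented by vectors of norm \<open>1\<close> in
  the lattice of rank \<open>3 r\<close> with quadratic form \<open>Tr (\<delta> Q)\<close>. If \<open>Q\<close> is classical, these vectors are orthonormal.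
  In general, after scaling, they have norm \<open>2\<close> and mutual inner products in \<open>{-1, 0, 1}\<close>. If every
  vector is non-orthogonal to at most \<open>d\<close> others, then \<open>N\<close> such vectors in dimension \<open>n\<close> satisfy
  \<open>N \<le> n (1 + d / 4)\<close>, and an argument in the style of Lemmens and Seidel for equiangular lines gives
  \<open>d \<le> max 56 (4 n - 4)\<close>.
\<close>

section \<open>Sums of four squares\<close>

definition sum4 :: "int \<Rightarrow> bool" where
  "sum4 n \<longleftrightarrow> (\<exists>a b c d. n = a\<^sup>2 + b\<^sup>2 + c\<^sup>2 + d\<^sup>2)"

lemma sum4I: "n = a\<^sup>2 + b\<^sup>2 + c\<^sup>2 + d\<^sup>2 \<Longrightarrow> sum4 n"
  unfolding sum4_def by blast

lemma euler_four_square: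
  fixes a b c d x y z w :: int
  shows "(a\<^sup>2 + b\<^sup>2 + c\<^sup>2 + d\<^sup>2) * (x\<^sup>2 + y\<^sup>2 + z\<^sup>2 + w\<^sup>2) =
    (a*x + b*y + c*z + d*w)\<^sup>2 + (a*y - b*x + c*w - d*z)\<^sup>2 +
    (a*z - b*w - c*x + d*y)\<^sup>2 + (a*w + b*z - c*y - d*x)\<^sup>2"
  by (simp add: power2_eq_square algebra_simps)

lemma sum4_mult: "sum4 m \<Longrightarrow> sum4 n \<Longrightarrow> sum4 (m * n)"
  unfolding sum4_def using euler_four_square by metis

text \<open>The absolutely least residue modulo \<open>m\<close>; its bound is stated for squares,
  the form in which the descent adds it up.\<close>

lemma centered_residue:
  fixes x m :: int
  assumes "m > 0"
  obtains y k where "x = y + m * k" "4 * y\<^sup>2 \<le> m\<^sup>2"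
proof -
  define e where "e = x mod m"
  have e: "0 \<le> e" "e < m" "x = e + m * (x div m)" using assms unfolding e_def by auto
  show ?thesis
  proof (cases "2 * e \<le> m")
    case True
    then have "(2 * e)\<^sup>2 \<le> m\<^sup>2" using e(1) by (intro power_mono) auto
    then show ?thesis using that[OF e(3)] by (simp add: power_mult_distrib)
  next
    case False
    then have "(2 * (m - e))\<^sup>2 \<le> m\<^sup>2" using e(2) by (intro power_mono) auto
    then have "4 * (e - m)\<^sup>2 \<le> m\<^sup>2" by (simp add: power2_eq_square algebra_simps)
    moreover have "x = (e - m) + m * (x div m + 1)" using e(3) by (simp add: algebra_simps)
    ultimately show ?thesis using that by blast
  qed
qed

text \<open>Lagrange's descent: reducing the four roots modulo \<open>m\<close> gives
  \<open>x, y, z, w\<close>, whose squares add up to \<open>m r\<close> with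
  \<open>r \<le> m\<close>. All four terms of Euler's identity for the product of \<open>m p\<close>
  and \<open>m r\<close> are divisible by \<open>m\<close>, and dividing by \<open>m\<^sup>2\<close>
  leaves \<open>r p\<close>.\<close>

lemma sum4_descent:
  fixes m p :: int
  assumes p: "prime p" and m: "1 < m" "m < p" and s: "sum4 (m * p)"
  shows "\<exists>r. 0 < r \<and> r < m \<and> sum4 (r * p)"
proof -
  obtain a b c d where abcd: "m * p = a\<^sup>2 + b\<^sup>2 + c\<^sup>2 + d\<^sup>2" using s unfolding sum4_def by blast
  have m0: "m > 0" using m by simp
  obtain x k1 where x: "a = x + m * k1" "4 * x\<^sup>2 \<le> m\<^sup>2" using centered_residue[OF m0] by blast
  obtain y k2 where y: "b = y + m * k2" "4 * y\<^sup>2 \<le> m\<^sup>2" using centered_residue[OF m0] by blast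
  obtain z k3 where z: "c = z + m * k3" "4 * z\<^sup>2 \<le> m\<^sup>2" using centered_residue[OF m0] by blast
  obtain w k4 where w: "d = w + m * k4" "4 * w\<^sup>2 \<le> m\<^sup>2" using centered_residue[OF m0] by blast
  \<comment> \<open>The quotient of \<open>x\<^sup>2 + y\<^sup>2 + z\<^sup>2 + w\<^sup>2\<close> by
    \<open>m\<close>, written without a division.\<close>
  define r where "r = p - 2 * (x * k1 + y * k2 + z * k3 + w * k4) - m * (k1\<^sup>2 + k2\<^sup>2 + k3\<^sup>2 + k4\<^sup>2)"
  have rm: "m * r = x\<^sup>2 + y\<^sup>2 + z\<^sup>2 + w\<^sup>2"
  proof -
    have "m * r = m * p - 2 * m * (x * k1 + y * k2 + z * k3 + w * k4) - m\<^sup>2 * (k1\<^sup>2 + k2\<^sup>2 + k3\<^sup>2 + k4\<^sup>2)"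
      unfolding r_def by (simp add: algebra_simps power2_eq_square)
    then show ?thesis unfolding abcd x(1) y(1) z(1) w(1)
      by (simp add: algebra_simps power2_eq_square)
  qed
  \<comment> \<open>Both extremes \<open>r = 0\<close> and \<open>r = m\<close> are excluded below
    because they would make \<open>m\<close> divide \<open>p\<close>.\<close>
  have ndvd: "\<not> m dvd p"
  proof
    assume "m dvd p"
    moreover have "\<forall>k. 0 \<le> k \<and> k dvd p \<longrightarrow> k = 1 \<or> k = p" using p prime_int_iff[of p] by blast
    ultimately have "m = 1 \<or> m = p" using m0 by (meson less_imp_le)
    then show False using m by simp
  qed
  have "m * r \<ge> 0" unfolding rm by simp
  then have r0: "r \<ge> 0" using m0 by (simp add: zero_le_mult_iff)
  have "r \<noteq> 0"
  proof
    assume "r = 0"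
    then have "x\<^sup>2 + y\<^sup>2 + z\<^sup>2 + w\<^sup>2 = 0" using rm by simp
    then have "x = 0" "y = 0" "z = 0" "w = 0"
      by (smt (verit) zero_le_power2 power2_eq_iff_nonneg zero_eq_power2)+
    then have "p = m * (k1\<^sup>2 + k2\<^sup>2 + k3\<^sup>2 + k4\<^sup>2)" using r_def \<open>r = 0\<close> by simp
    then show False using ndvd by auto
  qed
  moreover have le: "4 * (m * r) \<le> 4 * m\<^sup>2" unfolding rm using x(2) y(2) z(2) w(2) by simp
  then have "m * r \<le> m * m" by (simp add: power2_eq_square)
  then have "r \<le> m" using m0 by simp
  moreover have "r \<noteq> m"
  proof
    assume rr: "r = m"
    then have "4 * m\<^sup>2 = 4 * x\<^sup>2 + 4 * y\<^sup>2 + 4 * z\<^sup>2 + 4 * w\<^sup>2" using rm by (simp add: power2_eq_square)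
    then have *: "4 * x\<^sup>2 = m\<^sup>2" "4 * y\<^sup>2 = m\<^sup>2" "4 * z\<^sup>2 = m\<^sup>2" "4 * w\<^sup>2 = m\<^sup>2"
      using x(2) y(2) z(2) w(2) by linarith+
    have h: "2 * t = m \<or> 2 * t = - m" if "4 * t\<^sup>2 = m\<^sup>2" for t :: int
    proof -
      have "(2 * t)\<^sup>2 = m\<^sup>2" using that by (simp add: power_mult_distrib)
      then show ?thesis by (simp only: power2_eq_iff)
    qed
    have h': "m dvd 2 * t" if "4 * t\<^sup>2 = m\<^sup>2" for t :: int using h[OF that] by auto
    have "p = r + 2 * (x * k1 + y * k2 + z * k3 + w * k4) + m * (k1\<^sup>2 + k2\<^sup>2 + k3\<^sup>2 + k4\<^sup>2)"
      unfolding r_def by simp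
    also have "\<dots> = m + ((2 * x) * k1 + (2 * y) * k2 + (2 * z) * k3 + (2 * w) * k4) + m * (k1\<^sup>2 + k2\<^sup>2 + k3\<^sup>2 + k4\<^sup>2)"
      using rr by (simp add: algebra_simps)
    finally have "m dvd p" using h'[OF *(1)] h'[OF *(2)] h'[OF *(3)] h'[OF *(4)] by simp
    then show False using ndvd by simp
  qed
  moreover have "sum4 (r * p)"
  proof -
    \<comment> \<open>The terms of Euler's identity divided by \<open>m\<close>.\<close>
    define z1 z2 z3 z4 where
      "z1 = p - (k1 * a + k2 * b + k3 * c + k4 * d)" and
      "z2 = k1 * b - k2 * a + k3 * d - k4 * c" and
      "z3 = k1 * c - k2 * d - k3 * a + k4 * b" and
      "z4 = k1 * d + k2 * c - k3 * b - k4 * a"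
    have e1: "a * x + b * y + c * z + d * w = m * z1"
    proof -
      have "m * z1 = m * p - m * (k1 * a + k2 * b + k3 * c + k4 * d)"
        unfolding z1_def by (simp add: algebra_simps)
      then show ?thesis unfolding abcd x(1) y(1) z(1) w(1) by (simp add: algebra_simps power2_eq_square)
    qed
    have e2: "a * y - b * x + c * w - d * z = m * z2"
      "a * z - b * w - c * x + d * y = m * z3" "a * w + b * z - c * y - d * x = m * z4"
      unfolding z2_def z3_def z4_def x(1) y(1) z(1) w(1) by (simp_all add: algebra_simps)
    have "(m * p) * (m * r) = (m * z1)\<^sup>2 + (m * z2)\<^sup>2 + (m * z3)\<^sup>2 + (m * z4)\<^sup>2"
      unfolding rm abcd euler_four_square e1 e2 by (rule refl)
    then have "m\<^sup>2 * (r * p) = m\<^sup>2 * (z1\<^sup>2 + z2\<^sup>2 + z3\<^sup>2 + z4\<^sup>2)"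
      by (simp add: algebra_simps power2_eq_square)
    then have "r * p = z1\<^sup>2 + z2\<^sup>2 + z3\<^sup>2 + z4\<^sup>2" using m0 by simp
    then show ?thesis by (rule sum4I)
  qed
  ultimately show ?thesis using r0 by (intro exI[of _ r]) auto
qed

text \<open>Pigeonhole: for \<open>x\<close> and \<open>y\<close> from \<open>0\<close> to
  \<open>h = (p - 1) / 2\<close> the values \<open>x\<^sup>2\<close> and
  \<open>- 1 - y\<^sup>2\<close> give two sets of \<open>h + 1\<close> residues each, too many to be
  disjoint among \<open>p\<close> residues. A common residue gives
  \<open>x\<^sup>2 + y\<^sup>2 + 1 = p m\<close>, and the size of \<open>x\<close> and
  \<open>y\<close> gives \<open>m < p\<close>.\<close>

lemma prime_dvd_two_squares_plus_one:
  fixes p :: int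
  assumes "prime p" "odd p"
  shows "\<exists>m. 0 < m \<and> m < p \<and> sum4 (m * p)"
proof -
  have p3: "p \<ge> 3" using prime_ge_2_int[OF assms(1)] assms(2) by (cases "p = 2") auto
  define h where "h = (p - 1) div 2"
  have ph: "p = 2 * h + 1" using assms(2) unfolding h_def by (auto elim!: oddE)
  have h1: "h \<ge> 1" using p3 ph by simp
  have inj: "inj_on (\<lambda>x. x\<^sup>2 mod p) {0..h}"
  proof (rule inj_onI)
    fix x y assume xy: "x \<in> {0..h}" "y \<in> {0..h}" "x\<^sup>2 mod p = y\<^sup>2 mod p"
    then have "p dvd x\<^sup>2 - y\<^sup>2" using mod_eq_dvd_iff by blast
    then have "p dvd (x - y) * (x + y)" by (simp add: power2_eq_square algebra_simps)
    then have "p dvd x - y \<or> p dvd x + y" using assms(1) prime_dvd_mult_iff by blast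
    then show "x = y"
    proof
      assume d: "p dvd x - y"
      have "\<bar>x - y\<bar> < p" using xy ph by auto
      then show ?thesis using d dvd_imp_le_int[of "x - y" p] by force
    next
      assume d: "p dvd x + y"
      have "\<bar>x + y\<bar> < p" using xy ph by auto
      then have "x + y = 0" using d dvd_imp_le_int[of "x + y" p] by force
      then show ?thesis using xy by auto
    qed
  qed
  define S T where "S = (\<lambda>x. x\<^sup>2 mod p) ` {0..h}" and "T = (\<lambda>s. (- 1 - s) mod p) ` S"
  have cS: "card S = nat (h + 1)" unfolding S_def card_image[OF inj] by simp
  have Ssub: "S \<subseteq> {0..<p}" unfolding S_def using p3 by auto
  have injT: "inj_on (\<lambda>s. (- 1 - s) mod p) S"
  proof (rule inj_onI)
    fix s t assume st: "s \<in> S" "t \<in> S" "(- 1 - s) mod p = (- 1 - t) mod p"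
    then have "p dvd (- 1 - s) - (- 1 - t)" using mod_eq_dvd_iff by blast
    then have "p dvd t - s" by simp
    moreover have "s \<in> {0..<p}" "t \<in> {0..<p}" using st Ssub by blast+
    then have "\<bar>t - s\<bar> < p" by auto
    ultimately show "s = t" using dvd_imp_le_int[of "t - s" p] by force
  qed
  have cT: "card T = nat (h + 1)" unfolding T_def card_image[OF injT] cS ..
  have Tsub: "T \<subseteq> {0..<p}" unfolding T_def using p3 by auto
  have fin: "finite S" "finite T" using Ssub Tsub finite_subset by blast+
  have "S \<inter> T \<noteq> {}"
  proof
    assume "S \<inter> T = {}"
    then have "card (S \<union> T) = nat (h + 1) + nat (h + 1)"
      using card_Un_disjoint[OF fin] cS cT by simp
    moreover have "card (S \<union> T) \<le> card {0..<p}" using Ssub Tsub by (intro card_mono) auto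
    ultimately show False using ph h1 by simp
  qed
  then obtain x y where xy: "x \<in> {0..h}" "y \<in> {0..h}" "x\<^sup>2 mod p = (- 1 - y\<^sup>2 mod p) mod p"
    unfolding S_def T_def by blast
  then have "x\<^sup>2 mod p = (- 1 - y\<^sup>2) mod p" by (simp add: mod_diff_right_eq)
  then have "p dvd x\<^sup>2 - (- 1 - y\<^sup>2)" using mod_eq_dvd_iff by blast
  then obtain m where m: "x\<^sup>2 + y\<^sup>2 + 1 = p * m" unfolding dvd_def by (auto simp: algebra_simps)
  have "p * m > 0" unfolding m[symmetric] by (smt (verit) zero_le_power2)
  then have "m > 0" using p3 by (simp add: zero_less_mult_iff)
  have "x\<^sup>2 \<le> h\<^sup>2" "y\<^sup>2 \<le> h\<^sup>2" using xy by (auto intro: power_mono)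
  then have "p * m \<le> 2 * h\<^sup>2 + 1" using m by linarith
  also have "\<dots> < p * p" using h1 zero_le_square[of h] unfolding ph power2_eq_square distrib_left distrib_right
    by linarith
  finally have "m < p" using p3 by simp
  moreover have "sum4 (m * p)" using m by (intro sum4I[of _ x y 1 0]) (simp add: algebra_simps)
  ultimately show ?thesis using \<open>m > 0\<close> by blast
qed

lemma sum4_prime:
  fixes p :: int
  assumes "prime p"
  shows "sum4 p"
proof (cases "odd p")
  case True
  have "sum4 p" if "0 < m" "m < p" "sum4 (m * p)" for m
    using that
  proof (induction "nat m" arbitrary: m rule: less_induct)
    case less
    show ?case
    proof (cases "m = 1")
      case True
      then show ?thesis using less by simp
    next
      case False
      then obtain r where "0 < r" "r < m" "sum4 (r * p)"
        using sum4_descent[OF assms, of m] less.prems by auto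
      then show ?thesis using less by auto
    qed
  qed
  then show ?thesis using prime_dvd_two_squares_plus_one[OF assms True] by blast
next
  case False
  then have "p = 2" using assms prime_odd_int[of p] prime_ge_2_int[of p] by force
  then show ?thesis by (intro sum4I[of _ 1 1 0 0]) simp
qed

text \<open>Induction along the prime factorisation: the descent covers primes, Euler's identity
  covers products.\<close>

theorem four_squares:
  fixes n :: int
  assumes "n \<ge> 0"
  obtains a b c d :: int where "n = a\<^sup>2 + b\<^sup>2 + c\<^sup>2 + d\<^sup>2"
proof -
  have "sum4 (int k)" for k :: nat
  proof (induction k rule: prime_divisors_induct)
    case zero
    show ?case by (intro sum4I[of _ 0 0 0 0]) simp
  next
    case (unit u)
    then show ?case by (intro sum4I[of _ 1 0 0 0]) simp
  next
    case (factor q x)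
    then show ?case using sum4_mult[OF sum4_prime[of "int q"]] by simp
  qed
  from this[of "nat n"] show ?thesis using that assms unfolding sum4_def by auto
qed

section \<open>Finite families of vectors\<close>

text \<open>Vectors are total functions of which only the coordinates in \<open>I\<close> matter, so
  \<open>card I\<close> is the dimension.\<close>

definition dot :: "'i set \<Rightarrow> ('i \<Rightarrow> real) \<Rightarrow> ('i \<Rightarrow> real) \<Rightarrow> real" where
  "dot I x y = (\<Sum>i\<in>I. x i * y i)"

lemma dot_commute: "dot I x y = dot I y x"
  unfolding dot_def by (simp add: mult.commute)

lemma dot_simps:
  "dot I (\<lambda>i. x i + y i) z = dot I x z + dot I y z"
  "dot I (\<lambda>i. x i - y i) z = dot I x z - dot I y z"
  "dot I (\<lambda>i. - x i) z = - dot I x z"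
  "dot I (\<lambda>i. c * x i) z = c * dot I x z"
  "dot I (\<lambda>i. x i / c) z = dot I x z / c"
  "dot I z (\<lambda>i. x i + y i) = dot I z x + dot I z y"
  "dot I z (\<lambda>i. x i - y i) = dot I z x - dot I z y"
  "dot I z (\<lambda>i. - x i) = - dot I z x"
  "dot I z (\<lambda>i. c * x i) = c * dot I z x"
  "dot I z (\<lambda>i. x i / c) = dot I z x / c"
  unfolding dot_def
  by (simp_all add: algebra_simps sum.distrib sum_subtractf sum_negf sum_distrib_left sum_divide_distrib)

lemma dot_sum_left: "dot I (\<lambda>i. \<Sum>s\<in>S. X s i) z = (\<Sum>s\<in>S. dot I (X s) z)"
  unfolding dot_def by (simp add: sum_distrib_right sum.swap[of _ I])

lemma dot_sum_right: "dot I z (\<lambda>i. \<Sum>s\<in>S. X s i) = (\<Sum>s\<in>S. dot I z (X s))"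
  unfolding dot_def by (simp add: sum_distrib_left sum.swap[of _ I])

lemma dot_self_nonneg: "dot I x x \<ge> 0"
  unfolding dot_def by (intro sum_nonneg) simp

lemma dot_self_zero:
  assumes "finite I" "dot I x x = 0" "i \<in> I"
  shows "x i = 0"
  using assms unfolding dot_def by (subst (asm) sum_nonneg_eq_0_iff) auto

text \<open>The hypothesis says that \<open>x - y\<close> has norm \<open>0\<close>. Equality of
  vectors is expressed through inner products because the functions may differ outside
  \<open>I\<close>.\<close>

lemma dot_eq_if_close:
  assumes "finite I" "dot I x x + dot I y y = 2 * dot I x y"
  shows "dot I x w = dot I y w"
proof -
  have "dot I (\<lambda>i. x i - y i) (\<lambda>i. x i - y i) = 0"
    using assms(2) by (simp add: dot_simps dot_commute[of I y x])
  then have "\<And>i. i \<in> I \<Longrightarrow> x i - y i = 0" using dot_self_zero[OF assms(1)] by blast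
  then show ?thesis unfolding dot_def by (intro sum.cong) auto
qed

lemma dot_cauchy_schwarz: "(dot I x y)\<^sup>2 \<le> dot I x x * dot I y y"
  using Cauchy_Schwarz_ineq_sum[of x y I] unfolding dot_def by (simp add: power2_eq_square)

text \<open>The left side is the squared trace of the frame operator \<open>G\<close>, and the
  double sum is its squared Frobenius norm. Cauchy-Schwarz on the diagonal of \<open>G\<close>
  compares the two.\<close>

lemma frame_inequality:
  fixes X :: "'a \<Rightarrow> 'i \<Rightarrow> real"
  assumes "finite I" "finite S"
  shows "(\<Sum>s\<in>S. dot I (X s) (X s))\<^sup>2 \<le> card I * (\<Sum>s\<in>S. \<Sum>t\<in>S. (dot I (X s) (X t))\<^sup>2)"
proof -
  define G where "G i j = (\<Sum>s\<in>S. X s i * X s j)" for i j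
  have "(\<Sum>s\<in>S. \<Sum>t\<in>S. (dot I (X s) (X t))\<^sup>2) = 
     (\<Sum>s\<in>S. \<Sum>t\<in>S. \<Sum>i\<in>I. \<Sum>j\<in>I. (X s i * X s j) * (X t i * X t j))"
    unfolding dot_def power2_eq_square sum_product by (simp add: mult_ac)
  also have "\<dots> = (\<Sum>s\<in>S. \<Sum>i\<in>I. \<Sum>j\<in>I. \<Sum>t\<in>S. (X s i * X s j) * (X t i * X t j))"
    by (intro sum.cong refl) (subst sum.swap, intro sum.cong refl, subst sum.swap, rule refl)
  also have "\<dots> = (\<Sum>i\<in>I. \<Sum>j\<in>I. \<Sum>s\<in>S. \<Sum>t\<in>S. (X s i * X s j) * (X t i * X t j))"
    by (subst sum.swap, intro sum.cong refl, subst sum.swap, rule refl)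
  also have "\<dots> = (\<Sum>i\<in>I. \<Sum>j\<in>I. (G i j)\<^sup>2)"
    unfolding G_def power2_eq_square sum_product ..
  finally have F: "(\<Sum>s\<in>S. \<Sum>t\<in>S. (dot I (X s) (X t))\<^sup>2) = (\<Sum>i\<in>I. \<Sum>j\<in>I. (G i j)\<^sup>2)" .
  have "(\<Sum>i\<in>I. (G i i)\<^sup>2) \<le> (\<Sum>i\<in>I. \<Sum>j\<in>I. (G i j)\<^sup>2)"
    using assms(1) by (intro sum_mono member_le_sum) auto
  moreover have "(\<Sum>i\<in>I. G i i)\<^sup>2 \<le> card I * (\<Sum>i\<in>I. (G i i)\<^sup>2)"
    using Cauchy_Schwarz_ineq_sum[of "\<lambda>_. 1" "\<lambda>i. G i i" I] by simp
  moreover have "(\<Sum>s\<in>S. dot I (X s) (X s)) = (\<Sum>i\<in>I. G i i)"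
    unfolding dot_def G_def by (rule sum.swap)
  ultimately show ?thesis unfolding F by (smt (verit) mult_left_mono of_nat_0_le_iff)
qed

text \<open>The frame inequality takes the place of linear independence: for \<open>N\<close>
  vectors in dimension \<open>n\<close> it reads
  \<open>(N c)\<^sup>2 \<le> n N c\<^sup>2\<close>.\<close>

lemma card_le_if_orthogonal:
  fixes X :: "'a \<Rightarrow> 'i \<Rightarrow> real"
  assumes "finite I" "finite S" "c > 0"
    and "\<And>s. s \<in> S \<Longrightarrow> dot I (X s) (X s) = c"
    and "\<And>s t. s \<in> S \<Longrightarrow> t \<in> S \<Longrightarrow> s \<noteq> t \<Longrightarrow> dot I (X s) (X t) = 0"
  shows "card S \<le> card I"
proof -
  have "(\<Sum>t\<in>S. (dot I (X s) (X t))\<^sup>2) = c\<^sup>2" if "s \<in> S" for s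
  proof -
    have "(\<Sum>t\<in>S. (dot I (X s) (X t))\<^sup>2) = (\<Sum>t\<in>S. if s = t then c\<^sup>2 else 0)"
      using assms that by (intro sum.cong) auto
    then show ?thesis using that assms by simp
  qed
  then have "(card S * c)\<^sup>2 \<le> card I * (card S * c\<^sup>2)"
    using frame_inequality[OF assms(1,2), of X] assms(4) by simp
  then have "real (card S) * (card S * c\<^sup>2) \<le> card I * (card S * c\<^sup>2)"
    by (simp add: power2_eq_square mult_ac)
  then show ?thesis using assms(3) by (cases "card S = 0") auto
qed

text \<open>Duality: the left side \<open>C\<close> is the inner product of \<open>w\<close> with
  \<open>V\<close>, the combination of the \<open>X s\<close> with coefficients \<open>c s\<close>.
  Since \<open>V\<close> has squared norm at most \<open>B C\<close>, Cauchy-Schwarz gives the claim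
  after cancelling \<open>C\<close>.\<close>

lemma bombieri_inequality:
  fixes X :: "'a \<Rightarrow> 'i \<Rightarrow> real"
  assumes "finite I" "finite S"
    and B: "B \<ge> 0" "\<And>s. s \<in> S \<Longrightarrow> (\<Sum>t\<in>S. \<bar>dot I (X s) (X t)\<bar>) \<le> B"
  shows "(\<Sum>s\<in>S. (dot I (X s) w)\<^sup>2) \<le> B * dot I w w"
proof -
  define c where "c s = dot I (X s) w" for s
  define V where "V = (\<lambda>i. \<Sum>s\<in>S. c s * X s i)"
  define C where "C = (\<Sum>s\<in>S. (c s)\<^sup>2)"
  have C0: "C \<ge> 0" unfolding C_def by (simp add: sum_nonneg)
  have CV: "C = dot I V w" unfolding V_def C_def dot_sum_left dot_simps c_def
    by (simp add: power2_eq_square)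
  have "dot I V V = (\<Sum>s\<in>S. \<Sum>t\<in>S. c s * c t * dot I (X s) (X t))"
    unfolding V_def dot_sum_left dot_simps dot_sum_right by (simp add: sum_distrib_left mult_ac)
  \<comment> \<open>The mean inequality separates \<open>c s\<close> from \<open>c t\<close>, so
    that only row sums of the Gram matrix remain.\<close>
  also have "\<dots> \<le> (\<Sum>s\<in>S. \<Sum>t\<in>S. ((c s)\<^sup>2 + (c t)\<^sup>2) / 2 * \<bar>dot I (X s) (X t)\<bar>)"
  proof (intro sum_mono)
    fix s t
    have "\<bar>c s * c t\<bar> \<le> ((c s)\<^sup>2 + (c t)\<^sup>2) / 2"
      using sum_squares_bound[of "\<bar>c s\<bar>" "\<bar>c t\<bar>"] by (simp add: abs_mult)
    then have "\<bar>c s * c t\<bar> * \<bar>dot I (X s) (X t)\<bar> \<le> ((c s)\<^sup>2 + (c t)\<^sup>2) / 2 * \<bar>dot I (X s) (X t)\<bar>"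
      by (rule mult_right_mono) simp
    then show "c s * c t * dot I (X s) (X t) \<le> ((c s)\<^sup>2 + (c t)\<^sup>2) / 2 * \<bar>dot I (X s) (X t)\<bar>"
      by (metis abs_mult abs_le_D1)
  qed
  also have "\<dots> = (\<Sum>s\<in>S. \<Sum>t\<in>S. (c s)\<^sup>2 / 2 * \<bar>dot I (X s) (X t)\<bar>)
      + (\<Sum>s\<in>S. \<Sum>t\<in>S. (c t)\<^sup>2 / 2 * \<bar>dot I (X s) (X t)\<bar>)"
    by (simp add: add_divide_distrib distrib_right sum.distrib)
  also have "(\<Sum>s\<in>S. \<Sum>t\<in>S. (c t)\<^sup>2 / 2 * \<bar>dot I (X s) (X t)\<bar>)
      = (\<Sum>s\<in>S. \<Sum>t\<in>S. (c s)\<^sup>2 / 2 * \<bar>dot I (X s) (X t)\<bar>)"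
    by (subst sum.swap) (simp add: dot_commute)
  also have "(\<Sum>s\<in>S. \<Sum>t\<in>S. (c s)\<^sup>2 / 2 * \<bar>dot I (X s) (X t)\<bar>) + (\<Sum>s\<in>S. \<Sum>t\<in>S. (c s)\<^sup>2 / 2 * \<bar>dot I (X s) (X t)\<bar>)
      = (\<Sum>s\<in>S. (c s)\<^sup>2 * (\<Sum>t\<in>S. \<bar>dot I (X s) (X t)\<bar>))"
    by (simp add: sum_distrib_left flip: sum.distrib)
  also have "\<dots> \<le> (\<Sum>s\<in>S. (c s)\<^sup>2 * B)"
    using B(2) by (intro sum_mono mult_left_mono) auto
  also have "\<dots> = B * C" unfolding C_def by (simp add: sum_distrib_left mult_ac)
  finally have VV: "dot I V V \<le> B * C" .
  have "C\<^sup>2 \<le> dot I V V * dot I w w" unfolding CV by (rule dot_cauchy_schwarz)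
  also have "\<dots> \<le> (B * C) * dot I w w" using VV by (intro mult_right_mono dot_self_nonneg)
  finally have "C * C \<le> C * (B * dot I w w)" by (simp add: power2_eq_square mult_ac)
  then show ?thesis
    using C0 mult_nonneg_nonneg[OF B(1) dot_self_nonneg[of I w]]
    unfolding c_def[symmetric] C_def[symmetric] by (cases "C = 0") auto
qed

section \<open>Vectors of norm two\<close>

text \<open>A frame bound in the orthogonal complement of the \<open>y j\<close> without
  constructing that complement. The \<open>y j\<close>, rescaled to norm \<open>B\<close>, are
  adjoined to the \<open>X s\<close>; with this scaling both sides of the frame inequality contain
  the factor \<open>T\<close>.\<close>

lemma frame_orthogonal_complement:
  fixes X :: "'a \<Rightarrow> 'i \<Rightarrow> real" and y :: "'b \<Rightarrow> 'i \<Rightarrow> real" and B c :: real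
  assumes fin: "finite I" "finite S" "finite J" and "B > 0" "c > 0"
    and X1: "\<And>s. s \<in> S \<Longrightarrow> dot I (X s) (X s) = 1"
    and row: "\<And>s. s \<in> S \<Longrightarrow> (\<Sum>t\<in>S. (dot I (X s) (X t))\<^sup>2) \<le> B"
    and y: "\<And>j k. j \<in> J \<Longrightarrow> k \<in> J \<Longrightarrow> dot I (y j) (y k) = (if j = k then c else 0)"
    and Xy: "\<And>s j. s \<in> S \<Longrightarrow> j \<in> J \<Longrightarrow> dot I (X s) (y j) = 0"
  shows "card S + B * card J \<le> B * card I"
proof -
  define g where "g = case_sum X (\<lambda>j i. sqrt (B / c) * y j i)"
  define T where "T = card S + B * card J"
  have g_simps: "dot I (g (Inl s)) (g (Inl t)) = dot I (X s) (X t)"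
      "s \<in> S \<Longrightarrow> j \<in> J \<Longrightarrow> dot I (g (Inl s)) (g (Inr j)) = 0"
      "s \<in> S \<Longrightarrow> j \<in> J \<Longrightarrow> dot I (g (Inr j)) (g (Inl s)) = 0"
      "j \<in> J \<Longrightarrow> k \<in> J \<Longrightarrow> dot I (g (Inr j)) (g (Inr k)) = (if j = k then B else 0)" for s t j k
    using assms(4,5) Xy[of s j] unfolding g_def
    by (simp_all add: dot_simps y dot_commute[of I "y j" "X s"] flip: power2_eq_square mult.assoc)
  have finU: "finite (S <+> J)" using fin by simp
  have "(\<Sum>s\<in>S <+> J. dot I (g s) (g s)) = T"
    using fin by (simp add: sum.Plus g_simps X1 T_def)
  moreover have "(\<Sum>s\<in>S <+> J. \<Sum>t\<in>S <+> J. (dot I (g s) (g t))\<^sup>2)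
      = (\<Sum>s\<in>S. \<Sum>t\<in>S. (dot I (X s) (X t))\<^sup>2) + card J * B\<^sup>2"
    using fin by (simp add: sum.Plus g_simps if_distrib[of "\<lambda>x. x\<^sup>2"] cong: if_cong)
  ultimately have "T\<^sup>2 \<le> card I * ((\<Sum>s\<in>S. \<Sum>t\<in>S. (dot I (X s) (X t))\<^sup>2) + card J * B\<^sup>2)"
    using frame_inequality[OF fin(1) finU, of g] by simp
  also have "(\<Sum>s\<in>S. \<Sum>t\<in>S. (dot I (X s) (X t))\<^sup>2) \<le> (\<Sum>s\<in>S. B)"
    by (intro sum_mono row)
  finally have "T\<^sup>2 \<le> card I * (card S * B + card J * B\<^sup>2)"
    by (simp add: mult_left_mono)
  also have "\<dots> = (B * card I) * T" unfolding T_def by (simp add: algebra_simps power2_eq_square)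
  finally have "T * T \<le> (B * card I) * T" by (simp add: power2_eq_square)
  moreover have "T \<ge> 0" unfolding T_def using assms(4) by simp
  ultimately show ?thesis unfolding T_def[symmetric] using assms(4) by (cases "T = 0") auto
qed

text \<open>In the application \<open>Y t\<close> runs through the vectors not orthogonal to
  \<open>x\<close>, with signs making the product with \<open>x\<close> equal to \<open>1\<close>.
  Then \<open>x - Y t\<close> also has norm \<open>2\<close> and product \<open>1\<close> with
  \<open>x\<close>.\<close>

locale root_neighbours =
  fixes I :: "'i set" and x :: "'i \<Rightarrow> real" and T :: "'a set" and Y :: "'a \<Rightarrow> 'i \<Rightarrow> real"
  assumes fin: "finite I" "finite T"
    and xx: "dot I x x = 2"
    and YY: "t \<in> T \<Longrightarrow> dot I (Y t) (Y t) = 2"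
    and xY: "t \<in> T \<Longrightarrow> dot I x (Y t) = 1"
    and distinct: "t \<in> T \<Longrightarrow> t' \<in> T \<Longrightarrow> t \<noteq> t' \<Longrightarrow> dot I (Y t) (Y t') \<in> {-1, 0, 1}"
begin

text \<open>Two vectors of norm \<open>2\<close> with inner product \<open>2\<close> coincide, so
  both \<open>Y t\<close> and \<open>Y t'\<close> would be \<open>w\<close>.\<close>

lemma unique:
  assumes "t \<in> T" "t' \<in> T" "dot I w w = 2" "dot I (Y t) w = 2" "dot I (Y t') w = 2"
  shows "t = t'"
proof (rule ccontr)
  assume "t \<noteq> t'"
  have "dot I (Y t) (Y t') = dot I w (Y t')"
    using assms YY by (intro dot_eq_if_close fin) auto
  then have "dot I (Y t) (Y t') = 2" using assms by (simp add: dot_commute)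
  then show False using distinct[OF assms(1,2) \<open>t \<noteq> t'\<close>] by auto
qed

lemma card_unique:
  assumes "dot I w w = 2"
  shows "card {t \<in> T. dot I (Y t) w = 2} \<le> 1"
  using unique[OF _ _ assms] fin by (subst One_nat_def, subst card_le_Suc0_iff_eq) auto

lemma Y_int: "t \<in> T \<Longrightarrow> t' \<in> T \<Longrightarrow> dot I (Y t) (Y t') \<in> \<int>"
  using YY distinct[of t t'] by (cases "t = t'") auto

end

section \<open>Neighbours in the presence of an orthogonal frame\<close>

text \<open>Here \<open>y 0, \<dots>, y 3\<close> are orthogonal of norm \<open>2\<close> and add up to \<open>2 x\<close>. Up to eight exceptions, a
  neighbour of \<open>x\<close> is half the sum of two of them plus a vector of norm \<open>1\<close> orthogonal to all four.\<close>

locale root_neighbours_frame = root_neighbours I x T Y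
  for I :: "'i set" and x and T :: "'a set" and Y +
  fixes y :: "nat \<Rightarrow> 'i \<Rightarrow> real"
  assumes yy: "j < 4 \<Longrightarrow> k < 4 \<Longrightarrow> dot I (y j) (y k) = (if j = k then 2 else 0)"
    and y_sum: "(\<Sum>j<4. dot I w (y j)) = 2 * dot I w x"
    and Yy: "t \<in> T \<Longrightarrow> j < 4 \<Longrightarrow> dot I (Y t) (y j) \<in> \<int>"
begin

definition c where "c t j = dot I (Y t) (y j)"

lemma sum4_expand: "(\<Sum>j<4. f j :: real) = f 0 + f 1 + f 2 + f (3::nat)"
  by (simp add: eval_nat_numeral)

lemma less4: "(\<forall>j<4. P j) \<longleftrightarrow> P 0 \<and> P 1 \<and> P 2 \<and> P (3::nat)"
  by (auto simp: eval_nat_numeral less_Suc_eq)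

lemma c_sum: "t \<in> T \<Longrightarrow> (\<Sum>j<4. c t j) = 2"
  unfolding c_def y_sum using xY by (simp add: dot_commute)

text \<open>Bessel's inequality for four orthogonal vectors of norm \<open>2\<close>.\<close>

lemma c_sq: 
  assumes "t \<in> T"
  shows "(\<Sum>j<4. (c t j)\<^sup>2) \<le> 4"
proof -
  have "(\<Sum>j<4. (dot I (y j) (Y t))\<^sup>2) \<le> 2 * dot I (Y t) (Y t)"
    using fin yy by (intro bombieri_inequality) auto
  then show ?thesis using YY[OF assms] unfolding c_def by (simp add: dot_commute)
qed

text \<open>The exceptional neighbours: product \<open>2\<close> with \<open>y j\<close> means that
  \<open>Y t\<close> is \<open>y j\<close>, and product \<open>-1\<close> means that it is
  \<open>x - y j\<close>.\<close>

definition Sp where "Sp = {t \<in> T. \<exists>j<4. c t j = 2 \<or> c t j = -1}"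
definition R where "R = T - Sp"
text \<open>For \<open>t\<close> in \<open>R\<close> two of the four coefficients are
  \<open>1\<close> and two are \<open>0\<close>. For \<open>k = 1, 2, 3\<close>, \<open>Rk k\<close>
  collects those \<open>t\<close> whose pair of ones is \<open>{0, k}\<close> or its complement, one
  class for each splitting of the four indices into pairs.\<close>

definition Rk where "Rk k = {t \<in> R. c t k = c t 0}"

lemma xy: "j < 4 \<Longrightarrow> dot I x (y j) = 1"
proof -
  assume j: "j < 4"
  have "(\<Sum>k<4. dot I (y j) (y k)) = (\<Sum>k<4. if j = k then 2 else 0)"
    using j by (intro sum.cong) (auto simp: yy)
  then have "(\<Sum>k<4. dot I (y j) (y k)) = 2" using j by simp
  then show ?thesis unfolding y_sum by (simp add: dot_commute)
qed

lemma card_Sp: "card Sp \<le> 8"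
proof -
  have "Sp \<subseteq> (\<Union>j\<in>{..<4}. {t \<in> T. dot I (Y t) (y j) = 2} \<union> {t \<in> T. dot I (Y t) (\<lambda>i. x i - y j i) = 2})"
    unfolding Sp_def c_def using xY by (fastforce simp: dot_simps dot_commute[of I _ x])
  then have "card Sp \<le> card (\<Union>j\<in>{..<4}. {t \<in> T. dot I (Y t) (y j) = 2} \<union> {t \<in> T. dot I (Y t) (\<lambda>i. x i - y j i) = 2})"
    using fin by (intro card_mono) auto
  also have "\<dots> \<le> (\<Sum>j<4. card ({t \<in> T. dot I (Y t) (y j) = 2} \<union> {t \<in> T. dot I (Y t) (\<lambda>i. x i - y j i) = 2}))"
    by (intro card_UN_le) simp
  also have "\<dots> \<le> (\<Sum>j::nat<4. 2)"
  proof (intro sum_mono)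
    fix j :: nat assume "j \<in> {..<4}"
    then have j: "j < 4" by simp
    have "card {t \<in> T. dot I (Y t) (y j) = 2} \<le> 1" using j yy by (intro card_unique) simp
    moreover have "card {t \<in> T. dot I (Y t) (\<lambda>i. x i - y j i) = 2} \<le> 1"
      using j yy xx xy by (intro card_unique) (simp add: dot_simps dot_commute[of I "y j" x])
    ultimately show "card ({t \<in> T. dot I (Y t) (y j) = 2} \<union> {t \<in> T. dot I (Y t) (\<lambda>i. x i - y j i) = 2}) \<le> 2"
      using card_Un_le[of "{t \<in> T. dot I (Y t) (y j) = 2}" "{t \<in> T. dot I (Y t) (\<lambda>i. x i - y j i) = 2}"] by linarith
  qed
  finally show ?thesis by simp
qed

text \<open>The integers \<open>c t i\<close> make every \<open>c t i * (c t i - 1)\<close>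
  nonnegative, and these numbers add up to at most \<open>4 - 2\<close>. So each coefficient lies
  between \<open>-1\<close> and \<open>2\<close>, and both extremes belong to
  \<open>Sp\<close>.\<close>

lemma c_01:
  assumes "t \<in> R" "j < 4"
  shows "c t j = 0 \<or> c t j = 1"
proof -
  have t: "t \<in> T" "t \<notin> Sp" using assms unfolding R_def by auto
  have nonneg: "c t i * (c t i - 1) \<ge> 0" if "i < 4" for i
  proof -
    have "c t i \<in> \<int>" using Yy[OF t(1) that] unfolding c_def .
    then obtain k where k: "c t i = of_int k" by (auto elim: Ints_cases)
    have "k * (k - 1) \<ge> 0" by (cases "k \<ge> 1") (auto simp: mult_nonpos_nonpos)
    then have "real_of_int (k * (k - 1)) \<ge> 0" by (simp only: of_int_0_le_iff)
    then show ?thesis unfolding k by simp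
  qed
  obtain k where k: "c t j = of_int k" using Yy[OF t(1) assms(2)] unfolding c_def by (auto elim: Ints_cases)
  have "c t j * (c t j - 1) \<le> (\<Sum>i<4. c t i * (c t i - 1))"
    using nonneg assms(2) by (intro member_le_sum) auto
  also have "\<dots> = (\<Sum>i<4. (c t i)\<^sup>2) - (\<Sum>i<4. c t i)"
    by (simp add: power2_eq_square algebra_simps sum_subtractf)
  also have "\<dots> \<le> 2" using c_sum[OF t(1)] c_sq[OF t(1)] by simp
  finally have "real_of_int (k * (k - 1)) \<le> of_int 2" unfolding k by simp
  then have le: "k * (k - 1) \<le> 2" by (simp only: of_int_le_iff)
  have "k \<le> 2"
  proof (rule ccontr)
    assume "\<not> k \<le> 2"
    then have "3 * 2 \<le> k * (k - 1)" by (intro mult_mono) auto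
    then show False using le by simp
  qed
  moreover have "- 1 \<le> k"
  proof (rule ccontr)
    assume "\<not> - 1 \<le> k"
    then have "2 * 3 \<le> (- k) * (1 - k)" by (intro mult_mono) auto
    then show False using le by (simp add: algebra_simps)
  qed
  moreover have "c t j \<noteq> 2" "c t j \<noteq> -1" using t assms(2) unfolding Sp_def by auto
  then have "k \<noteq> 2" "k \<noteq> -1" unfolding k by auto
  ultimately have "k = 0 \<or> k = 1" by auto
  then show ?thesis unfolding k by auto
qed

lemma c_R:
  assumes "t \<in> R"
  shows "(c t 0 = 1 \<and> c t 1 = 1 \<and> c t 2 = 0 \<and> c t 3 = 0) \<or> (c t 0 = 1 \<and> c t 1 = 0 \<and> c t 2 = 1 \<and> c t 3 = 0)
    \<or> (c t 0 = 1 \<and> c t 1 = 0 \<and> c t 2 = 0 \<and> c t 3 = 1) \<or> (c t 0 = 0 \<and> c t 1 = 0 \<and> c t 2 = 1 \<and> c t 3 = 1)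
    \<or> (c t 0 = 0 \<and> c t 1 = 1 \<and> c t 2 = 0 \<and> c t 3 = 1) \<or> (c t 0 = 0 \<and> c t 1 = 1 \<and> c t 2 = 1 \<and> c t 3 = 0)"
proof -
  have "t \<in> T" using assms unfolding R_def by auto
  then have "c t 0 + c t 1 + c t 2 + c t 3 = 2" using c_sum by (simp add: sum4_expand)
  moreover have "c t 0 = 0 \<or> c t 0 = 1" "c t 1 = 0 \<or> c t 1 = 1" "c t 2 = 0 \<or> c t 2 = 1" "c t 3 = 0 \<or> c t 3 = 1"
    using c_01[OF assms] by simp_all
  ultimately show ?thesis by auto
qed

lemma Rk_union: "R \<subseteq> Rk 1 \<union> Rk 2 \<union> Rk 3"
  using c_R unfolding Rk_def by fastforce

lemma c_Rk:
  assumes "k \<in> {1, 2, 3}" "t \<in> Rk k" "j < 4"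
  shows "c t j = (if j = 0 \<or> j = k then c t 0 else 1 - c t 0)"
proof -
  have "\<forall>j<4. c t j = (if j = 0 \<or> j = k then c t 0 else 1 - c t 0)"
    using c_R[of t] assms(1,2) unfolding less4 Rk_def by auto
  then show ?thesis using assms(3) by blast
qed

lemma c_Rk_values:
  assumes "k \<in> {1, 2, 3}" "t \<in> Rk k"
  shows "c t 1 = (if k = 1 then c t 0 else 1 - c t 0)"
    "c t 2 = (if k = 2 then c t 0 else 1 - c t 0)"
    "c t 3 = (if k = 3 then c t 0 else 1 - c t 0)"
  using c_Rk[OF assms, of 1] c_Rk[OF assms, of 2] c_Rk[OF assms, of 3] by auto

text \<open>The component of \<open>Y t\<close> orthogonal to the frame; the division by
  \<open>2\<close> accounts for the norm of the \<open>y j\<close>.\<close>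

definition h where "h t = (\<lambda>i. Y t i - (c t 0 * y 0 i + c t 1 * y 1 i + c t 2 * y 2 i + c t 3 * y 3 i) / 2)"

lemma h_y: "j < 4 \<Longrightarrow> dot I (h t) (y j) = 0"
proof -
  have "\<forall>j<4. dot I (h t) (y j) = 0"
    unfolding less4 h_def by (simp add: dot_simps yy) (simp add: c_def)
  then show "j < 4 \<Longrightarrow> ?thesis" by blast
qed

lemma h_h: "dot I (h t) (h t') = dot I (Y t) (Y t') - (\<Sum>j<4. c t j * c t' j) / 2"
proof -
  have "dot I (h t) (h t') = dot I (h t) (Y t')"
    using h_y unfolding h_def[of t'] by (simp add: dot_simps)
  also have "\<dots> = dot I (Y t) (Y t') - (\<Sum>j<4. c t j * c t' j) / 2"
    unfolding h_def by (simp add: dot_simps sum4_expand c_def dot_commute[of I "y _"])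
  finally show ?thesis .
qed

lemma h_norm:
  assumes "t \<in> R"
  shows "dot I (h t) (h t) = 1"
proof -
  have t: "t \<in> T" using assms unfolding R_def by auto
  have "(\<Sum>j<4. c t j * c t j) = (\<Sum>j<4. c t j)"
    using c_01[OF assms] by (intro sum.cong) force+
  then show ?thesis unfolding h_h c_sum[OF t] YY[OF t] by simp
qed

lemma h_le: "t \<in> R \<Longrightarrow> t' \<in> R \<Longrightarrow> \<bar>dot I (h t) (h t')\<bar> \<le> 1"
  using dot_cauchy_schwarz[of I "h t" "h t'"] abs_le_square_iff[of "dot I (h t) (h t')" 1]
  by (simp add: h_norm)

text \<open>Inside one class the supports of the coefficients are equal or complementary, so the
  correction term in \<open>h_h\<close> is an integer.\<close>

lemma h_same:
  assumes "k \<in> {1, 2, 3}" "t \<in> Rk k" "t' \<in> Rk k"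
  shows "dot I (h t) (h t') \<in> {-1, 0, 1}"
proof -
  have R: "t \<in> R" "t' \<in> R" "t \<in> T" "t' \<in> T" using assms unfolding Rk_def R_def by auto
  have "(\<Sum>j<4. c t j * c t' j) \<in> {0, 2}"
    using assms(1) c_01[OF R(1), of 0] c_01[OF R(2), of 0]
    unfolding sum4_expand c_Rk_values[OF assms(1,2)] c_Rk_values[OF assms(1,3)] by auto
  then have "(\<Sum>j<4. c t j * c t' j) / 2 \<in> \<int>" by auto
  then have "dot I (h t) (h t') \<in> \<int>" unfolding h_h using Y_int[OF R(3,4)] by (intro Ints_diff)
  then obtain k where "dot I (h t) (h t') = of_int k" by (auto elim: Ints_cases)
  then show ?thesis using h_le[OF R(1,2)] by (cases "k = -1"; cases "k = 0"; cases "k = 1") auto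
qed

text \<open>Pairs from different classes meet in exactly one index, so the correction is
  \<open>1 / 2\<close> and the product is \<open>1 / 2\<close> or \<open>- 1 / 2\<close>.\<close>

lemma h_diff:
  assumes "k \<in> {1, 2, 3}" "l \<in> {1, 2, 3}" "k \<noteq> l" "t \<in> Rk k" "t' \<in> Rk l"
  shows "(dot I (h t) (h t'))\<^sup>2 = 1 / 4"
proof -
  have R: "t \<in> R" "t' \<in> R" "t \<in> T" "t' \<in> T" using assms unfolding Rk_def R_def by auto
  have "(\<Sum>j<4. c t j * c t' j) = 1"
    using assms(1-3) c_01[OF R(1), of 0] c_01[OF R(2), of 0]
    unfolding sum4_expand c_Rk_values[OF assms(1,4)] c_Rk_values[OF assms(2,5)] by auto
  then have *: "dot I (h t) (h t') = dot I (Y t) (Y t') - 1 / 2" unfolding h_h by simp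
  obtain k where k: "dot I (Y t) (Y t') = of_int k" using Y_int[OF R(3,4)] by (auto elim: Ints_cases)
  have "\<bar>of_int k - 1 / 2 :: real\<bar> \<le> 1" using h_le[OF R(1,2)] * k by simp
  then have "k = 0 \<or> k = 1" by linarith
  then show ?thesis unfolding * k by (auto simp: power2_eq_square)
qed

text \<open>A nonzero product of these unit vectors is a sign, so \<open>h s\<close> equals
  \<open>h t\<close> up to that sign. The sign and \<open>c s 0\<close> together determine
  \<open>Y s\<close> and hence \<open>s\<close>, which leaves four possibilities.\<close>

lemma h_row:
  assumes k: "k \<in> {1, 2, 3}" and t: "t \<in> Rk k"
  shows "card {t' \<in> Rk k. dot I (h t) (h t') \<noteq> 0} \<le> 4"
proof -
  let ?A = "{t' \<in> Rk k. dot I (h t) (h t') \<noteq> 0}"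
  let ?f = "\<lambda>t'. (dot I (h t) (h t'), c t' 0)"
  have RR: "s \<in> Rk k \<Longrightarrow> s \<in> R \<and> s \<in> T" for s unfolding Rk_def R_def by auto
  have "inj_on ?f ?A"
  proof (rule inj_onI)
    fix s s' assume s: "s \<in> ?A" "s' \<in> ?A" "?f s = ?f s'"
    define e where "e = dot I (h t) (h s)"
    have e: "e\<^sup>2 = 1" "dot I (h t) (h s') = e"
      using h_same[OF k t, of s] s unfolding e_def by auto
    have "dot I (h s) (h s') = dot I (\<lambda>i. e * h t i) (h s')"
    proof (rule dot_eq_if_close[OF fin(1)])
      have "dot I (h s) (\<lambda>i. e * h t i) = e\<^sup>2"
        unfolding dot_simps by (simp add: dot_commute[of I "h s"] power2_eq_square flip: e_def)
      then show "dot I (h s) (h s) + dot I (\<lambda>i. e * h t i) (\<lambda>i. e * h t i) = 2 * dot I (h s) (\<lambda>i. e * h t i)"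
        using s RR t e(1) by (simp add: dot_simps h_norm flip: power2_eq_square mult.assoc)
    qed
    then have 1: "dot I (h s) (h s') = 1" unfolding dot_simps using e by (simp add: power2_eq_square)
    have "c s' j = c s j" if "j < 4" for j
      using c_Rk[OF k _ that] s by auto
    then have "(\<Sum>j<4. c s j * c s' j) = (\<Sum>j<4. c s j * c s j)" by (intro sum.cong) auto
    also have "\<dots> / 2 = 1" using h_h[of s s] h_norm[of s] YY[of s] RR s by auto
    finally have "dot I (Y s) (Y s') = 2" using 1 h_h[of s s'] by simp
    moreover have "s \<in> T" "s' \<in> T" using RR s by blast+
    ultimately show "s = s'" using distinct[of s s'] by fastforce
  qed
  then have "card ?A = card (?f ` ?A)" by (rule card_image[symmetric])
  also have "\<dots> \<le> card ({-1, 1::real} \<times> {0, 1::real})"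
  proof (intro card_mono image_subsetI)
    fix s assume s: "s \<in> ?A"
    then have "dot I (h t) (h s) = -1 \<or> dot I (h t) (h s) = 1" using h_same[OF k t, of s] by auto
    moreover have "c s 0 = 0 \<or> c s 0 = 1" using s RR by (intro c_01) auto
    ultimately show "?f s \<in> {-1, 1} \<times> {0, 1}" by auto
  qed simp
  finally show ?thesis by (simp add: card_cartesian_product)
qed

lemma fin_Rk: "finite (Rk k)" using fin unfolding Rk_def R_def by auto

lemma h_row_sum:
  assumes k: "k \<in> {1, 2, 3}" and t: "t \<in> Rk k"
  shows "(\<Sum>t'\<in>Rk k. \<bar>dot I (h t) (h t')\<bar>) \<le> 4" "(\<Sum>t'\<in>Rk k. (dot I (h t) (h t'))\<^sup>2) \<le> 4"
proof -
  have "(\<Sum>t'\<in>Rk k. \<bar>dot I (h t) (h t')\<bar>) = (\<Sum>t'\<in>Rk k. if dot I (h t) (h t') \<noteq> 0 then 1 else 0)"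
    using h_same[OF k t] by (intro sum.cong) fastforce+
  also have "\<dots> = card {t' \<in> Rk k. dot I (h t) (h t') \<noteq> 0}"
    using fin_Rk by (simp add: sum.If_cases Int_def)
  finally show 1: "(\<Sum>t'\<in>Rk k. \<bar>dot I (h t) (h t')\<bar>) \<le> 4" using h_row[OF k t] by simp
  have "(\<Sum>t'\<in>Rk k. (dot I (h t) (h t'))\<^sup>2) = (\<Sum>t'\<in>Rk k. \<bar>dot I (h t) (h t')\<bar>)"
    using h_same[OF k t] by (intro sum.cong) fastforce+
  then show "(\<Sum>t'\<in>Rk k. (dot I (h t) (h t'))\<^sup>2) \<le> 4" using 1 by simp
qed

text \<open>The frame bound with row bound \<open>4\<close>, in the complement of the four
  \<open>y j\<close>.\<close>

lemma card_Rk: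
  assumes k: "k \<in> {1, 2, 3}"
  shows "card (Rk k) + 16 \<le> 4 * card I"
proof -
  have "real (card (Rk k)) + 4 * real (card {..<4::nat}) \<le> 4 * real (card I)"
    using fin fin_Rk h_row_sum[OF k] h_norm yy h_y
    by (intro frame_orthogonal_complement[of I "Rk k" "{..<4}" 4 2 h y]) (auto simp: Rk_def)
  then show ?thesis by simp
qed

text \<open>One vector from another class has squared product \<open>1 / 4\<close> with every
  \<open>h s\<close>, and Bombieri's inequality bounds the sum of these by \<open>4\<close>.\<close>

lemma card_Rk':
  assumes k: "k \<in> {1, 2, 3}" "l \<in> {1, 2, 3}" "k \<noteq> l" and t: "t \<in> Rk l"
  shows "card (Rk k) \<le> 16"
proof -
  have "(\<Sum>s\<in>Rk k. (dot I (h s) (h t))\<^sup>2) \<le> 4 * dot I (h t) (h t)"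
    using fin fin_Rk h_row_sum[OF k(1)] by (intro bombieri_inequality) auto
  moreover have "(\<Sum>s\<in>Rk k. (dot I (h s) (h t))\<^sup>2) = (\<Sum>s\<in>Rk k. 1 / 4)"
    using h_diff[OF k _ t] by (intro sum.cong) auto
  moreover have "dot I (h t) (h t) = 1" using t h_norm unfolding Rk_def by auto
  ultimately show ?thesis by simp
qed

text \<open>If two classes are nonempty, each class has at most \<open>16\<close> elements, for a
  total of at most \<open>8 + 48\<close>. Otherwise a single class contributes at most
  \<open>4 n - 16\<close>, where \<open>n\<close> is the dimension.\<close>

lemma card_bound: "card T \<le> 56 \<or> card T + 4 \<le> 4 * card I"
proof -
  have "T = Sp \<union> R" unfolding R_def Sp_def by auto
  then have "card T \<le> card Sp + card R" by (metis card_Un_le)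
  moreover have "card R \<le> card (Rk 1 \<union> Rk 2 \<union> Rk 3)" using Rk_union fin_Rk by (intro card_mono) auto
  moreover have "card (Rk 1 \<union> Rk 2 \<union> Rk 3) \<le> card (Rk 1) + card (Rk 2) + card (Rk 3)"
    by (meson card_Un_le add_le_mono le_trans order_refl)
  ultimately have T: "card T \<le> 8 + card (Rk 1) + card (Rk 2) + card (Rk 3)" using card_Sp by linarith
  have *: "card (Rk k) \<le> 16" if "Rk l \<noteq> {}" "k \<in> {1, 2, 3}" "l \<in> {1, 2, 3}" "k \<noteq> l" for k l
    using card_Rk'[OF that(2,3,4)] that by auto
  show ?thesis
  proof (cases "card (Rk 1) = 0")
    case e1: True
    show ?thesis
    proof (cases "card (Rk 2) = 0")
      case True
      then show ?thesis using T e1 card_Rk[of 3] by simp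
    next
      case False
      then have "Rk 2 \<noteq> {}" by auto
      then show ?thesis using T e1 card_Rk[of 2] *[of 2 3] *[of 3 2]
        by (cases "Rk 3 = {}") auto
    qed
  next
    case False
    then have "Rk 1 \<noteq> {}" by auto
    then have "card (Rk 2) \<le> 16" "card (Rk 3) \<le> 16" using *[of 1 2] *[of 1 3] by auto
    moreover have "card (Rk 1) \<le> 16 \<or> (card (Rk 2) = 0 \<and> card (Rk 3) = 0)"
      using *[of 2 1] *[of 3 1] by fastforce
    ultimately show ?thesis using T card_Rk[of 1] by auto
  qed
qed

end

section \<open>Neighbours without an orthogonal triple, and the bound in general\<close>

context root_neighbours
begin

text \<open>After replacing some \<open>Y t\<close> by \<open>x - Y t\<close>, all products are
  \<open>1\<close> or \<open>2\<close>, so the distinct vectors among them have the Gram matrix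
  identity plus all-ones and are at most \<open>card I\<close> in number. Each of them comes from at
  most two indices.\<close>

lemma card_bound_no_orthogonal_triple:
  assumes no_triple: "\<And>u1 u2 u3. \<forall>u\<in>{u1, u2, u3}. \<exists>t\<in>T. u = Y t \<or> u = (\<lambda>i. x i - Y t i) \<Longrightarrow>
      dot I u1 u2 = 0 \<Longrightarrow> dot I u1 u3 = 0 \<Longrightarrow> dot I u2 u3 = 0 \<Longrightarrow> False"
  shows "card T \<le> 2 * card I"
proof (cases "T = {}")
  case False
  then obtain t0 where t0: "t0 \<in> T" by blast
  define y0 where "y0 = Y t0"
  \<comment> \<open>The product of \<open>x - Y t\<close> with \<open>y0\<close> is \<open>1\<close>
    minus that of \<open>Y t\<close>, so products \<open>0\<close> and \<open>-1\<close> become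
    \<open>1\<close> and \<open>2\<close>.\<close>
  define u where "u t = (if dot I (Y t) y0 \<ge> 1 then Y t else (\<lambda>i. x i - Y t i))" for t
  have u_Z: "\<exists>t'\<in>T. u t = Y t' \<or> u t = (\<lambda>i. x i - Y t' i)" if "t \<in> T" for t
    using that unfolding u_def by auto
  have y0: "dot I y0 y0 = 2" "dot I x y0 = 1" using t0 YY xY unfolding y0_def by auto
  have uu: "dot I (u t) (u t) = 2" "dot I x (u t) = 1" if "t \<in> T" for t
    using xx YY[OF that] xY[OF that] unfolding u_def by (auto simp: dot_simps dot_commute[of I "Y t" x])
  have u_y0: "dot I (u t) y0 = 1 \<or> dot I (u t) y0 = 2" if "t \<in> T" for t
    using distinct[OF that t0] YY[OF t0] y0 unfolding u_def y0_def
    by (cases "t = t0") (auto simp: dot_simps)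
  have u_int: "dot I (u t) (u t') \<in> \<int>" if "t \<in> T" "t' \<in> T" for t t'
    using xx xY[OF that(1)] xY[OF that(2)] Y_int[OF that] unfolding u_def
    by (auto simp: dot_simps dot_commute[of I "Y _" x] intro!: Ints_add Ints_diff)
  have u_12: "dot I (u t) (u t') = 1 \<or> dot I (u t) (u t') = 2" if tt: "t \<in> T" "t' \<in> T" for t t'
  proof (cases "dot I (u t) y0 = 1 \<and> dot I (u t') y0 = 1")
    case True
    obtain k where k: "dot I (u t) (u t') = of_int k" using u_int[OF tt] by (auto elim: Ints_cases)
    have "(dot I (u t) (u t'))\<^sup>2 \<le> 2 * 2" using dot_cauchy_schwarz[of I "u t" "u t'"] uu tt by simp
    then have "\<bar>real_of_int k\<bar> \<le> 2" using abs_le_square_iff[of "real_of_int k" 2] k by simp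
    then have "k \<in> {-2, -1, 0, 1, 2}" by auto
    \<comment> \<open>A product \<open>0\<close> would make \<open>u t\<close>, \<open>u t'\<close>
      and \<open>x - y0\<close> a forbidden triple.\<close>
    moreover have "k \<noteq> 0"
    proof
      assume "k = 0"
      then have "dot I (u t) (u t') = 0" using k by simp
      moreover have "dot I (\<lambda>i. x i - y0 i) (u t) = 0" "dot I (\<lambda>i. x i - y0 i) (u t') = 0"
        using True uu tt by (simp_all add: dot_simps dot_commute[of I y0])
      moreover have "\<exists>s\<in>T. (\<lambda>i. x i - y0 i) = Y s \<or> (\<lambda>i. x i - y0 i) = (\<lambda>i. x i - Y s i)"
        using t0 unfolding y0_def by blast
      ultimately show False
        using no_triple[of "\<lambda>i. x i - y0 i" "u t" "u t'"] u_Z tt by blast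
    qed
    moreover have "k \<noteq> -1"
    proof
      assume "k = -1"
      then have "dot I (u t') y0 = dot I (\<lambda>i. x i - u t i) y0" using k uu tt xx
        by (intro dot_eq_if_close fin) (simp add: dot_simps dot_commute[of I "u _" x] dot_commute[of I "u t'" "u t"])
      then show False using True y0 by (simp add: dot_simps)
    qed
    moreover have "k \<noteq> -2"
    proof
      assume "k = -2"
      then have "dot I (u t') y0 = dot I (\<lambda>i. - u t i) y0" using k uu tt
        by (intro dot_eq_if_close fin) (simp add: dot_simps dot_commute[of I "u t'" "u t"])
      then show False using True by (simp add: dot_simps)
    qed
    ultimately show ?thesis using k by auto
  next
    case False
    then have "dot I (u t) y0 = 2 \<or> dot I (u t') y0 = 2" using u_y0 tt by blast
    moreover have "dot I (u s) w = dot I y0 w" if "s \<in> T" "dot I (u s) y0 = 2" for s w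
      using that uu y0 by (intro dot_eq_if_close fin) auto
    ultimately show ?thesis using u_y0 tt by (metis dot_commute)
  qed
  \<comment> \<open>Restricting to \<open>I\<close> turns agreement on \<open>I\<close> into
    equality of functions, so \<open>M\<close> counts each vector once.\<close>
  define f where "f t = restrict (u t) I" for t
  define M where "M = f ` T"
  have finM: "finite M" unfolding M_def using fin by simp
  have dot_f: "dot I (f t) w = dot I (u t) w" "dot I w (f t) = dot I w (u t)" for t w
    unfolding f_def dot_def by (simp_all cong: sum.cong)
  have M_dot: "dot I v w = (if v = w then 2 else 1)" if vw: "v \<in> M" "w \<in> M" for v w
  proof -
    obtain t s where ts: "t \<in> T" "s \<in> T" "v = f t" "w = f s" using vw unfolding M_def by blast
    show ?thesis
    proof (cases "v = w")
      case True
      have "dot I v v = 2" unfolding ts(3) dot_f using uu(1)[OF ts(1)] .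
      then show ?thesis using True by metis
    next
      case False
      have "dot I (u t) (u s) \<noteq> 2"
      proof
        assume "dot I (u t) (u s) = 2"
        then have "dot I (\<lambda>i. u t i - u s i) (\<lambda>i. u t i - u s i) = 0"
          using uu(1)[OF ts(1)] uu(1)[OF ts(2)]
          by (simp add: dot_simps dot_commute[of I "u s" "u t"])
        then have "\<And>i. i \<in> I \<Longrightarrow> u t i - u s i = 0" using dot_self_zero[OF fin(1)] by blast
        then have "f t = f s" unfolding f_def by (intro ext) (auto simp: restrict_def)
        then show False using False ts by simp
      qed
      then have "dot I v w = 1" unfolding ts(3,4) dot_f using u_12[OF ts(1,2)] by blast
      then show ?thesis using False by simp
    qed
  qed
  have "T = (\<Union>v\<in>M. {t \<in> T. f t = v})" unfolding M_def by auto
  then have "card T \<le> (\<Sum>v\<in>M. card {t \<in> T. f t = v})"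
    using card_UN_le[OF finM, of "\<lambda>v. {t \<in> T. f t = v}"] by simp
  \<comment> \<open>A given vector can arise from one index as \<open>Y t\<close> and from one more
    as \<open>x - Y t\<close>.\<close>
  also have "\<dots> \<le> (\<Sum>v\<in>M. 2)"
  proof (rule sum_mono)
    fix v assume v: "v \<in> M"
    then obtain s where s: "s \<in> T" "v = f s" unfolding M_def by blast
    have "{t \<in> T. f t = v} \<subseteq> {t \<in> T. dot I (Y t) (u s) = 2} \<union> {t \<in> T. dot I (Y t) (\<lambda>i. x i - u s i) = 2}"
    proof
      fix t assume "t \<in> {t \<in> T. f t = v}"
      then have t: "t \<in> T" "f t = f s" using s by auto
      have "dot I (u t) (u s) = dot I (f s) (u s)" by (simp only: dot_f(1)[symmetric] t(2))
      also have "\<dots> = 2" unfolding dot_f using uu(1)[OF s(1)] .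
      finally have ts: "dot I (u t) (u s) = 2" .
      then show "t \<in> {t \<in> T. dot I (Y t) (u s) = 2} \<union> {t \<in> T. dot I (Y t) (\<lambda>i. x i - u s i) = 2}"
        using ts t(1) xY[OF t(1)] uu[OF s(1)] unfolding u_def[of t]
        by (auto simp: dot_simps dot_commute[of I "Y t" x] split: if_splits)
    qed
    then have "card {t \<in> T. f t = v}
        \<le> card ({t \<in> T. dot I (Y t) (u s) = 2} \<union> {t \<in> T. dot I (Y t) (\<lambda>i. x i - u s i) = 2})"
      using fin by (intro card_mono) auto
    also have "\<dots> \<le> card {t \<in> T. dot I (Y t) (u s) = 2} + card {t \<in> T. dot I (Y t) (\<lambda>i. x i - u s i) = 2}"
      by (rule card_Un_le)
    also have "\<dots> \<le> 1 + 1"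
      using uu[OF s(1)] xx
      by (intro add_mono card_unique) (simp_all add: dot_simps dot_commute[of I "u s" x])
    finally show "card {t \<in> T. f t = v} \<le> 2" by simp
  qed
  finally have T: "card T \<le> 2 * card M" by simp
  define m where "m = real (card M)"
  define s where "s = sqrt (m + 1)"
  define S where "S = (\<lambda>i. \<Sum>v\<in>M. v i)"
  \<comment> \<open>The Gram matrix of \<open>M\<close> is identity plus all-ones; the multiple of \<open>S\<close> is chosen such that
    the \<open>g v\<close> are orthonormal.\<close>
  define g where "g v = (\<lambda>i. v i - 1 / (s * (s + 1)) * S i)" for v
  have "M \<noteq> {}" using False unfolding M_def by simp
  then have "m \<ge> 1" unfolding m_def using finM by (simp add: Suc_leI card_gt_0_iff)
  then have s: "s > 1" "s\<^sup>2 = m + 1" unfolding s_def by simp_all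
  have vS: "dot I v S = s\<^sup>2" if "v \<in> M" for v
  proof -
    have "dot I v S = (\<Sum>w\<in>M. 1 + (if v = w then 1 else 0))"
      unfolding S_def dot_sum_right using M_dot that by (intro sum.cong) auto
    also have "\<dots> = m + 1" unfolding m_def sum.distrib using that finM by simp
    finally show ?thesis using s by simp
  qed
  have "dot I S S = (\<Sum>v\<in>M. dot I v S)" unfolding S_def dot_sum_left ..
  then have SS: "dot I S S = (s\<^sup>2 - 1) * s\<^sup>2" using vS s(2) unfolding m_def by simp
  have "dot I (g v) (g w) = dot I v w - 1" if "v \<in> M" "w \<in> M" for v w
  proof -
    have "dot I (g v) (g w) = dot I v w - 2 * (1 / (s * (s + 1))) * s\<^sup>2 + (1 / (s * (s + 1)))\<^sup>2 * ((s\<^sup>2 - 1) * s\<^sup>2)"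
      unfolding g_def dot_simps using vS that SS dot_commute[of I S w] by (simp add: algebra_simps power2_eq_square)
    also have "\<dots> = dot I v w - 1"
    proof -
      have 2: "2 * (1 / (s * (s + 1))) * s\<^sup>2 = 2 * s / (s + 1)"
        using s(1) unfolding power2_eq_square by simp
      have "(1 / (s * q))\<^sup>2 * ((q * (s - 1)) * s\<^sup>2) = (s - 1) / q" if "q \<noteq> 0" for q
        using s(1) that by (simp add: power2_eq_square)
      moreover have "s\<^sup>2 - 1 = (s + 1) * (s - 1)" by (simp add: power2_eq_square algebra_simps)
      ultimately have "(1 / (s * (s + 1)))\<^sup>2 * ((s\<^sup>2 - 1) * s\<^sup>2) = (s - 1) / (s + 1)"
        using s(1) by (metis add_pos_pos less_irrefl less_trans zero_less_one)
      moreover have "2 * s / (s + 1) - (s - 1) / (s + 1) = 1"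
        using s(1) by (simp flip: diff_divide_distrib)
      ultimately show ?thesis using 2 by linarith
    qed
    finally show ?thesis .
  qed
  then have "card M \<le> card I"
    using M_dot by (intro card_le_if_orthogonal[OF fin(1) finM, of 1 g]) auto
  then show ?thesis using T by simp
qed simp

text \<open>An orthogonal triple is completed to a frame by a fourth vector; without such a triple
  the bound \<open>2 * card I\<close> is already strong enough.\<close>

lemma card_bound: "card T \<le> 56 \<or> card T + 4 \<le> 4 * card I"
proof (cases "\<exists>u1 u2 u3. (\<forall>u\<in>{u1, u2, u3}. \<exists>t\<in>T. u = Y t \<or> u = (\<lambda>i. x i - Y t i)) \<and>
      dot I u1 u2 = 0 \<and> dot I u1 u3 = 0 \<and> dot I u2 u3 = 0")
  case True
  then obtain u1 u2 u3 where u: "\<forall>u\<in>{u1, u2, u3}. \<exists>t\<in>T. u = Y t \<or> u = (\<lambda>i. x i - Y t i)"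
    and orth: "dot I u1 u2 = 0" "dot I u1 u3 = 0" "dot I u2 u3 = 0" by blast
  \<comment> \<open>The remaining vector is forced by the sum \<open>2 x\<close>; its norm is
    \<open>8 + 6 - 12 = 2\<close>.\<close>
  define u4 where "u4 = (\<lambda>i. 2 * x i - (u1 i + u2 i + u3 i))"
  define y where "y j = (if j = 0 then u1 else if j = 1 then u2 else if j = (2::nat) then u3 else u4)" for j
  have un: "dot I u u = 2" "dot I x u = 1" if mem: "u \<in> {u1, u2, u3}" for u
  proof -
    obtain t where "t \<in> T" "u = Y t \<or> u = (\<lambda>i. x i - Y t i)" using bspec[OF u mem] by (elim bexE)
    then show "dot I u u = 2" "dot I x u = 1"
      using xx YY[of t] xY[of t] by (auto simp: dot_simps dot_commute[of I "Y t" x])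
  qed
  have uY: "dot I (Y t) u \<in> \<int>" if mem: "t \<in> T" "u \<in> {u1, u2, u3}" for t u
  proof -
    obtain s where "s \<in> T" "u = Y s \<or> u = (\<lambda>i. x i - Y s i)" using bspec[OF u mem(2)] by (elim bexE)
    then show ?thesis
      using Y_int[OF mem(1), of s] xY[OF mem(1)] by (auto simp: dot_simps dot_commute[of I "Y t" x])
  qed
  have c: "dot I u2 u1 = 0" "dot I u3 u1 = 0" "dot I u3 u2 = 0" "dot I u1 x = 1" "dot I u2 x = 1" "dot I u3 x = 1"
    using orth un(2) by (simp_all add: dot_commute[of I u2 u1] dot_commute[of I u3 u1]
      dot_commute[of I u3 u2] dot_commute[of I _ x])
  interpret root_neighbours_frame I x T Y y
  proof
    show "dot I (y j) (y k) = (if j = k then 2 else 0)" if "j < 4" "k < 4" for j k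
    proof -
      have "j = 0 \<or> j = 1 \<or> j = 2 \<or> j = 3" "k = 0 \<or> k = 1 \<or> k = 2 \<or> k = 3" using that by auto
      then show ?thesis unfolding y_def u4_def
        by (elim disjE) (simp_all add: dot_simps un c orth xx)
    qed
    show "(\<Sum>j<4. dot I w (y j)) = 2 * dot I w x" for w
      by (simp add: eval_nat_numeral y_def u4_def dot_simps)
    show "dot I (Y t) (y j) \<in> \<int>" if "t \<in> T" "j < 4" for t j
      unfolding y_def u4_def using uY[OF that(1)] xY[OF that(1)]
      by (auto simp: dot_simps dot_commute[of I _ x])
  qed
  show ?thesis by (rule card_bound)
next
  case False
  have "card T \<le> 2 * card I"
    by (rule card_bound_no_orthogonal_triple) (use False in blast)
  then show ?thesis by auto
qed

end

section \<open>The number of vectors of norm two\<close>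

text \<open>If each vector is non-orthogonal to at most \<open>d\<close> others, the frame
  inequality gives \<open>4 N \<le> n (4 + d)\<close>, which is \<open>N \<le> n\<^sup>2\<close> for
  \<open>d = 4 n - 4\<close>. The hypothesis \<open>256 \<le> card S\<close> rules out small
  \<open>n\<close>.\<close>

theorem root_system_bound:
  fixes X :: "'a \<Rightarrow> 'i \<Rightarrow> real"
  assumes fin: "finite I" "finite S"
    and norm: "\<And>s. s \<in> S \<Longrightarrow> dot I (X s) (X s) = 2"
    and dist: "\<And>s t. s \<in> S \<Longrightarrow> t \<in> S \<Longrightarrow> s \<noteq> t \<Longrightarrow> dot I (X s) (X t) \<in> {-1, 0, 1}"
    and large: "card S \<ge> 256"
  shows "card S \<le> (card I)\<^sup>2"
proof -
  define n N where "n = card I" and "N = card S"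
  have deg: "card {t \<in> S. t \<noteq> s \<and> dot I (X s) (X t) \<noteq> 0} \<le> max 56 (4 * n - 4)" if s: "s \<in> S" for s
  proof -
    define T where "T = {t \<in> S. t \<noteq> s \<and> dot I (X s) (X t) \<noteq> 0}"
    define e where "e t = dot I (X s) (X t)" for t
    define Y where "Y t = (\<lambda>i. e t * X t i)" for t
    have e: "e t = 1 \<or> e t = -1" if "t \<in> T" for t
      using that dist[OF s, of t] unfolding T_def e_def by auto
    interpret root_neighbours I "X s" T Y
    proof
      show "finite I" "finite T" using fin unfolding T_def by auto
      show "dot I (X s) (X s) = 2" using norm s .
      show "dot I (Y t) (Y t) = 2" if "t \<in> T" for t
        using e[OF that] norm that unfolding Y_def dot_simps T_def by auto
      show "dot I (X s) (Y t) = 1" if "t \<in> T" for t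
        using e[OF that] unfolding Y_def dot_simps by (auto simp flip: e_def)
      show "dot I (Y t) (Y t') \<in> {-1, 0, 1}" if "t \<in> T" "t' \<in> T" "t \<noteq> t'" for t t'
        using e[OF that(1)] e[OF that(2)] dist[OF _ _ that(3)] that(1,2) unfolding Y_def dot_simps T_def by auto
    qed
    show ?thesis using card_bound unfolding T_def n_def by auto
  qed
  have row: "(\<Sum>t\<in>S. (dot I (X s) (X t))\<^sup>2) \<le> 4 + real (max 56 (4 * n - 4))" if s: "s \<in> S" for s
  proof -
    have "(\<Sum>t\<in>S. (dot I (X s) (X t))\<^sup>2)
        = (\<Sum>t\<in>S. (if t = s then 4 else 0) + (if t \<noteq> s \<and> dot I (X s) (X t) \<noteq> 0 then 1 else 0))"
      using norm[OF s] dist[OF s] by (intro sum.cong) fastforce+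
    also have "\<dots> = 4 + card {t \<in> S. t \<noteq> s \<and> dot I (X s) (X t) \<noteq> 0}"
      unfolding sum.distrib using fin s by (simp add: sum.If_cases Int_def)
    finally show ?thesis using deg[OF s] by simp
  qed
  have "(2 * real N)\<^sup>2 = (\<Sum>s\<in>S. dot I (X s) (X s))\<^sup>2" using norm unfolding N_def by simp
  also have "\<dots> \<le> n * (\<Sum>s\<in>S. \<Sum>t\<in>S. (dot I (X s) (X t))\<^sup>2)"
    unfolding n_def by (rule frame_inequality[OF fin])
  also have "\<dots> \<le> n * (\<Sum>s\<in>S. 4 + real (max 56 (4 * n - 4)))"
    using row by (intro mult_left_mono sum_mono) auto
  also have "\<dots> = real N * (n * (4 + real (max 56 (4 * n - 4))))" unfolding N_def by simp
  finally have "real N * (4 * real N) \<le> real N * (n * (4 + real (max 56 (4 * n - 4))))"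
    by (simp add: power2_eq_square)
  moreover have "N > 0" using large unfolding N_def by simp
  ultimately have "4 * real N \<le> n * (4 + real (max 56 (4 * n - 4)))" by simp
  then have "real (4 * N) \<le> real (n * (4 + max 56 (4 * n - 4)))" by simp
  then have le: "4 * N \<le> n * (4 + max 56 (4 * n - 4))" by (simp only: of_nat_le_iff)
  have "N \<le> n\<^sup>2"
  \<comment> \<open>From \<open>n = 15\<close> on, \<open>4 n - 4\<close> is at least
    \<open>56\<close>; below that, \<open>N\<close> is at most \<open>15 n\<close>, which
    contradicts \<open>N \<ge> 256\<close>.\<close>
  proof (cases "n \<ge> 15")
    case True
    then have "4 + max 56 (4 * n - 4) = 4 * n" by simp
    then have "4 * N \<le> n * (4 * n)" using le by (simp only:)
    then show ?thesis by (simp add: power2_eq_square)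
  next
    case False
    then have "max 56 (4 * n - 4) = 56" by auto
    then have "4 * N \<le> n * 60" using le by simp
    then have "N \<le> 15 * 15" using False by simp
    then show ?thesis using large unfolding N_def by simp
  qed
  then show ?thesis unfolding N_def n_def .
qed

section \<open>The simplest cubic field\<close>

text \<open>Coordinates are kept apart from the point \<open>r\<close>, so that the same coordinates
  can be evaluated at every conjugate of \<open>\<rho>\<close>.\<close>

definition ev :: "real \<Rightarrow> real \<Rightarrow> real \<Rightarrow> real \<Rightarrow> real" where
  "ev r x y z = x + y * r + z * r\<^sup>2"

lemma ev_add: "ev r x y z + ev r x' y' z' = ev r (x + x') (y + y') (z + z')"
  and ev_diff: "ev r x y z - ev r x' y' z' = ev r (x - x') (y - y') (z - z')"
  and ev_const: "ev r x 0 0 = x" and ev_root: "ev r 0 1 0 = r"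
  unfolding ev_def by (simp_all add: algebra_simps)

lemma is_subfield_rat_adjoin: "is_subfield (rat_adjoin \<rho>)"
  unfolding is_subfield_def rat_adjoin_def by blast

lemma generator_in_rat_adjoin: "\<rho> \<in> rat_adjoin \<rho>"
  unfolding rat_adjoin_def by blast

lemma rat_adjoin_subset: "is_subfield F \<Longrightarrow> \<rho> \<in> F \<Longrightarrow> rat_adjoin \<rho> \<subseteq> F"
  unfolding rat_adjoin_def by blast

section \<open>The three roots and irreducibility\<close>

text \<open>Positivity singles out the largest root, since the other two are negative.\<close>

locale simplest_cubic =
  fixes a :: int and \<rho> :: real
  assumes a_ge: "a \<ge> -1"
    and root: "\<rho> ^ 3 = of_int a * \<rho>\<^sup>2 + (of_int a + 3) * \<rho> + 1"
    and pos: "\<rho> > 0"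
begin

abbreviation "A \<equiv> real_of_int a"

definition is_root :: "real \<Rightarrow> bool" where
  "is_root r \<longleftrightarrow> r ^ 3 = A * r\<^sup>2 + (A + 3) * r + 1"

text \<open>The orbit of \<open>\<rho>\<close> under the map \<open>r \<mapsto> - 1 - 1 / r\<close>
  of order three, which generates the Galois group.\<close>

definition rt :: "nat \<Rightarrow> real" where
  "rt k = (if k = 0 then \<rho> else if k = 1 then - 1 - 1 / \<rho> else - 1 / (1 + \<rho>))"

lemma rt_simps: "rt 0 = \<rho>" "rt 1 = - 1 - 1 / \<rho>" "rt (Suc 0) = - 1 - 1 / \<rho>" "rt 2 = - 1 / (1 + \<rho>)"
  unfolding rt_def by simp_all

lemma A_ge: "A \<ge> -1" using a_ge by simp

text \<open>Solving the cubic for \<open>a\<close> turns Vieta's formulas into identities between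
  rational functions of \<open>\<rho>\<close>.\<close>

lemma A_eq: "A = (\<rho> ^ 3 - 3 * \<rho> - 1) / (\<rho> * (\<rho> + 1))"
proof -
  have "A * (\<rho> * (\<rho> + 1)) = \<rho> ^ 3 - 3 * \<rho> - 1"
    unfolding root by (simp add: algebra_simps power2_eq_square)
  then show ?thesis using pos by (subst eq_divide_eq) auto
qed

lemma vieta: "rt 0 + rt 1 + rt 2 = A" "rt 0 * rt 1 + rt 0 * rt 2 + rt 1 * rt 2 = - (A + 3)"
    "rt 0 * rt 1 * rt 2 = 1"
proof -
  have p: "\<rho> \<noteq> 0" "1 + \<rho> \<noteq> 0" "\<rho> + 1 \<noteq> 0" using pos by auto
  have "- 1 - 1 / \<rho> = - ((1 + \<rho>) / \<rho>)" using p by (simp add: field_simps)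
  moreover have "\<rho> * - (q / \<rho>) * (- 1 / q) = 1" if "q \<noteq> 0" for q using that p by simp
  ultimately show "rt 0 * rt 1 * rt 2 = 1" unfolding rt_simps using p by metis
  show "rt 0 + rt 1 + rt 2 = A" unfolding rt_simps A_eq using p
    by (simp add: divide_simps) (simp add: algebra_simps power2_eq_square power3_eq_cube)
  show "rt 0 * rt 1 + rt 0 * rt 2 + rt 1 * rt 2 = - (A + 3)" unfolding rt_simps A_eq using p
    by (simp add: divide_simps) (simp add: algebra_simps power2_eq_square power3_eq_cube)
qed

lemma is_root_factor: "is_root r \<longleftrightarrow> (r - rt 0) * (r - rt 1) * (r - rt 2) = 0"
proof -
  have "(r - rt 0) * (r - rt 1) * (r - rt 2) = r ^ 3 - (rt 0 + rt 1 + rt 2) * r\<^sup>2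
      + (rt 0 * rt 1 + rt 0 * rt 2 + rt 1 * rt 2) * r - rt 0 * rt 1 * rt 2"
    by (simp add: algebra_simps power2_eq_square power3_eq_cube)
  also have "\<dots> = r ^ 3 - (A * r\<^sup>2 + (A + 3) * r + 1)"
    unfolding vieta by (simp add: algebra_simps)
  finally show ?thesis unfolding is_root_def by simp
qed

lemma is_root_iff: "is_root r \<longleftrightarrow> (\<exists>k<3. r = rt k)"
  unfolding is_root_factor by (auto simp: eval_nat_numeral less_Suc_eq)

lemma is_root_rt: "k < 3 \<Longrightarrow> is_root (rt k)"
  using is_root_iff by blast

lemma ev_mult:
  assumes "is_root r"
  shows "ev r x y z * ev r x' y' z' = ev r (x * x' + (y * z' + z * y') + A * (z * z'))
     (x * y' + y * x' + (A + 3) * (y * z' + z * y') + (A\<^sup>2 + 3 * A + 1) * (z * z'))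
     (x * z' + y * y' + z * x' + A * (y * z' + z * y') + (A\<^sup>2 + A + 3) * (z * z'))"
proof -
  have r3: "r ^ 3 = A * r\<^sup>2 + (A + 3) * r + 1" using assms unfolding is_root_def .
  have r4: "r ^ 4 = (A\<^sup>2 + A + 3) * r\<^sup>2 + (A\<^sup>2 + 3 * A + 1) * r + A"
  proof -
    have "r ^ 4 = r * r ^ 3" by (simp add: eval_nat_numeral)
    also have "\<dots> = A * r ^ 3 + (A + 3) * r\<^sup>2 + r" 
      by (subst r3) (simp add: algebra_simps power2_eq_square power3_eq_cube)
    finally show ?thesis unfolding r3 by (simp add: algebra_simps power2_eq_square)
  qed
  have "ev r x y z * ev r x' y' z' = x * x' + (x * y' + y * x') * r + (x * z' + y * y' + z * x') * r\<^sup>2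
      + (y * z' + z * y') * r ^ 3 + z * z' * r ^ 4"
    unfolding ev_def by (simp add: algebra_simps eval_nat_numeral)
  then show ?thesis unfolding r3 r4 ev_def by (simp add: algebra_simps)
qed

text \<open>A rational root would be an integer dividing the constant term, and neither
  \<open>1\<close> nor \<open>-1\<close> is a root.\<close>

lemma no_rational_root:
  assumes "w \<in> \<rat>" "is_root w"
  shows False
proof -
  have w: "w ^ 3 = A * w\<^sup>2 + (A + 3) * w + 1" using assms unfolding is_root_def by simp
  define p where "p = [:-1, - (A + 3), - A, 1:]"
  have "algebraic_int w"
  proof (rule algebraic_int.intros)
    show "lead_coeff p = 1" "poly p w = 0" unfolding p_def using w
      by (simp_all add: algebra_simps power2_eq_square power3_eq_cube)
    show "\<forall>i. coeff p i \<in> \<int>" unfolding p_def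
      by (auto simp: coeff_pCons split: nat.split)
  qed
  then have "w \<in> \<int>" using assms(1) by (rule rational_algebraic_int_is_int)
  then obtain n where n: "w = of_int n" by (auto elim: Ints_cases)
  have "real_of_int (n ^ 3) = of_int (a * n\<^sup>2 + (a + 3) * n + 1)" using w unfolding n by simp
  then have n3: "n ^ 3 = a * n\<^sup>2 + (a + 3) * n + 1" by (simp only: of_int_eq_iff)
  then have "n * (n\<^sup>2 - a * n - (a + 3)) = 1" by (simp add: algebra_simps power2_eq_square power3_eq_cube)
  then have "n dvd 1" by (metis dvd_triv_left)
  then have "n = 1 \<or> n = -1" by auto
  then show False using n3 by (auto; presburger)
qed

text \<open>A rational quadratic relation for \<open>r\<close> would split a linear factor off the
  cubic and thus produce a rational root.\<close>

lemma ev_eq_0: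
  assumes r: "is_root r" and q: "x \<in> \<rat>" "y \<in> \<rat>" "z \<in> \<rat>" and 0: "ev r x y z = 0"
  shows "x = 0 \<and> y = 0 \<and> z = 0"
proof -
  have irr: "r \<notin> \<rat>" using no_rational_root r by blast
  have linear: "u = 0 \<and> v = 0" if "u \<in> \<rat>" "v \<in> \<rat>" "u + v * r = 0" for u v
  proof (rule ccontr)
    assume "\<not> ?thesis"
    then have "v \<noteq> 0" using that by auto
    then have "r = - u / v" using that(3) by (simp add: field_simps eq_neg_iff_add_eq_0)
    then show False using irr that by auto
  qed
  have "z = 0"
  proof (rule ccontr)
    assume z: "z \<noteq> 0"
    define s t where "s = - y / z" and "t = - x / z"
    have st: "s \<in> \<rat>" "t \<in> \<rat>" unfolding s_def t_def using q by auto
    have "z * (r\<^sup>2 - s * r - t) = 0" using 0 z unfolding ev_def s_def t_def by (simp add: algebra_simps)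
    then have r2: "r\<^sup>2 = s * r + t" using z by simp
    have "r ^ 3 = r * r\<^sup>2" by (simp add: power2_eq_square power3_eq_cube)
    also have "\<dots> = s * r\<^sup>2 + t * r" 
      by (subst r2) (simp add: algebra_simps power2_eq_square)
    finally have "r ^ 3 = (s\<^sup>2 + t) * r + s * t" unfolding r2 by (simp add: algebra_simps power2_eq_square)
    then have "(s * t - A * t - 1) + (s\<^sup>2 + t - A * s - (A + 3)) * r = 0"
      using r unfolding is_root_def r2 by (simp add: algebra_simps)
    then have "s * t - A * t - 1 = 0" and e2: "s\<^sup>2 + t - A * s - (A + 3) = 0"
      using linear[of "s * t - A * t - 1" "s\<^sup>2 + t - A * s - (A + 3)"] st by auto
    then have e1: "t * (s - A) = 1" by (simp add: algebra_simps)
    \<comment> \<open>The two roots of the quadratic relation add up to \<open>s\<close> and all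
      three roots of the cubic to \<open>A\<close>, so this is the third root.\<close>
    define w where "w = A - s"
    have tw: "t * w = -1" using e1 unfolding w_def by (simp add: algebra_simps)
    have "t = (A - w) * w + A + 3" using e2 unfolding w_def by (simp add: algebra_simps power2_eq_square)
    then have "((A - w) * w + A + 3) * w = -1" using tw by simp
    then have "is_root w" unfolding is_root_def by (simp add: algebra_simps power2_eq_square power3_eq_cube)
    moreover have "w \<in> \<rat>" unfolding w_def using st by auto
    ultimately show False using no_rational_root by blast
  qed
  moreover from this have "x + y * r = 0" using 0 unfolding ev_def by simp
  ultimately show ?thesis using linear q by blast
qed

section \<open>The field in coordinates, and its conjugations\<close>

definition F where "F = {ev \<rho> x y z | x y z. x \<in> \<rat> \<and> y \<in> \<rat> \<and> z \<in> \<rat>}"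

lemma F_I: "x \<in> \<rat> \<Longrightarrow> y \<in> \<rat> \<Longrightarrow> z \<in> \<rat> \<Longrightarrow> ev \<rho> x y z \<in> F"
  unfolding F_def by blast

lemma root_\<rho>: "is_root \<rho>" using root unfolding is_root_def .

lemma F_ring:
  assumes "\<alpha> \<in> F" "\<beta> \<in> F"
  shows "\<alpha> + \<beta> \<in> F" "\<alpha> - \<beta> \<in> F" "\<alpha> * \<beta> \<in> F"
proof -
  obtain x y z x' y' z' where e: "\<alpha> = ev \<rho> x y z" "\<beta> = ev \<rho> x' y' z'"
    and q: "x \<in> \<rat>" "y \<in> \<rat>" "z \<in> \<rat>" "x' \<in> \<rat>" "y' \<in> \<rat>" "z' \<in> \<rat>"
    using assms unfolding F_def by auto
  show "\<alpha> + \<beta> \<in> F" "\<alpha> - \<beta> \<in> F" unfolding e ev_add ev_diff using q by (auto intro!: F_I)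
  show "\<alpha> * \<beta> \<in> F" unfolding e ev_mult[OF root_\<rho>] using q by (intro F_I Rats_add Rats_mult) auto
qed

lemma F_rat: "x \<in> \<rat> \<Longrightarrow> x \<in> F" using F_I[of x 0 0] by (simp add: ev_const)

lemma \<rho>_F: "\<rho> \<in> F" using F_I[of 0 1 0] by (simp add: ev_root)

lemma inverse_\<rho>: "1 / \<rho> = ev \<rho> (- (A + 3)) (- A) 1"
  using root pos unfolding ev_def by (simp add: field_simps power2_eq_square power3_eq_cube)

lemma inverse_1\<rho>: "1 / (1 + \<rho>) = ev \<rho> 2 (A + 1) (- 1)"
  using root pos unfolding ev_def by (simp add: field_simps power2_eq_square power3_eq_cube)

lemma rt_F: "rt k \<in> F"
proof -
  have "1 / \<rho> \<in> F" unfolding inverse_\<rho> by (intro F_I) auto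
  moreover have "1 / (1 + \<rho>) \<in> F" unfolding inverse_1\<rho> by (intro F_I) auto
  moreover have "- 1 \<in> F" "0 \<in> F" by (auto intro: F_rat)
  ultimately have "- 1 - 1 / \<rho> \<in> F" "0 - 1 / (1 + \<rho>) \<in> F" by (blast intro: F_ring(2))+
  then show ?thesis using \<rho>_F unfolding rt_def by auto
qed

text \<open>The norm is symmetric in the roots, hence a polynomial in the elementary symmetric
  functions.\<close>

lemma norm_rational:
  assumes q: "x \<in> \<rat>" "y \<in> \<rat>" "z \<in> \<rat>"
  shows "ev (rt 0) x y z * ev (rt 1) x y z * ev (rt 2) x y z \<in> \<rat>"
proof -
  define e1 e2 e3 where "e1 = rt 0 + rt 1 + rt 2" "e2 = rt 0 * rt 1 + rt 0 * rt 2 + rt 1 * rt 2" "e3 = rt 0 * rt 1 * rt 2"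
  have "ev (rt 0) x y z * ev (rt 1) x y z * ev (rt 2) x y z =
     x ^ 3 + x\<^sup>2 * y * e1 + x\<^sup>2 * z * (e1\<^sup>2 - 2 * e2) + x * y\<^sup>2 * e2 + x * y * z * (e1 * e2 - 3 * e3)
     + x * z\<^sup>2 * (e2\<^sup>2 - 2 * e1 * e3) + y ^ 3 * e3 + y\<^sup>2 * z * e1 * e3 + y * z\<^sup>2 * e2 * e3 + z ^ 3 * e3\<^sup>2"
    unfolding e1_e2_e3_def ev_def by (simp add: algebra_simps power2_eq_square power3_eq_cube)
  also have "\<dots> \<in> \<rat>" unfolding e1_e2_e3_def vieta using q
    by (intro Rats_add Rats_mult Rats_diff Rats_power) auto
  finally show ?thesis .
qed

text \<open>The inverse of an element is the product of its other two conjugates divided by the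
  norm; the conjugates lie in \<open>F\<close> because all three roots do.\<close>

lemma F_subfield: "is_subfield F"
proof -
  have "inverse \<alpha> \<in> F" if \<alpha>: "\<alpha> \<in> F" for \<alpha>
  proof (cases "\<alpha> = 0")
    case True
    then show ?thesis using F_rat by simp
  next
    case False
    obtain x y z where e: "\<alpha> = ev (rt 0) x y z" and q: "x \<in> \<rat>" "y \<in> \<rat>" "z \<in> \<rat>"
      using \<alpha> unfolding F_def rt_simps by auto
    define \<beta> where "\<beta> = ev (rt 1) x y z * ev (rt 2) x y z"
    define N where "N = ev (rt 0) x y z * ev (rt 1) x y z * ev (rt 2) x y z"
    have "ev (rt k) x y z \<noteq> 0" if "k < 3" for k
    proof
      assume "ev (rt k) x y z = 0"
      then have "x = 0 \<and> y = 0 \<and> z = 0" using ev_eq_0[OF is_root_rt[OF that] q] by blast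
      then show False using False unfolding e ev_def by simp
    qed
    then have "N \<noteq> 0" unfolding N_def by simp
    moreover have "\<alpha> * \<beta> = N" unfolding \<beta>_def N_def e by simp
    ultimately have "inverse \<alpha> = \<beta> * (1 / N)" using False by (simp add: field_simps)
    moreover have "1 / N \<in> F" using norm_rational[OF q] unfolding N_def by (intro F_rat) auto
    moreover have "\<beta> \<in> F" unfolding \<beta>_def ev_def power2_eq_square using q by (intro F_ring rt_F F_rat)
    ultimately show ?thesis using F_ring(3)[of \<beta> "1 / N"] by simp
  qed
  then show ?thesis unfolding is_subfield_def using F_ring F_rat by auto
qed

definition K where "K = rat_adjoin \<rho>"

lemma K_F: "K \<subseteq> F" unfolding K_def using rat_adjoin_subset[OF F_subfield \<rho>_F] .

lemma ev_inj:
  assumes "ev \<rho> x y z = ev \<rho> x' y' z'" "x \<in> \<rat>" "y \<in> \<rat>" "z \<in> \<rat>" "x' \<in> \<rat>" "y' \<in> \<rat>" "z' \<in> \<rat>"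
  shows "x = x' \<and> y = y' \<and> z = z'"
proof -
  have "ev \<rho> (x - x') (y - y') (z - z') = 0" using assms(1) unfolding ev_diff[symmetric] by simp
  then show ?thesis using ev_eq_0[OF root_\<rho>, of "x - x'" "y - y'" "z - z'"] assms by auto
qed

definition coord :: "real \<Rightarrow> real \<times> real \<times> real" where
  "coord \<alpha> = (THE (x, y, z). x \<in> \<rat> \<and> y \<in> \<rat> \<and> z \<in> \<rat> \<and> \<alpha> = ev \<rho> x y z)"

lemma coord_ev: "x \<in> \<rat> \<Longrightarrow> y \<in> \<rat> \<Longrightarrow> z \<in> \<rat> \<Longrightarrow> coord (ev \<rho> x y z) = (x, y, z)"
  unfolding coord_def by (rule the_equality) (auto dest: ev_inj)

text \<open>The conjugation taking \<open>\<rho>\<close> to \<open>rt k\<close>, meaningful on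
  \<open>F\<close> only.\<close>

definition cj :: "nat \<Rightarrow> real \<Rightarrow> real" where
  "cj k \<alpha> = (case coord \<alpha> of (x, y, z) \<Rightarrow> ev (rt k) x y z)"

lemma cj_ev: "x \<in> \<rat> \<Longrightarrow> y \<in> \<rat> \<Longrightarrow> z \<in> \<rat> \<Longrightarrow> cj k (ev \<rho> x y z) = ev (rt k) x y z"
  unfolding cj_def by (simp add: coord_ev)

lemma cj_rat: "x \<in> \<rat> \<Longrightarrow> cj k x = x"
  using cj_ev[of x 0 0 k] by (simp add: ev_const)

lemma cj_hom:
  assumes k: "k < 3" and "\<alpha> \<in> F" "\<beta> \<in> F"
  shows "cj k (\<alpha> + \<beta>) = cj k \<alpha> + cj k \<beta>" "cj k (\<alpha> - \<beta>) = cj k \<alpha> - cj k \<beta>" "cj k (\<alpha> * \<beta>) = cj k \<alpha> * cj k \<beta>"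
proof -
  obtain x y z x' y' z' where e: "\<alpha> = ev \<rho> x y z" "\<beta> = ev \<rho> x' y' z'"
    and q: "x \<in> \<rat>" "y \<in> \<rat>" "z \<in> \<rat>" "x' \<in> \<rat>" "y' \<in> \<rat>" "z' \<in> \<rat>"
    using assms(2,3) unfolding F_def by auto
  show "cj k (\<alpha> + \<beta>) = cj k \<alpha> + cj k \<beta>" "cj k (\<alpha> - \<beta>) = cj k \<alpha> - cj k \<beta>"
    unfolding e ev_add ev_diff using q by (simp_all add: cj_ev ev_add ev_diff)
  show "cj k (\<alpha> * \<beta>) = cj k \<alpha> * cj k \<beta>"
    unfolding e ev_mult[OF root_\<rho>] cj_ev[OF q(1-3)] cj_ev[OF q(4-6)] ev_mult[OF is_root_rt[OF k]]
    by (rule cj_ev; intro Rats_add Rats_mult Rats_power q Rats_of_int Rats_number_of Rats_1)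
qed

lemma real_embedding_cj: "k < 3 \<Longrightarrow> real_embedding K (cj k)"
  unfolding real_embedding_def using cj_hom(1,3)[of k] subsetD[OF K_F] cj_rat[of 1 k] by simp

section \<open>Real embeddings and total positivity\<close>

lemma K_ring:
  assumes "\<alpha> \<in> K" "\<beta> \<in> K"
  shows "\<alpha> + \<beta> \<in> K" "\<alpha> - \<beta> \<in> K" "\<alpha> * \<beta> \<in> K" "inverse \<alpha> \<in> K"
  using is_subfield_rat_adjoin[of \<rho>] assms unfolding is_subfield_def K_def by auto

lemma K_01: "0 \<in> K" "1 \<in> K" "\<rho> \<in> K"
  using is_subfield_rat_adjoin[of \<rho>] generator_in_rat_adjoin unfolding is_subfield_def K_def by auto

lemma K_int: "of_int n \<in> K"
proof -
  have nat: "real m \<in> K" for m by (induction m) (auto intro: K_ring K_01)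
  show ?thesis
  proof (cases "n \<ge> 0")
    case True
    then show ?thesis using nat[of "nat n"] by simp
  next
    case False
    then show ?thesis using K_ring(2)[OF K_01(1) nat[of "nat (- n)"]] by simp
  qed
qed

lemma embedding_0: "real_embedding K \<sigma> \<Longrightarrow> \<sigma> 0 = 0"
  unfolding real_embedding_def using K_01 by (metis add_cancel_right_right)

lemma embedding_int:
  assumes "real_embedding K \<sigma>"
  shows "\<sigma> (of_int n) = of_int n"
proof -
  have add: "\<sigma> (x + y) = \<sigma> x + \<sigma> y" if "x \<in> K" "y \<in> K" for x y
    using assms that unfolding real_embedding_def by blast
  have 1: "\<sigma> 1 = 1" using assms unfolding real_embedding_def by blast
  have K_nat: "of_nat m \<in> K" for m using K_int[of "int m"] by simp
  have nat: "\<sigma> (of_nat m) = of_nat m" for m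
    by (induction m) (simp_all add: embedding_0[OF assms] add K_01 K_nat 1)
  have "\<sigma> (of_int n) + \<sigma> (of_int (- n)) = 0"
    using add[OF K_int[of n] K_int[of "- n"]] embedding_0[OF assms] by simp
  then show ?thesis using nat[of "nat n"] nat[of "nat (- n)"] by (cases "n \<ge> 0") auto
qed

lemma embedding_ev:
  assumes "real_embedding K \<sigma>"
  shows "\<sigma> (ev \<rho> (of_int x) (of_int y) (of_int z)) = ev (\<sigma> \<rho>) (of_int x) (of_int y) (of_int z)" "is_root (\<sigma> \<rho>)"
proof -
  have add: "\<sigma> (x + y) = \<sigma> x + \<sigma> y" and mult: "\<sigma> (x * y) = \<sigma> x * \<sigma> y" if "x \<in> K" "y \<in> K" for x y
    using assms that unfolding real_embedding_def by blast+
  show *: "\<sigma> (ev \<rho> (of_int x) (of_int y) (of_int z)) = ev (\<sigma> \<rho>) (of_int x) (of_int y) (of_int z)" for x y z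
    unfolding ev_def power2_eq_square by (simp add: add mult K_ring K_01 K_int embedding_int[OF assms])
  have "\<rho> * ev \<rho> (of_int 0) (of_int 0) (of_int 1) = ev \<rho> (of_int 1) (of_int (a + 3)) (of_int a)"
    using root unfolding ev_def by (simp add: power2_eq_square power3_eq_cube)
  moreover have "ev \<rho> (of_int 0) (of_int 0) (of_int 1) \<in> K"
    unfolding ev_def power2_eq_square by (intro K_ring K_int K_01)
  ultimately have "\<sigma> \<rho> * ev (\<sigma> \<rho>) (of_int 0) (of_int 0) (of_int 1) = ev (\<sigma> \<rho>) (of_int 1) (of_int (a + 3)) (of_int a)"
    using mult[OF K_01(3)] * by metis
  then show "is_root (\<sigma> \<rho>)" unfolding is_root_def ev_def by (simp add: power2_eq_square power3_eq_cube algebra_simps)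
qed

text \<open>Every embedding sends \<open>\<rho>\<close> to one of the three roots, and each root is
  attained by some \<open>cj k\<close>.\<close>

lemma totally_positive_ev:
  assumes "ev \<rho> (of_int x) (of_int y) (of_int z) \<in> K"
  shows "totally_positive K (ev \<rho> (of_int x) (of_int y) (of_int z))
    \<longleftrightarrow> (\<forall>k<3. ev (rt k) (of_int x) (of_int y) (of_int z) > 0)"
proof
  assume "totally_positive K (ev \<rho> (of_int x) (of_int y) (of_int z))"
  then have "cj k (ev \<rho> (of_int x) (of_int y) (of_int z)) > 0" if "k < 3" for k
    using real_embedding_cj[OF that] unfolding totally_positive_def by blast
  then show "\<forall>k<3. ev (rt k) (of_int x) (of_int y) (of_int z) > 0" by (simp add: cj_ev)
next
  assume *: "\<forall>k<3. ev (rt k) (of_int x) (of_int y) (of_int z) > 0"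
  show "totally_positive K (ev \<rho> (of_int x) (of_int y) (of_int z))"
    unfolding totally_positive_def
  proof (intro conjI allI impI assms)
    fix \<sigma> assume \<sigma>: "real_embedding K \<sigma>"
    obtain k where "k < 3" "\<sigma> \<rho> = rt k" using embedding_ev(2)[OF \<sigma>] is_root_iff by blast
    then show "\<sigma> (ev \<rho> (of_int x) (of_int y) (of_int z)) > 0" unfolding embedding_ev(1)[OF \<sigma>] using * by simp
  qed
qed

end

section \<open>Positive trace functionals from the codifferent\<close>

text \<open>Euler's dual basis for the trace form: dividing the cubic by \<open>X - r\<close> leaves
  the coefficients \<open>r\<^sup>2 - e1 * r + e2\<close>, \<open>r - e1\<close> and
  \<open>1\<close>, and these over the derivative at \<open>r\<close> are dual to \<open>1\<close>,
  \<open>r\<close>, \<open>r\<^sup>2\<close>. The factors such as \<open>(r1 - r2) / d\<close> are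
  the inverse derivatives.\<close>

lemma lagrange_dual_basis:
  fixes r0 r1 r2 e1 e2 c0 c1 c2 :: real
  assumes "r0 \<noteq> r1" "r0 \<noteq> r2" "r1 \<noteq> r2"
    and e: "r0 + r1 + r2 = e1" "r0 * r1 + r0 * r2 + r1 * r2 = e2"
  defines "d \<equiv> (r0 - r1) * (r0 - r2) * (r1 - r2)"
    and "n \<equiv> (\<lambda>r. c0 * (r\<^sup>2 - e1 * r + e2) + c1 * (r - e1) + c2)"
  shows "n r0 * (r1 - r2) / d * ev r0 x y z + n r1 * (r2 - r0) / d * ev r1 x y z
    + n r2 * (r0 - r1) / d * ev r2 x y z = c0 * x + c1 * y + c2 * z"
proof -
  have "n r0 * (r1 - r2) * ev r0 x y z + n r1 * (r2 - r0) * ev r1 x y z + n r2 * (r0 - r1) * ev r2 x y z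
      = (c0 * x + c1 * y + c2 * z) * d"
    unfolding n_def d_def ev_def e[symmetric] by (simp add: algebra_simps power2_eq_square)
  moreover have "d \<noteq> 0" unfolding d_def using assms(1-3) by simp
  ultimately show ?thesis by (simp flip: add_divide_distrib add: divide_eq_eq)
qed

context simplest_cubic
begin

lemma rt_less: "rt 0 > 0" "rt 1 < - 1" "- 1 < rt 2" "rt 2 < 0"
  unfolding rt_simps using pos by (simp_all add: field_simps)

text \<open>Both bounds follow from the identity
  \<open>(\<rho> - A - 1) * (\<rho> + 1) = 2 + 1 / \<rho>\<close>, a rewriting of the cubic.\<close>

lemma \<rho>_bounds: "A + 1 < \<rho>" "\<rho> < A + 2 + 2 / \<rho>"
proof -
  have 1: "(\<rho> - A - 1) * (\<rho> + 1) = 2 + 1 / \<rho>"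
  proof -
    have "\<rho> * ((\<rho> - A - 1) * (\<rho> + 1)) = \<rho> * (2 + 1 / \<rho>)"
      using root pos by (simp add: algebra_simps power2_eq_square power3_eq_cube)
    then show ?thesis using pos by simp
  qed
  moreover have "2 + 1 / \<rho> > 0" using pos by (simp add: add_pos_pos)
  ultimately show "A + 1 < \<rho>" using pos zero_less_mult_iff[of "\<rho> - A - 1" "\<rho> + 1"] by simp
  have "(1 + 2 / \<rho>) * (\<rho> + 1) = \<rho> + 3 + 2 / \<rho>"
    using pos by (simp add: distrib_left distrib_right)
  then have "(1 + 2 / \<rho>) * (\<rho> + 1) > 2 + 1 / \<rho>" using pos by (simp add: divide_strict_right_mono add_strict_mono)
  then have "(\<rho> - A - 1) * (\<rho> + 1) < (1 + 2 / \<rho>) * (\<rho> + 1)" using 1 by simp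
  then show "\<rho> < A + 2 + 2 / \<rho>" using pos by (simp add: mult_less_cancel_right)
qed

text \<open>The derivative of the cubic is positive at \<open>rt 0\<close> and \<open>rt 1\<close>
  and negative at \<open>rt 2\<close>, so the hypotheses say that numerator and denominator of each
  weight have the same sign. Here \<open>1 / r\<close> stands for
  \<open>r\<^sup>2 - A * r - (A + 3)\<close>.\<close>

lemma positive_weights:
  assumes "c0 * (1 / rt 0) + c1 * (rt 0 - A) + c2 > 0"
    and "c0 * (1 / rt 1) + c1 * (rt 1 - A) + c2 > 0"
    and "c0 * (1 / rt 2) + c1 * (rt 2 - A) + c2 < 0"
  obtains w where "\<And>k. k < 3 \<Longrightarrow> w k > 0"
    and "\<And>x y z. (\<Sum>k<3. w k * ev (rt k) x y z) = c0 * x + c1 * y + c2 * z"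
proof -
  define d where "d = (rt 0 - rt 1) * (rt 0 - rt 2) * (rt 1 - rt 2)"
  define n where "n k = c0 * (1 / rt k) + c1 * (rt k - A) + c2" for k
  define w where "w k = n k * (if k = 0 then rt 1 - rt 2 else if k = 1 then rt 2 - rt 0 else rt 0 - rt 1) / d" for k :: nat
  have d: "d < 0" unfolding d_def using rt_less by (intro mult_pos_neg mult_pos_pos) auto
  have n: "n 0 > 0" "n 1 > 0" "n 2 < 0" unfolding n_def using assms by auto
  have "w 0 > 0" "w 1 > 0" "w 2 > 0" unfolding w_def using n d rt_less
    by (simp_all add: divide_pos_pos divide_neg_neg mult_pos_neg mult_neg_pos)
  then have "\<And>k. k < 3 \<Longrightarrow> w k > 0" by (auto simp: eval_nat_numeral less_Suc_eq)
  moreover have inv: "1 / rt k = (rt k)\<^sup>2 - A * rt k + - (A + 3)" if "k < 3" for k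
  proof -
    have "rt k * ((rt k)\<^sup>2 - A * rt k + - (A + 3)) = 1"
      using is_root_rt[OF that] unfolding is_root_def by (simp add: algebra_simps power2_eq_square power3_eq_cube)
    then show ?thesis by (metis mult_zero_left nonzero_eq_divide_eq mult.commute zero_neq_one)
  qed
  have "(\<Sum>k<3. w k * ev (rt k) x y z) = c0 * x + c1 * y + c2 * z" for x y z
  proof -
    have "rt 0 \<noteq> rt 1" "rt 0 \<noteq> rt 2" "rt 1 \<noteq> rt 2" using rt_less by auto
    from lagrange_dual_basis[OF this vieta(1,2), of c0 c1 c2 x y z]
    show ?thesis unfolding d_def[symmetric]
      by (simp add: eval_nat_numeral w_def n_def inv)
  qed
  ultimately show ?thesis using that by blast
qed

text \<open>The traces of \<open>x + y \<rho> + z \<rho>\<^sup>2\<close> against the two codifferent elements used below are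
  \<open>(2 x - y + 2 z) / 2\<close> and \<open>x + z\<close>; they equal \<open>1\<close> at the generators of the first and of the
  second cone, respectively.\<close>

definition height :: "real \<Rightarrow> real" where
  "height \<alpha> = (case coord \<alpha> of (x, y, z) \<Rightarrow> x + z)"

text \<open>The conjugates of the codifferent element whose trace pairing is
  \<open>height\<close>.\<close>

definition height_weight :: "nat \<Rightarrow> real" where
  "height_weight = (SOME w. (\<forall>k<3. w k > 0) \<and> (\<forall>x y z. (\<Sum>k<3. w k * ev (rt k) x y z) = x + z))"

lemma inverse_rt: "1 / rt 0 = - 1 - rt 1" "1 / rt 1 = - 1 - rt 2" "1 / rt 2 = - 1 - rt 0"
proof -
  have "- 1 - 1 / \<rho> = - ((1 + \<rho>) / \<rho>)" using pos by (simp add: field_simps)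
  then have "1 / rt 1 = - (\<rho> / (1 + \<rho>))" unfolding rt_simps by simp
  also have "\<dots> = - 1 - rt 2" unfolding rt_simps using pos by (simp add: field_simps)
  finally show "1 / rt 1 = - 1 - rt 2" .
qed (use pos in \<open>simp_all add: rt_simps field_simps\<close>)

lemma height_weight: "k < 3 \<Longrightarrow> height_weight k > 0" "(\<Sum>k<3. height_weight k * ev (rt k) x y z) = x + z"
proof -
  have "1 * (1 / rt 0) + 0 * (rt 0 - A) + 1 > 0" "1 * (1 / rt 1) + 0 * (rt 1 - A) + 1 > 0"
      "1 * (1 / rt 2) + 0 * (rt 2 - A) + 1 < 0"
    unfolding inverse_rt using rt_less by auto
  then obtain w where "\<And>k. k < 3 \<Longrightarrow> w k > 0"
      "\<And>x y z. (\<Sum>k<3. w k * ev (rt k) x y z) = 1 * x + 0 * y + 1 * z"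
    using positive_weights[of 1 0 1] by blast
  then have "(\<forall>k<3. w k > 0) \<and> (\<forall>x y z. (\<Sum>k<3. w k * ev (rt k) x y z) = x + z)" by simp
  then have "(\<forall>k<3. height_weight k > 0) \<and> (\<forall>x y z. (\<Sum>k<3. height_weight k * ev (rt k) x y z) = x + z)"
    unfolding height_weight_def
    by (rule someI[where P = "\<lambda>w. (\<forall>k<3. w k > 0) \<and> (\<forall>x y z. (\<Sum>k<3. w k * ev (rt k) x y z) = x + z)"])
  then show "k < 3 \<Longrightarrow> height_weight k > 0" "(\<Sum>k<3. height_weight k * ev (rt k) x y z) = x + z" by auto
qed

lemma cone2_functional_pos:
  assumes "\<forall>k<3. ev (rt k) x y z > 0"
  shows "x + z > 0"
proof -
  have "(\<Sum>k<3. height_weight k * ev (rt k) x y z) > 0"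
    using assms height_weight(1) by (intro sum_pos mult_pos_pos) (auto simp: lessThan_empty_iff)
  then show ?thesis unfolding height_weight(2) .
qed

lemma cone1_functional_pos:
  assumes "\<forall>k<3. ev (rt k) x y z > 0"
  shows "2 * x - y + 2 * z > 0"
proof -
  \<comment> \<open>This is precisely the upper bound in \<open>\<rho>_bounds\<close>.\<close>
  have "2 * (1 / rt 0) + - 1 * (rt 0 - A) + 2 > 0" unfolding rt_simps using \<rho>_bounds by simp
  moreover have "2 * (1 / rt 1) + - 1 * (rt 1 - A) + 2 > 0" unfolding inverse_rt using rt_less A_ge by simp
  moreover have "2 * (1 / rt 2) + - 1 * (rt 2 - A) + 2 < 0"
    unfolding inverse_rt using rt_less \<rho>_bounds(1) pos by (simp add: rt_simps(1))
  ultimately obtain w where w: "\<And>k. k < 3 \<Longrightarrow> w k > 0"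
    and "\<And>x y z. (\<Sum>k<3. w k * ev (rt k) x y z) = 2 * x + - 1 * y + 2 * z"
    using positive_weights[of 2 "- 1" 2] by blast
  then have "2 * x - y + 2 * z = (\<Sum>k<3. w k * ev (rt k) x y z)" by simp
  also have "\<dots> > 0" using assms w by (intro sum_pos mult_pos_pos) (auto simp: lessThan_empty_iff)
  finally show ?thesis .
qed

end

section \<open>The ring of integers in coordinates\<close>

locale simplest_cubic_integers = simplest_cubic +
  assumes integers: "ring_of_integers (rat_adjoin \<rho>) = int_adjoin \<rho>"
begin

definition OK where "OK = ring_of_integers K"

definition evi :: "int \<Rightarrow> int \<Rightarrow> int \<Rightarrow> real" where
  "evi x y z = ev \<rho> (of_int x) (of_int y) (of_int z)"

text \<open>Horner's scheme, replacing \<open>\<rho> ^ 3\<close> by the cubic relation in each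
  step.\<close>

lemma poly_int_ev: "\<forall>i. coeff p i \<in> \<int> \<Longrightarrow> \<exists>x y z. poly p \<rho> = evi x y z"
proof (induction p)
  case 0
  show ?case by (intro exI[of _ 0]) (simp add: evi_def ev_def)
next
  case (pCons c p)
  have "coeff p i \<in> \<int>" for i using pCons.prems by (metis coeff_pCons_Suc)
  then obtain x y z where "poly p \<rho> = evi x y z" using pCons.IH by blast
  moreover obtain n where n: "c = of_int n" using pCons.prems by (metis Ints_cases coeff_pCons_0)
  ultimately have "poly (pCons c p) \<rho> = of_int n + \<rho> * evi x y z" by simp
  also have "\<dots> = of_int n + of_int x * \<rho> + of_int y * \<rho>\<^sup>2 + of_int z * \<rho> ^ 3"
    unfolding evi_def ev_def by (simp add: algebra_simps power2_eq_square power3_eq_cube)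
  also have "\<dots> = evi (n + z) (x + (a + 3) * z) (y + a * z)"
    unfolding root evi_def ev_def by (simp add: algebra_simps)
  finally show ?case by blast
qed

lemma OK_iff: "\<alpha> \<in> OK \<longleftrightarrow> (\<exists>x y z. \<alpha> = evi x y z)"
proof
  assume "\<alpha> \<in> OK"
  then show "\<exists>x y z. \<alpha> = evi x y z"
    unfolding OK_def K_def integers int_adjoin_def using poly_int_ev by auto
next
  assume "\<exists>x y z. \<alpha> = evi x y z"
  then obtain x y z where "\<alpha> = evi x y z" by blast
  then have "\<alpha> = poly [:of_int x, of_int y, of_int z:] \<rho>" unfolding evi_def ev_def
    by (simp add: algebra_simps power2_eq_square)
  moreover have "\<forall>i. coeff [:of_int x, of_int y, of_int z:] i \<in> (\<int> :: real set)"
    by (auto simp: coeff_pCons split: nat.split)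
  ultimately show "\<alpha> \<in> OK" unfolding OK_def K_def integers int_adjoin_def by blast
qed

lemma evi_OK: "evi x y z \<in> OK"
  unfolding OK_iff by blast

lemma OK_K: "\<alpha> \<in> OK \<Longrightarrow> \<alpha> \<in> K"
  unfolding OK_def ring_of_integers_def by blast

lemma evi_add: "evi x y z + evi x' y' z' = evi (x + x') (y + y') (z + z')"
  and evi_diff: "evi x y z - evi x' y' z' = evi (x - x') (y - y') (z - z')"
  by (simp_all add: evi_def ev_add ev_diff)

lemma evi_mult: "evi x y z * evi x' y' z' = evi (x * x' + (y * z' + z * y') + a * (z * z'))
     (x * y' + y * x' + (a + 3) * (y * z' + z * y') + (a\<^sup>2 + 3 * a + 1) * (z * z'))
     (x * z' + y * y' + z * x' + a * (y * z' + z * y') + (a\<^sup>2 + a + 3) * (z * z'))"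
  by (simp add: evi_def ev_mult[OF root_\<rho>])

lemma evi_int: "of_int n = evi n 0 0"
  unfolding evi_def ev_def by simp

lemma OK_ring: "\<alpha> \<in> OK \<Longrightarrow> \<beta> \<in> OK \<Longrightarrow> \<alpha> + \<beta> \<in> OK" "\<alpha> \<in> OK \<Longrightarrow> \<beta> \<in> OK \<Longrightarrow> \<alpha> - \<beta> \<in> OK"
    "\<alpha> \<in> OK \<Longrightarrow> \<beta> \<in> OK \<Longrightarrow> \<alpha> * \<beta> \<in> OK"
  unfolding OK_iff using evi_add evi_diff evi_mult by metis+

lemma OK_int: "of_int n \<in> OK" "0 \<in> OK" "1 \<in> OK" "numeral m \<in> OK"
  using evi_OK[of n 0 0] evi_OK[of 0 0 0] evi_OK[of 1 0 0] evi_OK[of "numeral m" 0 0]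
  unfolding evi_def ev_def by simp_all

lemma OK_sum: "(\<And>i. i \<in> I \<Longrightarrow> f i \<in> OK) \<Longrightarrow> sum f I \<in> OK"
  by (induction I rule: infinite_finite_induct) (auto intro: OK_ring OK_int)

lemma coord_evi: "coord (evi x y z) = (of_int x, of_int y, of_int z)"
  unfolding evi_def by (rule coord_ev) auto

lemma height_evi: "height (evi x y z) = of_int (x + z)"
  unfolding height_def by (simp add: coord_evi)

abbreviation TP where "TP \<equiv> totally_positive K"

lemma TP_evi: "TP (evi x y z) \<longleftrightarrow> (\<forall>k<3. ev (rt k) (of_int x) (of_int y) (of_int z) > 0)"
  unfolding evi_def by (rule totally_positive_ev[OF OK_K[OF evi_OK[unfolded evi_def]]])

lemma functionals_pos:
  assumes "TP (evi x y z)"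
  shows "2 * x - y + 2 * z > 0" "x + z > 0"
proof -
  have "real_of_int (2 * x - y + 2 * z) > 0" using cone1_functional_pos assms unfolding TP_evi by simp
  then show "2 * x - y + 2 * z > 0" by (simp only: of_int_0_less_iff)
  have "real_of_int (x + z) > 0" using cone2_functional_pos assms unfolding TP_evi by simp
  then show "x + z > 0" by (simp only: of_int_0_less_iff)
qed

lemma TP_add: "TP \<alpha> \<Longrightarrow> TP \<beta> \<Longrightarrow> TP (\<alpha> + \<beta>)"
  unfolding totally_positive_def real_embedding_def using K_ring(1) add_pos_pos by metis

lemma TP_mult: "TP \<alpha> \<Longrightarrow> TP \<beta> \<Longrightarrow> TP (\<alpha> * \<beta>)"
  unfolding totally_positive_def real_embedding_def using K_ring(3) mult_pos_pos by metis

lemma TP_square: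
  assumes "v \<in> K" "v \<noteq> 0"
  shows "TP (v\<^sup>2)"
  unfolding totally_positive_def
proof (intro conjI allI impI)
  show "v\<^sup>2 \<in> K" unfolding power2_eq_square using assms K_ring by blast
  fix \<sigma> assume \<sigma>: "real_embedding K \<sigma>"
  then have mult: "\<sigma> (x * y) = \<sigma> x * \<sigma> y" if "x \<in> K" "y \<in> K" for x y
    using that unfolding real_embedding_def by blast
  have "\<sigma> v * \<sigma> (inverse v) = \<sigma> 1" using mult[of v "inverse v"] assms K_ring(4) by simp
  then have "\<sigma> v \<noteq> 0" using \<sigma> unfolding real_embedding_def by auto
  then show "\<sigma> (v\<^sup>2) > 0" unfolding power2_eq_square mult[OF assms(1,1)] by (metis not_real_square_gt_zero)
qed

lemma TP_1: "TP 1" using TP_square[of 1] K_01 by simp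

end

section \<open>Totally positive integers up to squares of units\<close>

context simplest_cubic_integers
begin

text \<open>The determinant, up to sign, of the generators \<open>1\<close>,
  \<open>\<rho>\<^sup>2\<close> and \<open>(\<rho> / (1 + \<rho>))\<^sup>2\<close> of the second
  cone, that is, the number of lattice points in its half-open parallelepiped.\<close>

abbreviation D :: int where "D \<equiv> a\<^sup>2 + 3 * a + 3"

lemma D_pos: "D > 0"
proof -
  have "0 \<le> (a + 1) * (a + 2)" using a_ge by simp
  then show ?thesis by (simp add: algebra_simps power2_eq_square)
qed

definition unit_OK :: "real \<Rightarrow> bool" where
  "unit_OK u \<longleftrightarrow> u \<in> OK \<and> (\<exists>w\<in>OK. u * w = 1)"

lemma unit_OK_mult: "unit_OK u \<Longrightarrow> unit_OK v \<Longrightarrow> unit_OK (u * v)"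
  unfolding unit_OK_def using OK_ring(3) by (metis mult.assoc mult.left_commute mult_1_right)

lemma unit_evi:
  "unit_OK 1" "unit_OK (evi 0 1 0)" "unit_OK (evi (- (a + 3)) (- a) 1)"
  "unit_OK (evi 1 1 0)" "unit_OK (evi 2 (a + 1) (- 1))"
proof -
  have inv: "evi 0 1 0 * evi (- (a + 3)) (- a) 1 = 1" "evi 1 1 0 * evi 2 (a + 1) (- 1) = 1"
    unfolding evi_mult by (simp_all add: evi_int[of 1, symmetric, simplified] algebra_simps)
  have unit: "unit_OK u \<and> unit_OK w" if "u \<in> OK" "w \<in> OK" "u * w = 1" for u w
    unfolding unit_OK_def using that by (metis mult.commute)
  show "unit_OK 1" using unit[OF OK_int(3) OK_int(3)] by simp
  show "unit_OK (evi 0 1 0)" "unit_OK (evi (- (a + 3)) (- a) 1)"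
    using unit[OF evi_OK evi_OK inv(1)] by auto
  show "unit_OK (evi 1 1 0)" "unit_OK (evi 2 (a + 1) (- 1))"
    using unit[OF evi_OK evi_OK inv(2)] by auto
qed

text \<open>Both functionals are positive integers on totally positive integers, so their minimum
  over the orbit of \<open>\<alpha>\<close> is attained. The sign of \<open>y\<close> tells which
  functional is smaller, and hence which cone is reached.\<close>

lemma fundamental_domain:
  assumes "\<alpha> \<in> OK" "TP \<alpha>"
  obtains u w x y z where "u \<in> OK" "w \<in> OK" "u * w = 1" "\<alpha> * u\<^sup>2 = evi x y z" "TP (evi x y z)"
    "(0 \<le> y \<and> y \<le> 2 * x \<and> y \<le> 2 * z) \<or> (y \<le> 0 \<and> (a + 1) * y \<le> D * x \<and> - (a + 2) * y \<le> D * z)"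
proof -
  define P where "P t \<longleftrightarrow> (case t of (x, y, z) \<Rightarrow> \<exists>u. unit_OK u \<and> \<alpha> * u\<^sup>2 = evi x y z)" for t
  \<comment> \<open>The factor \<open>2\<close> puts the functionals on the same scale; they agree
    where \<open>y = 0\<close>, the common face of the cones.\<close>
  define m where "m t = (case t of (x, y, z) \<Rightarrow> nat (min (2 * x - y + 2 * z) (2 * (x + z))))" for t :: "int \<times> int \<times> int"
  have TP: "TP (evi x y z)" if "P (x, y, z)" for x y z
  proof -
    from that obtain u where u: "unit_OK u" "\<alpha> * u\<^sup>2 = evi x y z" unfolding P_def by auto
    then have "u \<noteq> 0" "u \<in> K" unfolding unit_OK_def using OK_K by auto
    then show ?thesis using TP_mult[OF assms(2) TP_square] u by metis
  qed
  obtain x0 y0 z0 where "\<alpha> = evi x0 y0 z0" using assms(1) OK_iff by blast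
  then have "P (x0, y0, z0)" unfolding P_def using unit_evi(1) by auto
  then obtain t where t: "P t" "\<And>s. P s \<Longrightarrow> m t \<le> m s"
    using ex_has_least_nat[of P _ m] by blast
  obtain x y z where xyz: "t = (x, y, z)" by (cases t)
  obtain u where u: "unit_OK u" "\<alpha> * u\<^sup>2 = evi x y z" using t(1) unfolding P_def xyz by auto
  have pos: "2 * x - y + 2 * z > 0" "x + z > 0" using functionals_pos[OF TP[OF t(1)[unfolded xyz]]] by auto
  have min: "min (2 * x - y + 2 * z) (2 * (x + z)) \<le> min (2 * x' - y' + 2 * z') (2 * (x' + z'))"
    if "unit_OK (evi p q r)" "evi x y z * (evi p q r)\<^sup>2 = evi x' y' z'" for p q r x' y' z'
  proof -
    have "\<alpha> * (u * evi p q r)\<^sup>2 = evi x' y' z'"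
      unfolding that(2)[symmetric] u(2)[symmetric] by (simp add: power_mult_distrib)
    then have P': "P (x', y', z')" unfolding P_def using unit_OK_mult[OF u(1) that(1)] by auto
    then have "m (x, y, z) \<le> m (x', y', z')" using t(2) xyz by blast
    moreover have "2 * x' - y' + 2 * z' > 0" "x' + z' > 0" using functionals_pos[OF TP[OF P']] by auto
    ultimately show ?thesis using pos unfolding m_def by (simp add: nat_le_eq_zle)
  qed
  \<comment> \<open>For \<open>y \<le> 0\<close> the other two facets come from the units
    \<open>1 + \<rho>\<close> and \<open>(1 + \<rho>) / \<rho>\<close>, for \<open>y > 0\<close>
    from their inverses.\<close>
  note units = unit_evi unit_OK_mult[OF unit_evi(4,3)] unit_OK_mult[OF unit_evi(2,5)]
  note units' = units(4,5) units(6,7)[unfolded evi_mult]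
  note m' = min[OF units'(1), unfolded power2_eq_square evi_mult, OF refl]
    min[OF units'(2), unfolded power2_eq_square evi_mult, OF refl]
    min[OF units'(3), unfolded power2_eq_square evi_mult, OF refl]
    min[OF units'(4), unfolded power2_eq_square evi_mult, OF refl]
  have "(0 \<le> y \<and> y \<le> 2 * x \<and> y \<le> 2 * z) \<or> (y \<le> 0 \<and> (a + 1) * y \<le> D * x \<and> - (a + 2) * y \<le> D * z)"
  proof (cases "y \<le> 0")
    case True
    then have eq: "min (2 * x - y + 2 * z) (2 * (x + z)) = 2 * (x + z)" by simp
    from m'(1) m'(3) have "- (a + 2) * y \<le> D * z" "(a + 1) * y \<le> D * x"
      unfolding eq by (simp_all add: algebra_simps power2_eq_square)
    then show ?thesis using True by blast
  next
    case False
    then have eq: "min (2 * x - y + 2 * z) (2 * (x + z)) = 2 * x - y + 2 * z" by simp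
    from m'(2) m'(4) have "y \<le> 2 * x" "y \<le> 2 * z"
      unfolding eq by (simp_all add: algebra_simps power2_eq_square)
    then show ?thesis using False by auto
  qed
  moreover obtain w where "w \<in> OK" "u * w = 1" using u(1) unfolding unit_OK_def by blast
  moreover have "TP (evi x y z)" using TP t(1) xyz by blast
  ultimately show ?thesis using that u unfolding unit_OK_def by blast
qed

section \<open>Representation by diagonal forms\<close>

text \<open>Diagonal forms are lists of coefficients, so that orthogonal sums are
  concatenations.\<close>

definition rep :: "real list \<Rightarrow> real \<Rightarrow> bool" where
  "rep cs \<alpha> \<longleftrightarrow> (\<exists>vs. length vs = length cs \<and> set vs \<subseteq> OK \<and> \<alpha> = sum_list (map2 (\<lambda>c v. c * v\<^sup>2) cs vs))"

lemma rep_append: 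
  assumes "rep cs \<alpha>" "rep ds \<beta>"
  shows "rep (cs @ ds) (\<alpha> + \<beta>)"
proof -
  obtain vs ws where "length vs = length cs" "set vs \<subseteq> OK" "\<alpha> = sum_list (map2 (\<lambda>c v. c * v\<^sup>2) cs vs)"
    "length ws = length ds" "set ws \<subseteq> OK" "\<beta> = sum_list (map2 (\<lambda>c v. c * v\<^sup>2) ds ws)"
    using assms unfolding rep_def by blast
  then show ?thesis unfolding rep_def by (intro exI[of _ "vs @ ws"]) simp
qed

lemma rep_single: "v \<in> OK \<Longrightarrow> rep [c] (c * v\<^sup>2)"
  unfolding rep_def by (intro exI[of _ "[v]"]) simp

lemma rep_zero: "rep cs 0"
proof (induction cs)
  case Nil
  show ?case unfolding rep_def by simp
next
  case (Cons c cs)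
  show ?case using rep_append[OF rep_single[OF OK_int(2)] Cons.IH, of c] by simp
qed

lemma rep_member:
  assumes "c \<in> set cs"
  shows "rep cs c"
proof -
  obtain ds es where cs: "cs = ds @ [c] @ es" using split_list[OF assms] by auto
  show ?thesis using rep_append[OF rep_zero rep_append[OF rep_single[OF OK_int(3)] rep_zero], of ds c es]
    unfolding cs by simp
qed

lemma rep_scale:
  assumes "rep cs \<alpha>" "u \<in> OK"
  shows "rep cs (\<alpha> * u\<^sup>2)"
proof -
  obtain vs where vs: "length vs = length cs" "set vs \<subseteq> OK" "\<alpha> = sum_list (map2 (\<lambda>c v. c * v\<^sup>2) cs vs)"
    using assms unfolding rep_def by blast
  have "sum_list (map2 (\<lambda>c v. c * v\<^sup>2) cs (map (\<lambda>v. v * u) vs)) = sum_list (map2 (\<lambda>c v. c * v\<^sup>2) cs vs) * u\<^sup>2"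
    using vs(1)[symmetric] by (induction cs vs rule: list_induct2) (simp_all add: algebra_simps power2_eq_square)
  then show ?thesis unfolding rep_def using vs assms(2) OK_ring(3)
    by (intro exI[of _ "map (\<lambda>v. v * u) vs"]) auto
qed

text \<open>Writing \<open>n\<close> as a sum of four squares distributes \<open>n\<close> over four
  variables, each a multiple of \<open>e\<close>.\<close>

lemma rep_four:
  assumes "n \<ge> 0" "e \<in> OK"
  shows "rep (replicate 4 c) (of_int n * (c * e\<^sup>2))"
proof -
  obtain p q r s where n: "n = p\<^sup>2 + q\<^sup>2 + r\<^sup>2 + s\<^sup>2" using four_squares[OF assms(1)] .
  define vs where "vs = [of_int p * e, of_int q * e, of_int r * e, of_int s * e]"
  have "length vs = length (replicate 4 c)" unfolding vs_def by simp
  moreover have "set vs \<subseteq> OK" unfolding vs_def using assms(2) by (auto intro: OK_ring OK_int)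
  moreover have "of_int n * (c * e\<^sup>2) = sum_list (map2 (\<lambda>c v. c * v\<^sup>2) (replicate 4 c) vs)"
    unfolding vs_def n by (simp add: eval_nat_numeral algebra_simps)
  ultimately show ?thesis unfolding rep_def by blast
qed

lemma universal_diagonal:
  assumes TP: "\<And>c. c \<in> set cs \<Longrightarrow> c \<in> OK \<and> TP c"
    and rep: "\<And>\<alpha>. \<alpha> \<in> OK \<Longrightarrow> TP \<alpha> \<Longrightarrow> rep cs \<alpha>"
  shows "\<exists>A. universal_form K (length cs) A \<and> diagonal_form (length cs) A"
proof -
  define A where "A i j = (if i = j then cs ! i else 0)" for i j
  define n where "n = length cs"
  have cs: "cs ! i \<in> OK" "TP (cs ! i)" if "i < n" for i using TP that unfolding n_def by auto
  have fv: "form_value n A v = (\<Sum>i<n. cs ! i * (v i)\<^sup>2)" for v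
  proof -
    have "(\<Sum>j\<in>{i..<n}. A i j * v i * v j) = cs ! i * (v i)\<^sup>2" if "i < n" for i
    proof -
      have "(\<Sum>j\<in>{i..<n}. A i j * v i * v j) = (\<Sum>j\<in>{i..<n}. if j = i then cs ! i * (v i)\<^sup>2 else 0)"
        unfolding A_def by (intro sum.cong) (auto simp: power2_eq_square)
      then show ?thesis using that by simp
    qed
    then show ?thesis unfolding form_value_def by simp
  qed
  have "is_quadratic_form K n A" unfolding is_quadratic_form_def A_def
    using cs(1) OK_int(2) unfolding OK_def[symmetric] by auto
  moreover have "totally_positive_form K n A" unfolding totally_positive_form_def
  proof (intro allI impI, elim conjE exE)
    fix v i0 assume v: "integral_vector K n v" and i0: "i0 < n" "v i0 \<noteq> 0"
    have vK: "v i \<in> K" if "i < n" for i using v that OK_K unfolding integral_vector_def OK_def by auto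
    \<comment> \<open>Vanishing variables are dropped because \<open>0\<close> is not totally
      positive.\<close>
    define J where "J = {i. i < n \<and> v i \<noteq> 0}"
    have pos: "TP (cs ! i * (v i)\<^sup>2)" if "i \<in> J" for i
      using that cs(2) vK unfolding J_def by (intro TP_mult TP_square) auto
    have "TP (\<Sum>i\<in>J'. cs ! i * (v i)\<^sup>2)" if "finite J'" "J' \<noteq> {}" "J' \<subseteq> J" for J'
      using that by (induction J' rule: finite_ne_induct) (auto intro: pos TP_add)
    from this[of J] have "TP (\<Sum>i\<in>J. cs ! i * (v i)\<^sup>2)" using i0 unfolding J_def by auto
    moreover have "(\<Sum>i<n. cs ! i * (v i)\<^sup>2) = (\<Sum>i\<in>J. cs ! i * (v i)\<^sup>2)"
      unfolding J_def by (intro sum.mono_neutral_right) auto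
    ultimately show "TP (form_value n A v)" unfolding fv by simp
  qed
  moreover have "\<exists>v. integral_vector K n v \<and> form_value n A v = \<alpha>"
    if \<alpha>: "\<alpha> \<in> ring_of_integers K" "TP \<alpha>" for \<alpha>
  proof -
    obtain vs where vs: "length vs = length cs" "set vs \<subseteq> OK" "\<alpha> = sum_list (map2 (\<lambda>c v. c * v\<^sup>2) cs vs)"
      using rep[of \<alpha>] \<alpha> unfolding OK_def[symmetric] rep_def by blast
    have "integral_vector K n (\<lambda>i. vs ! i)" unfolding integral_vector_def OK_def[symmetric]
      using vs(1,2) unfolding n_def by auto
    moreover have "form_value n A (\<lambda>i. vs ! i) = \<alpha>"
      using vs(1) unfolding vs(3) by (simp add: fv sum_list_sum_nth atLeast0LessThan n_def[symmetric])
    ultimately show ?thesis by blast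
  qed
  moreover have "diagonal_form n A" unfolding diagonal_form_def A_def by auto
  ultimately show ?thesis unfolding universal_form_def n_def by blast
qed

text \<open>The generators \<open>e\<^sub>2\<close>, \<open>e\<^sub>3\<close> and
  \<open>e\<^sub>4\<close> as squares of \<open>\<rho>\<close>, \<open>1 + \<rho>\<close> and
  \<open>\<rho> / (1 + \<rho>)\<close>.\<close>

lemma units_squared:
  "(evi 0 1 0)\<^sup>2 = evi 0 0 1" "(evi 1 1 0)\<^sup>2 = evi 1 2 1"
  "(evi (- 1) (- (a + 1)) 1)\<^sup>2 = evi (- 1 - a) (- D) (a + 2)"
  unfolding power2_eq_square evi_mult by (simp_all add: algebra_simps)

lemma TP_unit_squares: "TP (evi 0 0 1)" "TP (evi (- 1 - a) (- D) (a + 2))"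
proof -
  have "evi 0 1 0 \<noteq> 0" "evi (- 1) (- (a + 1)) 1 \<noteq> 0"
    using ev_eq_0[OF root_\<rho>, of 0 1 0] ev_eq_0[OF root_\<rho>, of "- 1" "- (of_int a + 1)" 1]
    unfolding evi_def by auto
  then show "TP (evi 0 0 1)" "TP (evi (- 1 - a) (- D) (a + 2))"
    unfolding units_squared[symmetric] using TP_square OK_K evi_OK by auto
qed

text \<open>The inequalities say that \<open>D\<close> times the element is a nonnegative
  combination of \<open>e\<^sub>1\<close>, \<open>e\<^sub>2\<close> and \<open>e\<^sub>4\<close>;
  the coefficient \<open>- y\<close> of \<open>e\<^sub>4\<close> is positive.\<close>

lemma TP_cone:
  assumes "y < 0" "(a + 1) * y \<le> D * x" "- (a + 2) * y \<le> D * z"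
  shows "TP (evi x y z)"
  unfolding TP_evi
proof (intro allI impI)
  fix k :: nat assume k: "k < 3"
  define n1 n2 where "n1 = D * x - (a + 1) * y" and "n2 = D * z + (a + 2) * y"
  have n: "real_of_int n1 \<ge> 0" "real_of_int n2 \<ge> 0" "- real_of_int y > 0" unfolding n1_def n2_def using assms by linarith+
  define E where "E = ev (rt k) (of_int (- 1 - a)) (of_int (- D)) (of_int (a + 2))"
  have pos: "(rt k)\<^sup>2 > 0" "E > 0"
    using TP_unit_squares k unfolding TP_evi E_def by (auto simp: ev_def)
  have "of_int D * ev (rt k) (of_int x) (of_int y) (of_int z) = of_int n1 + of_int n2 * (rt k)\<^sup>2 + (- of_int y) * E"
    unfolding n1_def n2_def E_def ev_def by (simp add: algebra_simps power2_eq_square)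
  also have "\<dots> > 0" using n pos by (intro add_nonneg_pos add_nonneg_nonneg mult_nonneg_nonneg mult_pos_pos) auto
  finally show "ev (rt k) (of_int x) (of_int y) (of_int z) > 0"
    using D_pos by (simp add: zero_less_mult_iff del: of_int_add of_int_mult of_int_power)
qed

lemma TP_f: "TP (evi 1 1 1)"
proof -
  have "1 + r + r\<^sup>2 > 0" for r :: real
    using zero_le_power2[of "r + 1 / 2"] by (simp add: power2_eq_square algebra_simps)
  then show ?thesis unfolding TP_evi ev_def by simp
qed

text \<open>The first cone has index \<open>2\<close>: the parity of \<open>y\<close> decides
  whether \<open>1 + \<rho> + \<rho>\<^sup>2\<close>, the only nonzero point of its parallelepiped,
  occurs.\<close>

lemma cone1_decomposition:
  assumes "0 \<le> y" "y \<le> 2 * x" "y \<le> 2 * z"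
  obtains n1 n2 n3 e :: int where "n1 \<ge> 0" "n2 \<ge> 0" "n3 \<ge> 0" "e = 0 \<or> e = 1"
    "x = n1 + n3 + e" "y = 2 * n3 + e" "z = n2 + n3 + e"
proof -
  define n3 e where "n3 = y div 2" and "e = y mod 2"
  have "y = 2 * n3 + e" "e = 0 \<or> e = 1" unfolding n3_def e_def by auto
  then show ?thesis using that[of "x - n3 - e" "z - n3 - e" n3 e] assms by auto
qed

lemma evi_eqI: "x = x' \<Longrightarrow> y = y' \<Longrightarrow> z = z' \<Longrightarrow> evi x y z = evi x' y' z'"
  by simp

lemma evi_scale: "of_int n * evi x y z = evi (n * x) (n * y) (n * z)"
  unfolding evi_def ev_def by (simp add: algebra_simps)

lemma rep_three_units:
  assumes "n1 \<ge> 0" "n2 \<ge> 0" "n3 \<ge> 0" "e1 \<in> OK" "e2 \<in> OK" "e3 \<in> OK"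
  shows "rep (replicate 12 1) (of_int n1 * e1\<^sup>2 + of_int n2 * e2\<^sup>2 + of_int n3 * e3\<^sup>2)"
proof -
  have "replicate 12 (1::real) = replicate 4 1 @ replicate 4 1 @ replicate 4 1"
    unfolding replicate_add[symmetric] by simp
  then show ?thesis
    using rep_append[OF rep_four[OF assms(1,4), of 1] rep_append[OF rep_four[OF assms(2,5), of 1] rep_four[OF assms(3,6), of 1]]]
    by (simp add: add.assoc)
qed

end

section \<open>Diagonal universal forms\<close>

context simplest_cubic_integers
begin

lemma D_div: "D * (k div D) \<le> k" "D * p \<le> k \<Longrightarrow> p \<le> k div D"
proof -
  show "D * (k div D) \<le> k" using D_pos by (simp add: minus_mod_eq_mult_div[symmetric])
  show "p \<le> k div D" if "D * p \<le> k" using zdiv_mono1[OF that D_pos] D_pos by simp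
qed

text \<open>The lattice points of smallest height in the half-open parallelepiped spanned by \<open>1\<close>,
  \<open>\<rho>\<^sup>2\<close> and \<open>(\<rho> / (1 + \<rho>))\<^sup>2\<close>.\<close>

definition parallelepiped_point :: "int \<Rightarrow> real" where
  "parallelepiped_point Y = evi (- ((a + 1) * Y div D)) (- Y) (- (- (a + 2) * Y div D))"

lemma parallelepiped_point_TP:
  assumes "0 < Y"
  shows "TP (parallelepiped_point Y)"
  unfolding parallelepiped_point_def
proof (rule TP_cone)
  show "- Y < 0" using assms by simp
  have "D * ((a + 1) * Y div D) \<le> (a + 1) * Y" by (rule D_div(1))
  then show "(a + 1) * - Y \<le> D * - ((a + 1) * Y div D)" by simp
  have "D * (- (a + 2) * Y div D) \<le> - (a + 2) * Y" by (rule D_div(1))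
  then show "- (a + 2) * - Y \<le> D * - (- (a + 2) * Y div D)" by simp
qed

text \<open>Division of \<open>- y\<close> by \<open>D\<close> gives the multiplicity of
  \<open>e\<^sub>4\<close> and the index \<open>Y\<close> of the parallelepiped point; the excess in
  the other two coordinates goes to \<open>e\<^sub>1\<close> and \<open>e\<^sub>2\<close>.\<close>

lemma cone2_decomposition:
  assumes "y \<le> 0" "(a + 1) * y \<le> D * x" "- (a + 2) * y \<le> D * z"
  obtains n1 n2 n4 Y where "n1 \<ge> 0" "n2 \<ge> 0" "n4 \<ge> 0" "0 \<le> Y" "Y < D"
    "evi x y z = of_int n1 * 1\<^sup>2 + of_int n2 * (evi 0 1 0)\<^sup>2 + of_int n4 * (evi (- 1) (- (a + 1)) 1)\<^sup>2
      + (if Y = 0 then 0 else parallelepiped_point Y)"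
proof -
  define q Y where "q = (- y) div D" and "Y = (- y) mod D"
  have y: "y = - (D * q + Y)" unfolding q_def Y_def by simp
  have Y: "0 \<le> Y" "Y < D" unfolding Y_def using D_pos by auto
  have q: "q \<ge> 0" unfolding q_def using assms(1) D_pos by (simp add: pos_imp_zdiv_nonneg_iff)
  define s t where "s = (a + 1) * Y div D" and "t = - (a + 2) * Y div D"
  \<comment> \<open>Nonnegative because \<open>- s\<close> and \<open>- t\<close>, being rounded up,
    are the least coordinates allowed in the cone for this \<open>Y\<close>.\<close>
  define n1 n2 where "n1 = x + (a + 1) * q + s" and "n2 = z - (a + 2) * q + t"
  have "D * - (x + (a + 1) * q) \<le> (a + 1) * Y" using assms(2) unfolding y by (simp add: algebra_simps)
  then have "- (x + (a + 1) * q) \<le> s" unfolding s_def by (rule D_div(2))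
  then have n1: "n1 \<ge> 0" unfolding n1_def by simp
  have "D * - (z - (a + 2) * q) \<le> - (a + 2) * Y" using assms(3) unfolding y by (simp add: algebra_simps)
  then have "- (z - (a + 2) * q) \<le> t" unfolding t_def by (rule D_div(2))
  then have n2: "n2 \<ge> 0" unfolding n2_def by simp
  have pt: "(if Y = 0 then 0 else parallelepiped_point Y) = evi (- s) (- Y) (- t)"
    unfolding parallelepiped_point_def s_def t_def using evi_int[of 0] by auto
  have "evi x y z = of_int n1 * 1\<^sup>2 + of_int n2 * (evi 0 1 0)\<^sup>2 + of_int q * (evi (- 1) (- (a + 1)) 1)\<^sup>2
      + (if Y = 0 then 0 else parallelepiped_point Y)"
    unfolding pt units_squared one_power2 mult_1_right evi_int[of n1] evi_scale evi_add
    by (rule evi_eqI; simp add: n1_def n2_def y algebra_simps)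
  then show ?thesis using that n1 n2 q Y by blast
qed

lemma cone1_sum:
  "of_int n1 * 1\<^sup>2 + of_int n2 * (evi 0 1 0)\<^sup>2 + of_int n3 * (evi 1 1 0)\<^sup>2 + of_int e * evi 1 1 1
    = evi (n1 + n3 + e) (2 * n3 + e) (n2 + n3 + e)"
  unfolding units_squared one_power2 mult_1_right evi_int[of n1] evi_scale evi_add
  by (rule evi_eqI) simp_all

lemma reduce_to_domain:
  assumes "\<And>x y z. 0 \<le> y \<Longrightarrow> y \<le> 2 * x \<Longrightarrow> y \<le> 2 * z \<Longrightarrow> rep cs (evi x y z)"
    and "\<And>x y z. y \<le> 0 \<Longrightarrow> (a + 1) * y \<le> D * x \<Longrightarrow> - (a + 2) * y \<le> D * z \<Longrightarrow> rep cs (evi x y z)"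
    and "\<alpha> \<in> OK" "TP \<alpha>"
  shows "rep cs \<alpha>"
proof -
  obtain u w x y z where u: "u \<in> OK" "w \<in> OK" "u * w = 1" "\<alpha> * u\<^sup>2 = evi x y z"
    and "(0 \<le> y \<and> y \<le> 2 * x \<and> y \<le> 2 * z) \<or> (y \<le> 0 \<and> (a + 1) * y \<le> D * x \<and> - (a + 2) * y \<le> D * z)"
    using fundamental_domain[OF assms(3,4)] by metis
  then have "rep cs (evi x y z)" using assms(1,2) by blast
  then have "rep cs (\<alpha> * u\<^sup>2 * w\<^sup>2)" unfolding u(4)[symmetric] by (rule rep_scale) fact
  moreover have "\<alpha> * u\<^sup>2 * w\<^sup>2 = \<alpha> * (u * w)\<^sup>2" by (simp add: power_mult_distrib)
  ultimately show ?thesis unfolding u(3) by simp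
qed

lemma diagonal_universal_nonneg:
  assumes "a \<ge> 0"
  shows "\<exists>A. universal_form K (nat (3 * (a\<^sup>2 + 3 * a + 6))) A \<and> diagonal_form (nat (3 * (a\<^sup>2 + 3 * a + 6))) A"
proof -
  \<comment> \<open>The first three blocks have
    \<open>12 + 1 + (D - 1) = a\<^sup>2 + 3 a + 15\<close> entries; the ones at the end fill up to
    the required rank.\<close>
  define cs where "cs = replicate 12 1 @ [evi 1 1 1] @ map parallelepiped_point [1..D - 1] @ replicate (nat (2 * a\<^sup>2 + 6 * a + 3)) 1"
  have len: "length cs = nat (3 * (a\<^sup>2 + 3 * a + 6))"
  proof -
    have "0 \<le> D - 1" "0 \<le> 2 * a\<^sup>2 + 6 * a + 3" using assms by simp_all
    then have "int (length cs) = 3 * (a\<^sup>2 + 3 * a + 6)" unfolding cs_def by simp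
    then show ?thesis by (metis nat_int)
  qed
  have pt: "rep cs \<alpha>" if "rep (replicate 12 1) \<beta>" "rep [evi 1 1 1] \<gamma>" "rep (map parallelepiped_point [1..D - 1]) \<delta>"
    "\<alpha> = \<beta> + \<gamma> + \<delta>" for \<alpha> \<beta> \<gamma> \<delta>
    using rep_append[OF that(1) rep_append[OF that(2) rep_append[OF that(3) rep_zero]]] that(4)
    unfolding cs_def by (simp add: add.assoc)
  have "rep cs \<alpha>" if "\<alpha> \<in> OK" "TP \<alpha>" for \<alpha>
    using _ _ that
  proof (rule reduce_to_domain)
    fix x y z :: int assume *: "0 \<le> y" "y \<le> 2 * x" "y \<le> 2 * z"
    obtain n1 n2 n3 e :: int where n: "n1 \<ge> 0" "n2 \<ge> 0" "n3 \<ge> 0" "e = 0 \<or> e = 1"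
      and xyz: "x = n1 + n3 + e" "y = 2 * n3 + e" "z = n2 + n3 + e"
      using cone1_decomposition[OF *] .
    have "rep [evi 1 1 1] (of_int e * evi 1 1 1)"
      using n(4) rep_zero rep_single[OF OK_int(3), of "evi 1 1 1"] by auto
    from pt[OF rep_three_units[OF n(1-3) OK_int(3) evi_OK evi_OK] this rep_zero refl]
    show "rep cs (evi x y z)" unfolding xyz cone1_sum[symmetric] by simp
  next
    fix x y z :: int assume *: "y \<le> 0" "(a + 1) * y \<le> D * x" "- (a + 2) * y \<le> D * z"
    obtain n1 n2 n4 Y where n: "n1 \<ge> 0" "n2 \<ge> 0" "n4 \<ge> 0" "0 \<le> Y" "Y < D"
      and eq: "evi x y z = of_int n1 * 1\<^sup>2 + of_int n2 * (evi 0 1 0)\<^sup>2 + of_int n4 * (evi (- 1) (- (a + 1)) 1)\<^sup>2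
      + (if Y = 0 then 0 else parallelepiped_point Y)"
      using cone2_decomposition[OF *] .
    have "rep (map parallelepiped_point [1..D - 1]) (if Y = 0 then 0 else parallelepiped_point Y)"
      using n(4,5) by (auto intro: rep_zero rep_member)
    from pt[OF rep_three_units[OF n(1-3) OK_int(3) evi_OK evi_OK] rep_zero this refl]
    show "rep cs (evi x y z)" unfolding eq by simp
  qed
  moreover have "c \<in> OK \<and> TP c" if "c \<in> set cs" for c
    using that TP_1 OK_int(3) TP_f evi_OK parallelepiped_point_TP unfolding cs_def
    by (auto simp: parallelepiped_point_def)
  ultimately show ?thesis using universal_diagonal[of cs] unfolding len by blast
qed

text \<open>The general construction would take \<open>13\<close> variables here, one more than the
  rank \<open>12\<close>, so the single variable for \<open>f\<close> and the triples of generators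
  are traded against each other.\<close>

lemma diagonal_universal_minus_one:
  assumes a: "a = -1"
  shows "\<exists>A. universal_form K 12 A \<and> diagonal_form 12 A"
proof -
  define f where "f = evi 1 1 1"
  define cs where "cs = replicate 4 f @ replicate 4 1 @ replicate 4 1"
  note OKs = OK_int(3) evi_OK
  have cs: "rep cs (of_int n * (f * u\<^sup>2) + of_int m * v\<^sup>2 + of_int k * w\<^sup>2)"
    if "n \<ge> 0" "m \<ge> 0" "k \<ge> 0" "u \<in> OK" "v \<in> OK" "w \<in> OK" for n m k :: int and u v w
    using rep_append[OF rep_four[OF that(1,4), of f] rep_append[OF rep_four[OF that(2,5), of 1] rep_four[OF that(3,6), of 1]]]
    unfolding cs_def by (simp add: add.assoc)
  define u4 g where "u4 = evi (- 1) 0 1" and "g = evi (- 2) (- 1) 1"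
  have OK': "u4 \<in> OK" "g \<in> OK" unfolding u4_def g_def by (rule evi_OK)+
  have sq: "u4\<^sup>2 = evi 0 (- 1) 1" "g\<^sup>2 = evi 1 (- 1) 2" "f * u4\<^sup>2 = evi (- 1) (- 2) 3"
      "f * (evi 2 0 (- 1))\<^sup>2 = evi 2 (- 1) 0" "f * 1\<^sup>2 = evi 1 1 1"
      "(evi 0 1 0)\<^sup>2 = evi 0 0 1" "(evi 1 1 0)\<^sup>2 = evi 1 2 1" "1\<^sup>2 = evi 1 0 0"
    unfolding u4_def g_def f_def power2_eq_square evi_mult by (simp_all add: a evi_int[of 1, symmetric, simplified])
  have "rep cs \<alpha>" if "\<alpha> \<in> OK" "TP \<alpha>" for \<alpha>
    using _ _ that
  proof (rule reduce_to_domain)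
    fix x y z :: int assume *: "0 \<le> y" "y \<le> 2 * x" "y \<le> 2 * z"
    obtain n1 n2 n3 e :: int where n: "n1 \<ge> 0" "n2 \<ge> 0" "n3 \<ge> 0" "e = 0 \<or> e = 1"
      and xyz: "x = n1 + n3 + e" "y = 2 * n3 + e" "z = n2 + n3 + e"
      using cone1_decomposition[OF *] .
    \<comment> \<open>By \<open>e\<^sub>1 + e\<^sub>2 + e\<^sub>3 = 2 f\<close> the smallest
      coefficient is absorbed into that of \<open>f\<close>, which leaves two generators.\<close>
    consider "n1 \<le> n2" "n1 \<le> n3" | "n2 \<le> n1" "n2 \<le> n3" | "n3 \<le> n1" "n3 \<le> n2" by linarith
    then show "rep cs (evi x y z)"
    proof cases
      case 1
      have "rep cs (of_int (2 * n1 + e) * (f * 1\<^sup>2) + of_int (n2 - n1) * (evi 0 1 0)\<^sup>2 + of_int (n3 - n1) * (evi 1 1 0)\<^sup>2)"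
        using 1 n by (intro cs OKs) auto
      then show ?thesis unfolding sq(3-5) unfolding sq evi_scale evi_add xyz by (simp add: algebra_simps)
    next
      case 2
      have "rep cs (of_int (2 * n2 + e) * (f * 1\<^sup>2) + of_int (n1 - n2) * 1\<^sup>2 + of_int (n3 - n2) * (evi 1 1 0)\<^sup>2)"
        using 2 n by (intro cs OKs) auto
      then show ?thesis unfolding sq(3-5) unfolding sq evi_scale evi_add xyz by (simp add: algebra_simps)
    next
      case 3
      have "rep cs (of_int (2 * n3 + e) * (f * 1\<^sup>2) + of_int (n1 - n3) * 1\<^sup>2 + of_int (n2 - n3) * (evi 0 1 0)\<^sup>2)"
        using 3 n by (intro cs OKs) auto
      then show ?thesis unfolding sq(3-5) unfolding sq evi_scale evi_add xyz by (simp add: algebra_simps)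
    qed
  next
    fix x y z :: int assume *: "y \<le> 0" "(a + 1) * y \<le> D * x" "- (a + 2) * y \<le> D * z"
    \<comment> \<open>With \<open>e\<^sub>4 = u4\<^sup>2\<close> we have \<open>g\<^sup>2 = e\<^sub>1 + e\<^sub>2 + e\<^sub>4\<close>, so one of the generators can be traded for \<open>g\<^sup>2\<close>; the
      relation \<open>f + 2 e\<^sub>4 = g\<^sup>2 + e\<^sub>2\<close> and its two conjugates up to units then remove one more.\<close>
    define n1 n2 n4 where "n1 = x" and "n2 = z + y" and "n4 = - y"
    have n: "n1 \<ge> 0" "n2 \<ge> 0" "n4 \<ge> 0" and xyz: "x = n1" "y = - n4" "z = n2 + n4"
      using * unfolding a n1_def n2_def n4_def by auto
    \<comment> \<open>The smallest of \<open>n1\<close>, \<open>n2\<close>, \<open>n4\<close>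
      becomes the coefficient of \<open>g\<^sup>2\<close>; the second comparison decides whether the
      relation with \<open>f\<close> uses up \<open>g\<^sup>2\<close> or the generator next to
      it.\<close>
    consider "n1 \<le> n2" "n1 \<le> n4" "n2 \<le> 2 * n1" | "n1 \<le> n2" "n1 \<le> n4" "2 * n1 \<le> n2"
      | "n2 \<le> n1" "n2 \<le> n4" "n4 \<le> 2 * n2" | "n2 \<le> n1" "n2 \<le> n4" "2 * n2 \<le> n4"
      | "n4 \<le> n1" "n4 \<le> n2" "n1 \<le> 2 * n4" | "n4 \<le> n1" "n4 \<le> n2" "2 * n4 \<le> n1" by linarith
    then show "rep cs (evi x y z)"
    proof cases
      case 1
      have "rep cs (of_int (n2 - n1) * (f * 1\<^sup>2) + of_int (2 * n1 - n2) * g\<^sup>2 + of_int (n4 + 2 * n2 - 3 * n1) * u4\<^sup>2)"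
        using 1 n by (intro cs OKs OK') auto
      then show ?thesis unfolding sq(3-5) unfolding sq evi_scale evi_add xyz by (simp add: algebra_simps)
    next
      case 2
      have "rep cs (of_int n1 * (f * 1\<^sup>2) + of_int (n2 - 2 * n1) * (evi 0 1 0)\<^sup>2 + of_int (n4 + n1) * u4\<^sup>2)"
        using 2 n by (intro cs OKs OK') auto
      then show ?thesis unfolding sq(3-5) unfolding sq evi_scale evi_add xyz by (simp add: algebra_simps)
    next
      case 3
      have "rep cs (of_int (n4 - n2) * (f * u4\<^sup>2) + of_int (2 * n2 - n4) * g\<^sup>2 + of_int (n1 + 2 * n4 - 3 * n2) * 1\<^sup>2)"
        using 3 n by (intro cs OKs OK') auto
      then show ?thesis unfolding sq(3-5) unfolding sq evi_scale evi_add xyz by (simp add: algebra_simps)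
    next
      case 4
      have "rep cs (of_int n2 * (f * u4\<^sup>2) + of_int (n4 - 2 * n2) * u4\<^sup>2 + of_int (n1 + n2) * 1\<^sup>2)"
        using 4 n by (intro cs OKs OK') auto
      then show ?thesis unfolding sq(3-5) unfolding sq evi_scale evi_add xyz by (simp add: algebra_simps)
    next
      case 5
      have "rep cs (of_int (n1 - n4) * (f * (evi 2 0 (- 1))\<^sup>2) + of_int (2 * n4 - n1) * g\<^sup>2 + of_int (n2 + 2 * n1 - 3 * n4) * (evi 0 1 0)\<^sup>2)"
        using 5 n by (intro cs OKs OK') auto
      then show ?thesis unfolding sq(3-5) unfolding sq evi_scale evi_add xyz by (simp add: algebra_simps)
    next
      case 6
      have "rep cs (of_int n4 * (f * (evi 2 0 (- 1))\<^sup>2) + of_int (n1 - 2 * n4) * 1\<^sup>2 + of_int (n2 + n4) * (evi 0 1 0)\<^sup>2)"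
        using 6 n by (intro cs OKs OK') auto
      then show ?thesis unfolding sq(3-5) unfolding sq evi_scale evi_add xyz by (simp add: algebra_simps)
    qed
  qed
  moreover have "c \<in> OK \<and> TP c" if "c \<in> set cs" for c
    using that TP_1 OK_int(3) TP_f evi_OK unfolding cs_def f_def by auto
  moreover have "length cs = 12" unfolding cs_def by simp
  ultimately show ?thesis using universal_diagonal[of cs] by metis
qed

end

section \<open>Lower bounds for the rank\<close>

text \<open>Completing the square in the last variable, by induction on \<open>n\<close>.\<close>

lemma psd_gram:
  fixes S :: "nat \<Rightarrow> nat \<Rightarrow> real"
  assumes "\<And>i j. S i j = S j i" and "\<And>x. (\<Sum>i<n. \<Sum>j<n. S i j * x i * x j) \<ge> 0"
  shows "\<exists>L. \<forall>x. (\<Sum>i<n. \<Sum>j<n. S i j * x i * x j) = (\<Sum>l<n. (\<Sum>i<n. L l i * x i)\<^sup>2)"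
  using assms
proof (induction n arbitrary: S)
  case 0
  then show ?case by simp
next
  case (Suc n)
  define d where "d = S n n"
  define b where "b x = (\<Sum>i<n. S n i * x i)" for x
  define q where "q x = (\<Sum>i<n. \<Sum>j<n. S i j * x i * x j)" for x
  have expand: "(\<Sum>i<Suc n. \<Sum>j<Suc n. S i j * x i * x j) = q x + 2 * x n * b x + d * (x n)\<^sup>2" for x
  proof -
    have "S i n * x i * x n = x n * (S n i * x i)" for i
      by (subst Suc.prems(1)[of i n]) (simp add: mult_ac)
    then have "(\<Sum>i<n. S i n * x i * x n) = x n * b x" 
      unfolding b_def sum_distrib_left by (simp only:)
    moreover have "(\<Sum>j<n. S n j * x n * x j) = x n * b x"
      unfolding b_def sum_distrib_left by (simp add: mult_ac)
    ultimately show ?thesis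
      by (simp add: q_def d_def sum.distrib power2_eq_square)
  qed
  have nonneg: "q x + 2 * t * b x + d * t\<^sup>2 \<ge> 0" for x t
  proof -
    have "q (x(n := t)) = q x" "b (x(n := t)) = b x" unfolding q_def b_def by auto
    then show ?thesis using Suc.prems(2)[of "x(n := t)"] unfolding expand by (simp only: fun_upd_same)
  qed
  have d0: "d \<ge> 0" using nonneg[of "\<lambda>_. 0" 1] by (simp add: q_def b_def)
  show ?case
  proof (cases "d = 0")
    case True
    have b0: "b x = 0" for x
    proof (rule ccontr)
      assume "b x \<noteq> 0"
      \<comment> \<open>If \<open>d = 0\<close>, the form is affine in the last variable; this value
        of it would make the form equal to \<open>-1\<close>.\<close>
      then have "q x + 2 * (- (q x + 1) / (2 * b x)) * b x = - 1" by (simp add: field_simps)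
      then show False using nonneg[of x "- (q x + 1) / (2 * b x)"] True by simp
    qed
    have "q x \<ge> 0" for x using nonneg[of x 0] by simp
    then obtain L where L: "\<And>x. q x = (\<Sum>l<n. (\<Sum>i<n. L l i * x i)\<^sup>2)"
      using Suc.IH[of S, OF Suc.prems(1)] unfolding q_def by blast
    define L' where "L' l i = (if l < n \<and> i < n then L l i else 0)" for l i
    have "(\<Sum>l<Suc n. (\<Sum>i<Suc n. L' l i * x i)\<^sup>2) = q x" for x
      unfolding L L'_def by simp
    then show ?thesis unfolding expand using b0 True by (intro exI[of _ L']) simp
  next
    case False
    then have d: "d > 0" using d0 by simp
    \<comment> \<open>The Schur complement: what remains after splitting off the square that
      contains the last variable.\<close>
    define S' where "S' i j = S i j - S n i * S n j / d" for i j
    have q': "(\<Sum>i<n. \<Sum>j<n. S' i j * x i * x j) = q x - (b x)\<^sup>2 / d" for x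
      unfolding S'_def q_def b_def power2_eq_square sum_product
      by (simp add: algebra_simps sum_subtractf sum_divide_distrib)
    have "(\<Sum>i<n. \<Sum>j<n. S' i j * x i * x j) \<ge> 0" for x
    proof -
      have "q x + 2 * (- b x / d) * b x + d * (- b x / d)\<^sup>2 = q x - (b x)\<^sup>2 / d"
        using d by (simp add: power2_eq_square)
      then show ?thesis unfolding q' using nonneg[of x "- b x / d"] by simp
    qed
    moreover have "S' i j = S' j i" for i j unfolding S'_def using Suc.prems(1)[of i j] by simp
    ultimately obtain L where L: "\<And>x. (\<Sum>i<n. \<Sum>j<n. S' i j * x i * x j) = (\<Sum>l<n. (\<Sum>i<n. L l i * x i)\<^sup>2)"
      using Suc.IH[of S'] by blast
    define L' where "L' l i = (if l < n then (if i < n then L l i else 0) else S n i / sqrt d)" for l i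
    have "(\<Sum>l<Suc n. (\<Sum>i<Suc n. L' l i * x i)\<^sup>2) = q x + 2 * x n * b x + d * (x n)\<^sup>2" for x
    proof -
      have "(\<Sum>i<Suc n. S n i / sqrt d * x i) = (b x + d * x n) / sqrt d"
        unfolding b_def d_def by (simp add: sum_divide_distrib add_divide_distrib)
      then have "(\<Sum>l<Suc n. (\<Sum>i<Suc n. L' l i * x i)\<^sup>2)
          = (\<Sum>l<n. (\<Sum>i<n. L l i * x i)\<^sup>2) + ((b x + d * x n) / sqrt d)\<^sup>2"
        unfolding L'_def by simp
      also have "((b x + d * x n) / sqrt d)\<^sup>2 = (b x + d * x n)\<^sup>2 / d" using d by (simp add: power_divide)
      also have "(\<Sum>l<n. (\<Sum>i<n. L l i * x i)\<^sup>2) = q x - (b x)\<^sup>2 / d" using L q' by simp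
      also have "q x - (b x)\<^sup>2 / d + (b x + d * x n)\<^sup>2 / d = q x + 2 * x n * b x + d * (x n)\<^sup>2"
        using d by (simp add: field_simps power2_eq_square)
      finally show ?thesis .
    qed
    then show ?thesis unfolding expand by (intro exI[of _ L']) simp
  qed
qed

text \<open>By homogeneity the form is nonnegative at rational points with a common denominator, and
  these approximate every \<open>x\<close>.\<close>

lemma nonneg_if_nonneg_on_integers:
  fixes S :: "nat \<Rightarrow> nat \<Rightarrow> real"
  assumes "\<And>m. (\<Sum>i<n. \<Sum>j<n. S i j * of_int (m i) * of_int (m j)) \<ge> 0"
  shows "(\<Sum>i<n. \<Sum>j<n. S i j * x i * x j) \<ge> 0"
proof -
  define y where "y k i = real_of_int \<lfloor>real (Suc k) * x i\<rfloor> / real (Suc k)" for k i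
  have lim: "(\<lambda>k. y k i) \<longlonglongrightarrow> x i" for i
  proof (rule tendsto_sandwich)
    have "real_of_int \<lfloor>real (Suc k) * x i\<rfloor> \<ge> real (Suc k) * x i - 1" for k by linarith
    then have "y k i \<ge> (real (Suc k) * x i - 1) / real (Suc k)" for k
      unfolding y_def by (intro divide_right_mono) auto
    moreover have "(real (Suc k) * x i - 1) / real (Suc k) = x i - inverse (real (Suc k))" for k
      by (simp add: field_simps)
    ultimately show "\<forall>\<^sub>F k in sequentially. x i - inverse (real (Suc k)) \<le> y k i" by simp
    have "y k i \<le> (real (Suc k) * x i) / real (Suc k)" for k
      unfolding y_def by (intro divide_right_mono) auto
    then show "\<forall>\<^sub>F k in sequentially. y k i \<le> x i" by simp
    show "(\<lambda>k. x i - inverse (real (Suc k))) \<longlonglongrightarrow> x i"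
      using tendsto_diff[OF tendsto_const LIMSEQ_inverse_real_of_nat, of "x i"] by simp
  qed simp
  have "(\<lambda>k. \<Sum>i<n. \<Sum>j<n. S i j * y k i * y k j) \<longlonglongrightarrow> (\<Sum>i<n. \<Sum>j<n. S i j * x i * x j)"
    by (intro tendsto_sum tendsto_mult tendsto_const lim)
  moreover have "(\<Sum>i<n. \<Sum>j<n. S i j * y k i * y k j) \<ge> 0" for k
  proof -
    have "(\<Sum>i<n. \<Sum>j<n. S i j * y k i * y k j)
        = (\<Sum>i<n. \<Sum>j<n. S i j * of_int \<lfloor>real (Suc k) * x i\<rfloor> * of_int \<lfloor>real (Suc k) * x j\<rfloor>) / (real (Suc k))\<^sup>2"
      unfolding y_def by (simp add: sum_divide_distrib power2_eq_square)
    then show ?thesis using assms[of "\<lambda>i. \<lfloor>real (Suc k) * x i\<rfloor>"] by simp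
  qed
  ultimately show ?thesis by (intro LIMSEQ_le_const) auto
qed

text \<open>Passes from coefficients \<open>i \<le> j\<close> to a symmetric matrix by halving the
  off-diagonal entries.\<close>

lemma upper_triangular_sum:
  fixes g :: "nat \<Rightarrow> nat \<Rightarrow> real"
  shows "(\<Sum>i<n. \<Sum>j\<in>{i..<n}. g i j) = (\<Sum>i<n. \<Sum>j<n. if i = j then g i i else if i < j then g i j / 2 else g j i / 2)"
proof -
  define h where "h i j = (if i \<le> j then g i j else 0)" for i j
  have 1: "(\<Sum>j\<in>{i..<n}. g i j) = (\<Sum>j<n. h i j)" if "i < n" for i
    unfolding h_def using that by (intro sum.mono_neutral_cong_left) auto
  have "(\<Sum>i<n. \<Sum>j<n. if i = j then g i i else if i < j then g i j / 2 else g j i / 2)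
      = (\<Sum>i<n. \<Sum>j<n. (h i j + h j i) / 2)"
    unfolding h_def by (intro sum.cong) auto
  also have "\<dots> = ((\<Sum>i<n. \<Sum>j<n. h i j) + (\<Sum>i<n. \<Sum>j<n. h j i)) / 2"
    by (simp add: sum.distrib sum_divide_distrib[symmetric])
  also have "(\<Sum>i<n. \<Sum>j<n. h j i) = (\<Sum>i<n. \<Sum>j<n. h i j)" by (rule sum.swap)
  finally show ?thesis using 1 by simp
qed

context simplest_cubic_integers
begin

section \<open>From forms over the integers to Euclidean lattices\<close>

lemma cj_sum: "k < 3 \<Longrightarrow> (\<And>i. i \<in> J \<Longrightarrow> f i \<in> OK) \<Longrightarrow> cj k (sum f J) = (\<Sum>i\<in>J. cj k (f i))"
proof (induction J rule: infinite_finite_induct)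
  case (insert j J)
  then have "f j \<in> F" "sum f J \<in> F" using OK_K K_F OK_sum by blast+
  then show ?case using insert by (simp add: cj_hom)
qed (simp_all add: cj_rat)

lemma cj_mult_OK: "k < 3 \<Longrightarrow> \<alpha> \<in> OK \<Longrightarrow> \<beta> \<in> OK \<Longrightarrow> cj k (\<alpha> * \<beta>) = cj k \<alpha> * cj k \<beta>"
  using cj_hom(3) OK_K K_F by blast

lemma height_cj: "\<alpha> \<in> OK \<Longrightarrow> height \<alpha> = (\<Sum>k<3. height_weight k * cj k \<alpha>)"
proof -
  assume "\<alpha> \<in> OK"
  then obtain x y z where \<alpha>: "\<alpha> = evi x y z" using OK_iff by blast
  have "cj k \<alpha> = ev (rt k) (of_int x) (of_int y) (of_int z)" for k
    unfolding \<alpha> evi_def by (rule cj_ev) auto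
  then show ?thesis using height_weight(2) height_evi[of x y z] unfolding \<alpha> by simp
qed

lemma height_int: "\<alpha> \<in> OK \<Longrightarrow> height \<alpha> \<in> \<int>"
  using OK_iff height_evi by (metis Ints_of_int)

lemma height_TP: "\<alpha> \<in> OK \<Longrightarrow> TP \<alpha> \<Longrightarrow> height \<alpha> > 0"
  using OK_iff height_evi functionals_pos(2) by (metis of_int_0_less_iff)

lemma height_linear: "\<alpha> \<in> OK \<Longrightarrow> \<beta> \<in> OK \<Longrightarrow> height (\<alpha> + \<beta>) = height \<alpha> + height \<beta>"
    "\<alpha> \<in> OK \<Longrightarrow> \<beta> \<in> OK \<Longrightarrow> height (\<alpha> - \<beta>) = height \<alpha> - height \<beta>"
  unfolding OK_iff using evi_add evi_diff height_evi by (auto simp: evi_add evi_diff height_evi)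

lemma integral_vector_OK: "integral_vector K r v \<longleftrightarrow> (\<forall>i<r. v i \<in> OK)"
  unfolding integral_vector_def OK_def ..

lemma form_value_OK:
  assumes "is_quadratic_form K r Q" "integral_vector K r v"
  shows "form_value r Q v \<in> OK"
  using assms unfolding form_value_def is_quadratic_form_def integral_vector_OK OK_def[symmetric]
  by (intro OK_sum OK_ring) auto

text \<open>The conjugate of \<open>Q\<close> under \<open>cj k\<close> is a real form with
  symmetric matrix \<open>S\<close>; total positivity makes it semidefinite, so it is a sum of
  \<open>r\<close> squares of linear forms.\<close>

lemma form_sum_of_squares:
  assumes Q: "is_quadratic_form K r Q" "totally_positive_form K r Q" and k: "k < 3"
  shows "\<exists>L. \<forall>v. integral_vector K r v \<longrightarrow> cj k (form_value r Q v) = (\<Sum>l<r. (\<Sum>i<r. L l i * cj k (v i))\<^sup>2)"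
proof -
  define S where "S i j = (if i = j then cj k (Q i i) else if i < j then cj k (Q i j) / 2 else cj k (Q j i) / 2)" for i j
  have Q_OK: "Q i j \<in> OK" if "i \<le> j" "j < r" for i j
    using Q(1) that unfolding is_quadratic_form_def OK_def by blast
  have S: "cj k (form_value r Q v) = (\<Sum>i<r. \<Sum>j<r. S i j * cj k (v i) * cj k (v j))"
    if v: "integral_vector K r v" for v
  proof -
    have vO: "v i \<in> OK" if "i < r" for i using v that unfolding integral_vector_OK by blast
    have "cj k (form_value r Q v) = (\<Sum>i<r. cj k (\<Sum>j\<in>{i..<r}. Q i j * v i * v j))"
      unfolding form_value_def using k vO Q_OK by (intro cj_sum OK_sum OK_ring) auto
    also have "\<dots> = (\<Sum>i<r. \<Sum>j\<in>{i..<r}. cj k (Q i j * v i * v j))"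
      using k vO Q_OK by (intro sum.cong cj_sum OK_ring) auto
    also have "\<dots> = (\<Sum>i<r. \<Sum>j\<in>{i..<r}. cj k (Q i j) * cj k (v i) * cj k (v j))"
      using k vO Q_OK OK_ring(3) by (intro sum.cong refl) (simp add: cj_mult_OK)
    also have "\<dots> = (\<Sum>i<r. \<Sum>j<r. S i j * cj k (v i) * cj k (v j))"
      unfolding upper_triangular_sum S_def by (intro sum.cong refl) simp
    finally show ?thesis .
  qed
  \<comment> \<open>Testing on rational integers suffices, and \<open>cj k\<close> fixes
    them.\<close>
  have "(\<Sum>i<r. \<Sum>j<r. S i j * of_int (m i) * of_int (m j)) \<ge> 0" for m
  proof -
    define v where "v i = real_of_int (m i)" for i
    have v: "integral_vector K r v" unfolding integral_vector_OK v_def using OK_int(1) by blast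
    have c: "cj k (v i) = of_int (m i)" for i unfolding v_def by (rule cj_rat) simp
    have "cj k (form_value r Q v) \<ge> 0"
    proof (cases "\<exists>i<r. v i \<noteq> 0")
      case True
      then have "TP (form_value r Q v)" using Q(2) v unfolding totally_positive_form_def by blast
      then show ?thesis using real_embedding_cj[OF k] unfolding totally_positive_def by (meson less_imp_le)
    next
      case False
      then have "form_value r Q v = 0" unfolding form_value_def by simp
      then show ?thesis by (simp add: cj_rat)
    qed
    then show ?thesis unfolding S[OF v] c .
  qed
  then have "(\<Sum>i<r. \<Sum>j<r. S i j * x i * x j) \<ge> 0" for x
    by (rule nonneg_if_nonneg_on_integers)
  moreover have "S i j = S j i" for i j unfolding S_def by auto
  ultimately obtain L where L: "\<And>x. (\<Sum>i<r. \<Sum>j<r. S i j * x i * x j) = (\<Sum>l<r. (\<Sum>i<r. L l i * x i)\<^sup>2)"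
    using psd_gram[of S r] by blast
  have "cj k (form_value r Q v) = (\<Sum>l<r. (\<Sum>i<r. L l i * cj k (v i))\<^sup>2)"
    if "integral_vector K r v" for v
    unfolding S[OF that] by (rule L)
  then show ?thesis by blast
qed

text \<open>\<open>height\<close> is the trace against a totally positive element of the codifferent, so \<open>height \<circ> Q\<close>
  turns the integral vectors into a Euclidean lattice of rank \<open>3 * r\<close>.\<close>

lemma form_euclidean:
  assumes Q: "is_quadratic_form K r Q" "totally_positive_form K r Q"
  obtains X :: "(nat \<Rightarrow> real) \<Rightarrow> nat \<times> nat \<Rightarrow> real"
  where "\<And>v. integral_vector K r v \<Longrightarrow> dot ({..<3} \<times> {..<r}) (X v) (X v) = height (form_value r Q v)"
    and "\<And>v w. integral_vector K r v \<Longrightarrow> integral_vector K r w \<Longrightarrow>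
       2 * dot ({..<3} \<times> {..<r}) (X v) (X w)
         = height (form_value r Q (\<lambda>i. v i + w i)) - height (form_value r Q v) - height (form_value r Q w)"
    and "\<And>v w. integral_vector K r v \<Longrightarrow> integral_vector K r w \<Longrightarrow>
       - 2 * dot ({..<3} \<times> {..<r}) (X v) (X w)
         = height (form_value r Q (\<lambda>i. v i - w i)) - height (form_value r Q v) - height (form_value r Q w)"
proof -
  define I where "I = {..<3::nat} \<times> {..<r}"
  have "\<forall>k. \<exists>L. k < 3 \<longrightarrow> (\<forall>v. integral_vector K r v \<longrightarrow>
      cj k (form_value r Q v) = (\<Sum>l<r. (\<Sum>i<r. L l i * cj k (v i))\<^sup>2))"
    using form_sum_of_squares[OF Q] by blast
  from choice[OF this] obtain L where L: "\<And>k v. k < 3 \<Longrightarrow> integral_vector K r v \<Longrightarrow>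
      cj k (form_value r Q v) = (\<Sum>l<r. (\<Sum>i<r. L k l i * cj k (v i))\<^sup>2)"
    by blast
  \<comment> \<open>The three conjugate forms side by side, weighted so that the squared norm is the
    trace \<open>height\<close>.\<close>
  define X where "X v = (\<lambda>(k, l). sqrt (height_weight k) * (\<Sum>i<r. L k l i * cj k (v i)))" for v
  have norm: "dot I (X v) (X v) = height (form_value r Q v)" if v: "integral_vector K r v" for v
  proof -
    have "dot I (X v) (X v) = (\<Sum>k<3. \<Sum>l<r. height_weight k * (\<Sum>i<r. L k l i * cj k (v i))\<^sup>2)"
      unfolding dot_def I_def sum.cartesian_product
    proof (intro sum.cong refl)
      fix p assume p: "p \<in> {..<3::nat} \<times> {..<r}"
      obtain k l where kl: "p = (k, l)" by (cases p)
      have "height_weight k \<ge> 0" using p height_weight(1)[of k] unfolding kl by simp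
      then show "X v p * X v p = (case p of (k, l) \<Rightarrow> height_weight k * (\<Sum>i<r. L k l i * cj k (v i))\<^sup>2)"
        unfolding X_def kl prod.case power2_eq_square[symmetric] by (simp add: power_mult_distrib)
    qed
    also have "\<dots> = (\<Sum>k<3. height_weight k * cj k (form_value r Q v))"
      using L v by (simp add: sum_distrib_left)
    finally show ?thesis using height_cj form_value_OK[OF Q(1) v] by simp
  qed
  have cj_vec: "cj k (v i + w i) = cj k (v i) + cj k (w i)" "cj k (v i - w i) = cj k (v i) - cj k (w i)"
    if "integral_vector K r v" "integral_vector K r w" "i < r" "k < 3" for v w i k
  proof -
    have "v i \<in> F" "w i \<in> F" using that OK_K K_F unfolding integral_vector_OK by blast+
    then show "cj k (v i + w i) = cj k (v i) + cj k (w i)" "cj k (v i - w i) = cj k (v i) - cj k (w i)"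
      using that(4) by (simp_all add: cj_hom)
  qed
  have add: "X (\<lambda>i. v i + w i) p = X v p + X w p" and diff: "X (\<lambda>i. v i - w i) p = X v p - X w p"
    if vw: "integral_vector K r v" "integral_vector K r w" and p: "p \<in> I" for v w p
    using p unfolding X_def I_def
    by (auto simp: cj_vec[OF vw] algebra_simps sum.distrib sum_subtractf sum_distrib_left)
  have vec: "integral_vector K r (\<lambda>i. v i + w i)" "integral_vector K r (\<lambda>i. v i - w i)"
    if "integral_vector K r v" "integral_vector K r w" for v w
    using that OK_ring(1,2) unfolding integral_vector_OK by blast+
  show ?thesis
  proof (rule that[of X, folded I_def])
    fix v w assume vw: "integral_vector K r v" "integral_vector K r w"
    have "dot I (X (\<lambda>i. v i + w i)) (X (\<lambda>i. v i + w i)) = dot I (\<lambda>i. X v i + X w i) (\<lambda>i. X v i + X w i)"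
      unfolding dot_def using add[OF vw] by (intro sum.cong) auto
    then show "2 * dot I (X v) (X w)
        = height (form_value r Q (\<lambda>i. v i + w i)) - height (form_value r Q v) - height (form_value r Q w)"
      unfolding norm[OF vec(1)[OF vw]] by (simp add: dot_simps norm vw dot_commute[of I "X w" "X v"])
    have "dot I (X (\<lambda>i. v i - w i)) (X (\<lambda>i. v i - w i)) = dot I (\<lambda>i. X v i - X w i) (\<lambda>i. X v i - X w i)"
      unfolding dot_def using diff[OF vw] by (intro sum.cong) auto
    then show "- 2 * dot I (X v) (X w)
        = height (form_value r Q (\<lambda>i. v i - w i)) - height (form_value r Q v) - height (form_value r Q w)"
      unfolding norm[OF vec(2)[OF vw]] by (simp add: dot_simps norm vw dot_commute[of I "X w" "X v"])
  qed (rule norm)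
qed

text \<open>The diagonal terms of the polar form are even for any form, the mixed terms because
  \<open>Q\<close> is classical.\<close>

lemma form_polar_even:
  assumes Q: "is_quadratic_form K r Q" "classical_form K r Q"
    and vw: "integral_vector K r v" "integral_vector K r w"
  shows "\<exists>b\<in>OK. form_value r Q (\<lambda>i. v i + w i) - form_value r Q v - form_value r Q w = 2 * b"
proof -
  have O: "v i \<in> OK" "w i \<in> OK" if "i < r" for i using vw that unfolding integral_vector_OK by auto
  have Q_OK: "Q i j \<in> OK" if "i \<le> j" "j < r" for i j
    using Q(1) that unfolding is_quadratic_form_def OK_def by blast
  define t where "t i j = Q i j * (v i * w j + w i * v j)" for i j
  have "\<exists>b\<in>OK. t i j = 2 * b" if ij: "i \<le> j" "j < r" for i j
  proof (cases "i = j")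
    case True
    then show ?thesis unfolding t_def using ij Q_OK O
      by (intro bexI[of _ "Q i j * (v i * w i)"] OK_ring) auto
  next
    case False
    then obtain b where "b \<in> OK" "Q i j = 2 * b"
      using Q(2) ij unfolding classical_form_def OK_def by (metis le_neq_implies_less)
    then show ?thesis unfolding t_def using ij O
      by (intro bexI[of _ "b * (v i * w j + w i * v j)"] OK_ring) auto
  qed
  then obtain b where b: "\<And>i j. i \<le> j \<Longrightarrow> j < r \<Longrightarrow> b i j \<in> OK \<and> t i j = 2 * b i j" by metis
  have "form_value r Q (\<lambda>i. v i + w i) - form_value r Q v - form_value r Q w = (\<Sum>i<r. \<Sum>j\<in>{i..<r}. t i j)"
    unfolding form_value_def t_def sum_subtractf[symmetric] by (intro sum.cong refl) (simp add: algebra_simps)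
  also have "\<dots> = (\<Sum>i<r. \<Sum>j\<in>{i..<r}. 2 * b i j)" using b by (intro sum.cong refl) auto
  also have "\<dots> = 2 * (\<Sum>i<r. \<Sum>j\<in>{i..<r}. b i j)" by (simp add: sum_distrib_left)
  finally have "form_value r Q (\<lambda>i. v i + w i) - form_value r Q v - form_value r Q w = 2 * (\<Sum>i<r. \<Sum>j\<in>{i..<r}. b i j)" .
  moreover have "(\<Sum>i<r. \<Sum>j\<in>{i..<r}. b i j) \<in> OK" using b by (intro OK_sum) auto
  ultimately show ?thesis by blast
qed

section \<open>Rank bounds from integers of height one\<close>

context
  fixes r Q S
  assumes universal: "universal_form K r Q" and fin: "finite S"
    and S: "\<And>\<alpha>. \<alpha> \<in> S \<Longrightarrow> \<alpha> \<in> OK \<and> TP \<alpha> \<and> height \<alpha> = 1"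
begin

text \<open>For vectors \<open>v\<close>, \<open>w\<close> representing distinct elements, the
  heights of \<open>Q\<close> at \<open>v + w\<close> and \<open>v - w\<close> are positive and
  equal \<open>2\<close> plus or minus twice the inner product. That number is an integer, hence at
  most \<open>1\<close> in absolute value, and it is even if \<open>Q\<close> is classical.\<close>

lemma minimal_vectors:
  obtains Y :: "real \<Rightarrow> nat \<times> nat \<Rightarrow> real"
  where "\<And>\<alpha>. \<alpha> \<in> S \<Longrightarrow> dot ({..<3} \<times> {..<r}) (Y \<alpha>) (Y \<alpha>) = 1"
    and "\<And>\<alpha> \<beta>. \<alpha> \<in> S \<Longrightarrow> \<beta> \<in> S \<Longrightarrow> \<alpha> \<noteq> \<beta> \<Longrightarrow> 2 * dot ({..<3} \<times> {..<r}) (Y \<alpha>) (Y \<beta>) \<in> {-1, 0, 1}"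
    and "\<And>\<alpha> \<beta>. classical_form K r Q \<Longrightarrow> \<alpha> \<in> S \<Longrightarrow> \<beta> \<in> S \<Longrightarrow> \<alpha> \<noteq> \<beta> \<Longrightarrow> dot ({..<3} \<times> {..<r}) (Y \<alpha>) (Y \<beta>) = 0"
proof -
  define I where "I = {..<3::nat} \<times> {..<r}"
  have Q: "is_quadratic_form K r Q" "totally_positive_form K r Q"
    using universal unfolding universal_form_def by auto
  obtain X :: "(nat \<Rightarrow> real) \<Rightarrow> nat \<times> nat \<Rightarrow> real"
    where norm: "\<And>v. integral_vector K r v \<Longrightarrow> dot I (X v) (X v) = height (form_value r Q v)"
    and add: "\<And>v w. integral_vector K r v \<Longrightarrow> integral_vector K r w \<Longrightarrow> 2 * dot I (X v) (X w)
         = height (form_value r Q (\<lambda>i. v i + w i)) - height (form_value r Q v) - height (form_value r Q w)"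
    and diff: "\<And>v w. integral_vector K r v \<Longrightarrow> integral_vector K r w \<Longrightarrow> - 2 * dot I (X v) (X w)
         = height (form_value r Q (\<lambda>i. v i - w i)) - height (form_value r Q v) - height (form_value r Q w)"
    using form_euclidean[OF Q, folded I_def] by blast
  have "\<exists>v. integral_vector K r v \<and> form_value r Q v = \<alpha>" if "\<alpha> \<in> S" for \<alpha>
    using universal S[OF that] unfolding universal_form_def OK_def by blast
  then obtain V where V: "\<And>\<alpha>. \<alpha> \<in> S \<Longrightarrow> integral_vector K r (V \<alpha>)" "\<And>\<alpha>. \<alpha> \<in> S \<Longrightarrow> form_value r Q (V \<alpha>) = \<alpha>"
    by metis
  have pos: "height (form_value r Q u) > 0" if "integral_vector K r u" "\<exists>i<r. u i \<noteq> 0" for u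
    using height_TP[OF form_value_OK[OF Q(1) that(1)]] Q(2) that unfolding totally_positive_form_def by blast
  have vec: "integral_vector K r (\<lambda>i. v i + w i)" "integral_vector K r (\<lambda>i. v i - w i)"
    if "integral_vector K r v" "integral_vector K r w" for v w
    using that OK_ring(1,2) unfolding integral_vector_OK by blast+
  \<comment> \<open>Used with \<open>e = 1\<close> and \<open>e = - 1\<close>: vectors equal up to
    sign have the same value, so vectors with distinct values have nonzero sum and
    difference.\<close>
  have cong: "form_value r Q v = form_value r Q w" if "\<And>i. i < r \<Longrightarrow> v i = e * w i" "e * e = 1" for v w e
    unfolding form_value_def
  proof (intro sum.cong refl)
    fix i j assume "i \<in> {..<r}" "j \<in> {i..<r}"
    then have "Q i j * v i * v j = (e * e) * (Q i j * w i * w j)" using that(1) by simp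
    then show "Q i j * v i * v j = Q i j * w i * w j" using that(2) by simp
  qed
  have dots: "2 * dot I (X (V \<alpha>)) (X (V \<beta>)) \<in> {-1, 0, 1}"
    "classical_form K r Q \<Longrightarrow> dot I (X (V \<alpha>)) (X (V \<beta>)) = 0"
    if \<alpha>\<beta>: "\<alpha> \<in> S" "\<beta> \<in> S" "\<alpha> \<noteq> \<beta>" for \<alpha> \<beta>
  proof -
    define v w where "v = V \<alpha>" and "w = V \<beta>"
    have vw: "integral_vector K r v" "integral_vector K r w" unfolding v_def w_def using V \<alpha>\<beta> by auto
    have l: "height (form_value r Q v) = 1" "height (form_value r Q w) = 1" unfolding v_def w_def using V \<alpha>\<beta> S by auto
    have ne: "form_value r Q v \<noteq> form_value r Q w" unfolding v_def w_def using V \<alpha>\<beta> by auto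
    have "\<exists>i<r. v i + w i \<noteq> 0"
    proof (rule ccontr)
      assume "\<not> ?thesis"
      then have "\<And>i. i < r \<Longrightarrow> v i = - 1 * w i" by (auto simp: eq_neg_iff_add_eq_0)
      then show False using ne cong[of v "- 1" w] by auto
    qed
    then have p1: "height (form_value r Q (\<lambda>i. v i + w i)) > 0" using vec vw by (intro pos) auto
    have "\<exists>i<r. v i - w i \<noteq> 0"
    proof (rule ccontr)
      assume "\<not> ?thesis"
      then have "\<And>i. i < r \<Longrightarrow> v i = 1 * w i" by auto
      then show False using ne cong[of v 1 w] by auto
    qed
    then have p2: "height (form_value r Q (\<lambda>i. v i - w i)) > 0" using vec vw by (intro pos) auto
    have "2 * dot I (X v) (X w) \<in> \<int>"
      unfolding add[OF vw] by (intro Ints_diff height_int form_value_OK[OF Q(1)] vec vw)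
    then obtain k where k: "2 * dot I (X v) (X w) = of_int k" by (auto elim: Ints_cases)
    have "of_int k > (- 2 :: real)" "of_int k < (2 :: real)"
      using p1 p2 add[OF vw] diff[OF vw] l k by linarith+
    then have k': "k \<in> {-1, 0, 1}" by auto
    then show "2 * dot I (X (V \<alpha>)) (X (V \<beta>)) \<in> {-1, 0, 1}" using k unfolding v_def w_def by auto
    assume classical: "classical_form K r Q"
    obtain b where b: "b \<in> OK" "form_value r Q (\<lambda>i. v i + w i) - form_value r Q v - form_value r Q w = 2 * b"
      using form_polar_even[OF Q(1) classical vw] by blast
    have "height (form_value r Q (\<lambda>i. v i + w i)) - height (form_value r Q v) - height (form_value r Q w)
        = height (form_value r Q (\<lambda>i. v i + w i) - form_value r Q v - form_value r Q w)"
      using form_value_OK[OF Q(1)] vec vw by (simp add: height_linear OK_ring)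
    also have "\<dots> = height (b + b)" unfolding b(2) by simp
    also have "\<dots> = 2 * height b" unfolding height_linear(1)[OF b(1) b(1)] by simp
    finally have "of_int k = 2 * height b" using add[OF vw] k by simp
    moreover obtain m where "height b = of_int m" using height_int[OF b(1)] by (auto elim: Ints_cases)
    ultimately have "real_of_int k = of_int (2 * m)" by simp
    then have "k = 2 * m" by (simp only: of_int_eq_iff)
    then have "k = 0" using k' by auto
    then show "dot I (X (V \<alpha>)) (X (V \<beta>)) = 0" using k unfolding v_def w_def by simp
  qed
  show ?thesis
  proof (rule that[of "\<lambda>\<alpha>. X (V \<alpha>)", folded I_def])
    show "dot I (X (V \<alpha>)) (X (V \<alpha>)) = 1" if "\<alpha> \<in> S" for \<alpha>
      using norm V S that by simp
  qed (use dots in blast)+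
qed

lemma classical_rank_bound: "classical_form K r Q \<Longrightarrow> card S \<le> 3 * r"
proof -
  assume classical: "classical_form K r Q"
  obtain Y :: "real \<Rightarrow> nat \<times> nat \<Rightarrow> real"
    where Y: "\<And>\<alpha>. \<alpha> \<in> S \<Longrightarrow> dot ({..<3} \<times> {..<r}) (Y \<alpha>) (Y \<alpha>) = 1"
    "\<And>\<alpha> \<beta>. \<alpha> \<in> S \<Longrightarrow> \<beta> \<in> S \<Longrightarrow> \<alpha> \<noteq> \<beta> \<Longrightarrow> dot ({..<3} \<times> {..<r}) (Y \<alpha>) (Y \<beta>) = 0"
    using minimal_vectors classical by metis
  then have "card S \<le> card ({..<3::nat} \<times> {..<r})"
    using fin by (intro card_le_if_orthogonal[of _ _ 1 Y]) auto
  then show ?thesis by simp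
qed

text \<open>Scaling by \<open>sqrt 2\<close> gives vectors of norm \<open>2\<close> with products in
  \<open>{-1, 0, 1}\<close> in dimension \<open>3 * r\<close>.\<close>

lemma rank_bound: "card S \<ge> 256 \<Longrightarrow> card S \<le> (3 * r)\<^sup>2"
proof -
  assume large: "card S \<ge> 256"
  obtain Y :: "real \<Rightarrow> nat \<times> nat \<Rightarrow> real"
    where Y: "\<And>\<alpha>. \<alpha> \<in> S \<Longrightarrow> dot ({..<3} \<times> {..<r}) (Y \<alpha>) (Y \<alpha>) = 1"
    "\<And>\<alpha> \<beta>. \<alpha> \<in> S \<Longrightarrow> \<beta> \<in> S \<Longrightarrow> \<alpha> \<noteq> \<beta> \<Longrightarrow> 2 * dot ({..<3} \<times> {..<r}) (Y \<alpha>) (Y \<beta>) \<in> {-1, 0, 1}"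
    using minimal_vectors by metis
  have d: "dot J (\<lambda>i. sqrt 2 * Y \<alpha> i) (\<lambda>i. sqrt 2 * Y \<beta> i) = 2 * dot J (Y \<alpha>) (Y \<beta>)" for J \<alpha> \<beta>
    unfolding dot_simps by simp
  have "card S \<le> (card ({..<3::nat} \<times> {..<r}))\<^sup>2"
    using Y fin large by (intro root_system_bound[of _ _ "\<lambda>\<alpha> i. sqrt 2 * Y \<alpha> i"]) (auto simp: d)
  then show ?thesis by simp
qed

end

lemma evi_eq_iff: "evi x y z = evi x' y' z' \<longleftrightarrow> x = x' \<and> y = y' \<and> z = z'"
  unfolding evi_def using ev_inj[of "of_int x" "of_int y" "of_int z" "of_int x'" "of_int y'" "of_int z'"] by auto

lemma twice_sum_diff: "2 * (\<Sum>v<n. n - v) = n * (n + 1)" for n :: nat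
proof (induction n)
  case (Suc n)
  have "(\<Sum>v<Suc n. Suc n - v) = Suc n + (\<Sum>v<n. n - v)"
    by (subst sum.lessThan_Suc_shift) simp
  then show ?case using Suc by simp
qed simp

text \<open>The lattice points of the triangle with vertices \<open>e\<^sub>1\<close>,
  \<open>e\<^sub>2\<close>, \<open>e\<^sub>4\<close>. Their height \<open>1\<close> is the least
  possible for totally positive integers, so none is a sum of two such integers.\<close>

lemma many_indecomposables:
  obtains S where "finite S" "\<And>\<alpha>. \<alpha> \<in> S \<Longrightarrow> \<alpha> \<in> OK \<and> TP \<alpha> \<and> height \<alpha> = 1" "2 * int (card S) = a\<^sup>2 + 3 * a + 8"
proof -
  define n where "n = nat (a + 1)"
  have n: "int n = a + 1" unfolding n_def using a_ge by simp
  \<comment> \<open>The integers \<open>w\<close> with \<open>D * v \<le> (a + 1) * w\<close> and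
    \<open>(a + 2) * w \<le> D * (v + 1)\<close>, as \<open>D = (a + 1) * (a + 2) + 1\<close>; for
    \<open>v = 0\<close> the value \<open>w = 0\<close>, the vertex \<open>\<rho>\<^sup>2\<close>,
    is left to \<open>S2\<close>.\<close>
  define W where "W v = {int v * (a + 2) + 1..(int v + 1) * (a + 1)}" for v
  define P where "P = (SIGMA v:{..<n}. W v)"
  define g where "g = (\<lambda>(v, w). evi (- int v) (- w) (int v + 1))"
  define S1 S2 where "S1 = g ` P" and "S2 = {evi 1 0 0, evi 0 0 1, evi (- 1 - a) (- D) (a + 2)}"
  have inj: "inj_on g P" unfolding g_def by (auto simp: inj_on_def evi_eq_iff)
  have finP: "finite P" unfolding P_def W_def by auto
  have "card P = (\<Sum>v<n. card (W v))" unfolding P_def W_def by (intro card_SigmaI) auto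
  also have "\<dots> = (\<Sum>v<n. n - v)"
  proof (intro sum.cong refl)
    fix v assume "v \<in> {..<n}"
    then have "int (n - v) = a + 1 - int v" using n by auto
    then show "card (W v) = n - v" unfolding W_def by (simp add: algebra_simps)
  qed
  finally have cP: "2 * card P = n * (n + 1)" using twice_sum_diff by simp
  have bounds: "0 < w \<and> w < D" if "(v, w) \<in> P" for v w
  proof -
    have v: "int v \<le> a" and w: "int v * (a + 2) + 1 \<le> w" "w \<le> (int v + 1) * (a + 1)"
      using that n unfolding P_def W_def by auto
    have "(int v + 1) * (a + 1) \<le> (a + 1) * (a + 1)" using v by (intro mult_right_mono) auto
    also have "\<dots> < D" using v by (simp add: algebra_simps power2_eq_square)
    moreover have "0 \<le> int v * (a + 2)" using v by simp
    ultimately show ?thesis using w by linarith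
  qed
  have "S1 \<inter> S2 = {}"
    unfolding S1_def S2_def g_def using bounds by (fastforce simp: evi_eq_iff)
  moreover have "card S2 = 3" unfolding S2_def using D_pos by (simp add: evi_eq_iff)
  moreover have "card S1 = card P" unfolding S1_def by (rule card_image[OF inj])
  ultimately have card: "card (S1 \<union> S2) = card P + 3"
    using finP by (subst card_Un_disjoint) (auto simp: S1_def S2_def)
  have "2 * int (card P) = int n * (int n + 1)" using arg_cong[OF cP, of int] by (simp add: algebra_simps)
  then have "2 * int (card (S1 \<union> S2)) = a\<^sup>2 + 3 * a + 8"
    unfolding card n by (simp add: algebra_simps power2_eq_square)
  moreover have "finite (S1 \<union> S2)" unfolding S1_def S2_def using finP by simp
  moreover have "\<alpha> \<in> OK \<and> TP \<alpha> \<and> height \<alpha> = 1" if "\<alpha> \<in> S1 \<union> S2" for \<alpha>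
    using that
  proof
    assume "\<alpha> \<in> S1"
    then obtain v w where \<alpha>: "\<alpha> = evi (- int v) (- w) (int v + 1)" and vw: "(v, w) \<in> P"
      unfolding S1_def g_def by auto
    have v: "int v \<le> a" and w: "int v * (a + 2) + 1 \<le> w" "w \<le> (int v + 1) * (a + 1)"
      using vw n unfolding P_def W_def by auto
    have "TP \<alpha>" unfolding \<alpha>
    proof (rule TP_cone)
      show "- w < 0" using bounds[OF vw] by simp
      have "(a + 1) * (int v * (a + 2) + 1) \<le> (a + 1) * w" using w(1) a_ge by (intro mult_left_mono) auto
      moreover have "D * int v \<le> (a + 1) * (int v * (a + 2) + 1)" using v by (simp add: algebra_simps power2_eq_square)
      ultimately show "(a + 1) * - w \<le> D * - int v" by simp
      have "(a + 2) * w \<le> (a + 2) * ((int v + 1) * (a + 1))" using w(2) a_ge by (intro mult_left_mono) auto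
      also have "\<dots> \<le> D * (int v + 1)" by (simp add: algebra_simps power2_eq_square)
      finally show "- (a + 2) * - w \<le> D * (int v + 1)" by (simp add: algebra_simps)
    qed
    then show ?thesis unfolding \<alpha> using evi_OK by (simp add: height_evi)
  next
    assume "\<alpha> \<in> S2"
    moreover have "TP (evi 1 0 0)" using TP_1 evi_int[of 1] by simp
    ultimately show ?thesis unfolding S2_def
      using TP_unit_squares evi_OK by (auto simp: height_evi)
  qed
  ultimately show ?thesis using that by blast
qed

end

section \<open>The largest root and the conclusion\<close>

text \<open>The cubic is negative at \<open>0\<close> and positive at \<open>a + 3\<close>, so it
  has a positive root and the largest one is positive.\<close>

lemma largest_root:
  fixes a :: int
  assumes "a \<ge> -1"
    and "\<rho> = Max {x::real. x ^ 3 - of_int a * x ^ 2 - (of_int a + 3) * x - 1 = 0}"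
  shows "\<rho> ^ 3 = of_int a * \<rho>\<^sup>2 + (of_int a + 3) * \<rho> + 1" "\<rho> > 0"
proof -
  define p where "p = [:- 1, - (real_of_int a + 3), - real_of_int a, 1:]"
  have poly: "poly p x = x ^ 3 - of_int a * x ^ 2 - (of_int a + 3) * x - 1" for x
    unfolding p_def by (simp add: algebra_simps power2_eq_square power3_eq_cube)
  define R where "R = {x. poly p x = 0}"
  have R: "\<rho> = Max R" unfolding assms(2) R_def poly ..
  have "finite R" unfolding R_def using poly_roots_finite[of p] unfolding p_def by simp
  have "0 < 3 + real_of_int a" using assms(1) by simp
  moreover have "poly p 0 < 0" unfolding poly by simp
  moreover have "poly p (3 + of_int a) > 0"
  proof -
    define t where "t = real_of_int a + 3"
    have t: "t \<ge> 2" unfolding t_def using assms(1) by simp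
    have "poly p t = 3 * t\<^sup>2 - t\<^sup>2 - 1" unfolding poly using t_def
      by (simp add: algebra_simps power2_eq_square power3_eq_cube)
    moreover have "t\<^sup>2 \<ge> 2\<^sup>2" using t by (intro power_mono) auto
    ultimately show ?thesis unfolding t_def by (simp add: add.commute)
  qed
  ultimately obtain x where x: "0 < x" "poly p x = 0"
    using poly_IVT_pos[of 0 "3 + of_int a" p] by blast
  then have "x \<in> R" unfolding R_def by simp
  then have "R \<noteq> {}" by blast
  then have "\<rho> \<ge> x" "\<rho> \<in> R" unfolding R using \<open>finite R\<close> \<open>x \<in> R\<close> by auto
  then show "\<rho> > 0" "\<rho> ^ 3 = of_int a * \<rho>\<^sup>2 + (of_int a + 3) * \<rho> + 1"
    using x unfolding R_def poly by auto
qed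

theorem theorem1p1:
  fixes a :: int and \<rho> :: real and K :: "real set"
  assumes "a \<ge> -1"
    and "\<rho> = Max {x::real. x ^ 3 - of_int a * x ^ 2 - (of_int a + 3) * x - 1 = 0}"
    and "K = rat_adjoin \<rho>"
    and "ring_of_integers K = int_adjoin \<rho>"
  shows "(\<exists>A. universal_form K (nat (3 * (a ^ 2 + 3 * a + 6))) A
             \<and> diagonal_form (nat (3 * (a ^ 2 + 3 * a + 6))) A)
    \<and> (\<forall>r A. universal_form K r A \<and> classical_form K r A \<longrightarrow>
           real r \<ge> (of_int a ^ 2 + 3 * of_int a + 8) / 6)
    \<and> (a \<ge> 21 \<longrightarrow> (\<forall>r A. universal_form K r A \<longrightarrow>
           real r \<ge> sqrt (of_int a ^ 2 + 3 * of_int a + 8) / (3 * sqrt 2)))"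
proof -
  interpret simplest_cubic_integers a \<rho>
    by unfold_locales (use assms largest_root[OF assms(1,2)] in auto)
  have K: "K = simplest_cubic.K \<rho>" unfolding K_def assms(3) ..
  obtain S where S: "finite S" "\<And>\<alpha>. \<alpha> \<in> S \<Longrightarrow> \<alpha> \<in> OK \<and> totally_positive K \<alpha> \<and> height \<alpha> = 1"
    and card: "2 * int (card S) = a\<^sup>2 + 3 * a + 8"
    using many_indecomposables unfolding K by blast
  have card': "2 * real (card S) = of_int a ^ 2 + 3 * of_int a + 8"
    using arg_cong[OF card, of real_of_int] by simp
  have "\<exists>A. universal_form K (nat (3 * (a ^ 2 + 3 * a + 6))) A \<and> diagonal_form (nat (3 * (a ^ 2 + 3 * a + 6))) A"
  proof (cases "a = -1")
    case True
    then show ?thesis using diagonal_universal_minus_one unfolding K by simp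
  next
    case False
    then show ?thesis using diagonal_universal_nonneg assms(1) unfolding K by simp
  qed
  moreover have "real r \<ge> (of_int a ^ 2 + 3 * of_int a + 8) / 6"
    if "universal_form K r A" "classical_form K r A" for r A
  proof -
    have "card S \<le> 3 * r" using classical_rank_bound[of r A S] that S unfolding K by blast
    then show ?thesis unfolding card'[symmetric] by simp
  qed
  moreover have "real r \<ge> sqrt (of_int a ^ 2 + 3 * of_int a + 8) / (3 * sqrt 2)"
    if a: "a \<ge> 21" and "universal_form K r A" for r A
  proof -
    \<comment> \<open>At \<open>a = 21\<close> the number \<open>(a\<^sup>2 + 3 a + 8) / 2\<close>
      of lattice points is exactly \<open>256\<close>, the threshold of
      \<open>rank_bound\<close>.\<close>
    have "a\<^sup>2 \<ge> 21\<^sup>2" using a by (intro power_mono) auto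
    then have "card S \<ge> 256" using card a by simp
    then have "card S \<le> (3 * r)\<^sup>2" using rank_bound[of r A S] that(2) S unfolding K by blast
    then have "real (card S) \<le> real ((3 * r)\<^sup>2)" by (simp only: of_nat_le_iff)
    then have "sqrt (real (card S)) \<le> 3 * real r" by (intro real_le_lsqrt) auto
    moreover have "sqrt (of_int a ^ 2 + 3 * of_int a + 8) = sqrt 2 * sqrt (real (card S))"
      unfolding card'[symmetric] real_sqrt_mult ..
    ultimately show ?thesis by simp
  qed
  ultimately show ?thesis by blast
qed

end
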